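(* Let $k\ge3$ and $\beta\le0$. Let $G_N=(\mathbf{A}_N,\mathbf{h}_N=\mathbf{0})$ be a sequence of $k$-regular graphs, $G_N$ on vertex set $[N]$, converging locally to the $k$-regular tree, with edge weights $A_{ij}=\beta$ for all $\{i,j\}\in E(G_N)$ and $A_{ij}=0$ otherwise. Let $\mathbf{A}_N^\perp=\mathbf{P}^\perp\mathbf{A}_N\mathbf{P}^\perp$, where $\mathbf{P}^\perp=\mathbf{I}-\mathbf{1}\mathbf{1}^{T}/N$. If there is an interval $I$ of length less than $1$, independent of $N$, such that $\lambda_{\max}(\mathbf{A}_N^\perp),\lambda_{\min}(\mathbf{A}_N^\perp)\in I$, then $$\lim_{N\to\infty}F(G_N)=\log2+\frac{k}{2}\log\cosh(\beta).$$
   Context: Here $\mathbf{1}\in\mathbb{R}^N$ is the all-ones vector, $\lambda_{\max},\lambda_{\min}$ denote the largest and smallest eigenvalues of a symmetric matrix, and the Ising free energy density of $(\mathbf{A},\mathbf{h})$ on $[N]$ is $$F(\mathbf{A},\mathbf{h})=\frac1N\log\sum_{\boldsymbol\sigma\in\{-1,1\}^N}\exp\Big(\tfrac12\langle\boldsymbol\sigma,\mathbf{A}\boldsymbol\sigma\rangle+\langle\mathbf{h},\boldsymbol\sigma\rangle\Big).$$ Converging locally to the $k$-regular tree means (Benjamini–Schramm local weak convergence): for every fixed $r$, the fraction of vertices of $G_N$ whose radius-$r$ neighborhood is isomorphic to the radius-$r$ ball of the infinite $k$-regular tree tends to $1$. The limit is taken along those $N$ for which $G_N$ is defined. *)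

theory Defs
  imports
    "HOL-Analysis.Analysis"
    "Jordan_Normal_Form.Char_Poly"
    "Graph_Theory.Graph_Theory"
begin

section \<open>The Ising free energy density\<close>

definition spins :: "nat \<Rightarrow> real vec set" where
  "spins N = {\<sigma> \<in> carrier_vec N. \<forall>i<N. vec_index \<sigma> i \<in> {-1, 1}}"

text \<open>The sum in the free energy is a genuine finite sum.\<close>

lemma finite_spins: "finite (spins N)"
proof (rule finite_subset)
  show "spins N \<subseteq> vec N ` ({..<N} \<rightarrow>\<^sub>E {-1, 1})"
  proof
    fix \<sigma> assume s: "\<sigma> \<in> spins N"
    have "\<sigma> = vec N (restrict (vec_index \<sigma>) {..<N})"
      using s by (intro eq_vecI) (auto simp: spins_def)
    moreover have "restrict (vec_index \<sigma>) {..<N} \<in> {..<N} \<rightarrow>\<^sub>E {-1, 1}"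
      using s by (auto simp: spins_def)
    ultimately show "\<sigma> \<in> vec N ` ({..<N} \<rightarrow>\<^sub>E {-1, 1})"
      by blast
  qed
  show "finite (vec N ` ({..<N} \<rightarrow>\<^sub>E {-1, 1 :: real}))"
    by (intro finite_imageI finite_PiE) auto
qed

definition ising_free_energy :: "real mat \<Rightarrow> real vec \<Rightarrow> real" where
  "ising_free_energy A h =
     1 / real (dim_row A) *
     ln (\<Sum>\<sigma>\<in>spins (dim_row A). exp (1/2 * scalar_prod \<sigma> (A *\<^sub>v \<sigma>) + scalar_prod h \<sigma>))"


section \<open>Extreme eigenvalues and the projection orthogonal to the all-ones vector\<close>

text \<open>Only meant for symmetric real matrices of positive dimension; all their complex eigenvalues
  are real, so the set of real eigenvalues is the whole (finite, nonempty) spectrum.\<close>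

definition lambda_max :: "real mat \<Rightarrow> real" where
  "lambda_max A = Max {x. eigenvalue A x}"

definition lambda_min :: "real mat \<Rightarrow> real" where
  "lambda_min A = Min {x. eigenvalue A x}"

definition P_perp :: "nat \<Rightarrow> real mat" where
  "P_perp N = 1\<^sub>m N - mat N N (\<lambda>(i, j). 1 / real N)"

definition perp_part :: "real mat \<Rightarrow> real mat" where
  "perp_part A = P_perp (dim_row A) * A * P_perp (dim_row A)"


section \<open>Regular graphs and local convergence to the regular tree\<close>

text \<open>A finite simple graph is a \<^term>\<open>pair_graph\<close>: a finite, symmetric and loop-free set of
  ordered pairs. The edge \<open>{i, j}\<close> is present iff \<open>(i, j)\<close> (equivalently \<open>(j, i)\<close>) is an arc, and
  the degree of a vertex is its out-degree.\<close>

definition regular :: "nat \<Rightarrow> 'a pair_pre_digraph \<Rightarrow> bool" where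
  "regular k G \<longleftrightarrow> (\<forall>v \<in> pverts G. out_degree (with_proj G) v = k)"

definition weight_matrix :: "nat \<Rightarrow> real \<Rightarrow> nat pair_pre_digraph \<Rightarrow> real mat" where
  "weight_matrix N \<beta> G = mat N N (\<lambda>(i, j). if (i, j) \<in> parcs G then \<beta> else 0)"

text \<open>The infinite \<open>k\<close>-regular tree as the Cayley graph of the free product of \<open>k\<close> copies
  of the group of order two: vertices are the words over \<open>k\<close> letters without two equal adjacent
  letters, and a word is joined to the words obtained from it by adding or deleting its first
  letter. The root is the empty word.\<close>

definition tree_words :: "nat \<Rightarrow> nat list set" where
  "tree_words k = {w. set w \<subseteq> {..<k} \<and> distinct_adj w}"

definition regular_tree :: "nat \<Rightarrow> nat list pair_pre_digraph" where
  "regular_tree k = \<lparr> pverts = tree_words k,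
     parcs = {(u, v). u \<in> tree_words k \<and> v \<in> tree_words k \<and> (\<exists>x. v = x # u \<or> u = x # v)} \<rparr>"

lemma regular_regular_tree:
  assumes "k \<ge> 1"
  shows "regular k (regular_tree k)"
  unfolding regular_def
proof
  fix w assume "w \<in> pverts (regular_tree k)"
  then have w: "set w \<subseteq> {..<k}" "distinct_adj w"
    by (auto simp: regular_tree_def tree_words_def)
  let ?D = "out_arcs (with_proj (regular_tree k)) w"
  have D: "?D = {(w, v) |v. v \<in> tree_words k \<and> (\<exists>x. v = x # w \<or> w = x # v)}"
    using w by (auto simp: out_arcs_def regular_tree_def tree_words_def)
  show "out_degree (with_proj (regular_tree k)) w = k"
  proof (cases w)
    case Nil
    have "?D = (\<lambda>x. (w, x # w)) ` {..<k}"
      unfolding D using w Nil by (auto simp: tree_words_def)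
    then show ?thesis
      by (simp add: out_degree_def card_image inj_on_def)
  next
    case (Cons y u)
    have "?D = insert (w, u) ((\<lambda>x. (w, x # w)) ` ({..<k} - {y}))"
      unfolding D using w Cons by (auto simp: tree_words_def dest: distinct_adj_ConsD)
    moreover have "(w, u) \<notin> (\<lambda>x. (w, x # w)) ` ({..<k} - {y})"
      using Cons by auto
    moreover have "card ((\<lambda>x. (w, x # w)) ` ({..<k} - {y})) = k - 1"
      using w Cons by (subst card_image) (auto simp: inj_on_def)
    ultimately show ?thesis
      using assms by (simp add: out_degree_def)
  qed
qed

definition graph_ball :: "'a pair_pre_digraph \<Rightarrow> nat \<Rightarrow> 'a \<Rightarrow> 'a set" where
  "graph_ball G r u = {v. \<exists>p. pre_digraph.awalk (with_proj G) u p v \<and> length p \<le> r}"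

definition rooted_iso ::
  "('a, 'b) pre_digraph \<Rightarrow> 'a \<Rightarrow> ('c, 'd) pre_digraph \<Rightarrow> 'c \<Rightarrow> bool" where
  "rooted_iso G u H v \<longleftrightarrow>
     (\<exists>f. pre_digraph.digraph_isomorphism G f \<and> H = app_iso f G \<and> iso_verts f u = v)"

definition tree_like :: "nat \<Rightarrow> nat \<Rightarrow> 'a pair_pre_digraph \<Rightarrow> 'a \<Rightarrow> bool" where
  "tree_like k r G v \<longleftrightarrow>
     rooted_iso (induce_subgraph (with_proj G) (graph_ball G r v)) v
       (induce_subgraph (with_proj (regular_tree k)) (graph_ball (regular_tree k) r [])) []"

text \<open>Limits along the index set \<open>S\<close> are taken with respect to the
  filter \<^term>\<open>inf sequentially (principal S)\<close>.\<close>

definition converges_locally_to_tree ::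
  "nat \<Rightarrow> nat set \<Rightarrow> (nat \<Rightarrow> 'a pair_pre_digraph) \<Rightarrow> bool" where
  "converges_locally_to_tree k S G \<longleftrightarrow>
     (\<forall>r. ((\<lambda>N. real (card {v \<in> pverts (G N). tree_like k r (G N) v}) / real (card (pverts (G N))))
            \<longlongrightarrow> 1) (inf sequentially (principal S)))"

end

theory Submission
  imports Defs "HOL-Probability.Distributions"
begin

text \<open>
  Let \<open>E\<close> be the adjacency matrix, so that the weight matrix is \<open>\<beta> E\<close>. Differentiate the free energy in the inverse temperature
  \<open>s \<in> [\<beta>, 0]\<close>. The derivative is the average of \<open>\<langle>\<sigma>\<^sub>x \<sigma>\<^sub>y\<rangle>\<^sub>s\<close> over the edges, times \<open>k/2\<close>, while
  \<open>\<partial>\<^sub>s ln cosh s = tanh s\<close>. Since both sides agree at \<open>s = 0\<close>, the mean value theorem reduces the claim to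
  \<open>\<langle>\<sigma>\<^sub>x \<sigma>\<^sub>y\<rangle>\<^sub>s \<approx> tanh s\<close>, uniformly in \<open>s\<close>, for every edge at a vertex whose neighbourhood is a tree
  (lemmas \<open>corr_tree_like\<close>, \<open>mean_energy_estimate\<close> and \<open>free_energy_estimate\<close>).

  On a tree this correlation is exactly computable: conditioning on the spins at distance \<open>n\<close>, belief
  propagation gives \<open>\<langle>\<sigma>\<^sub>x \<sigma>\<^sub>y\<rangle> = \<langle>(t + tanh X tanh Y) / (1 + t tanh X tanh Y)\<rangle>\<close> with \<open>t = tanh s\<close>, where \<open>X\<close> and
  \<open>Y\<close> are the cavity fields that the far-away spins exert on the two ends of the edge
  (\<open>tree_edge_correlation\<close>, \<open>edge_corr_bound\<close>). So \<open>X\<close> and \<open>Y\<close> must be small in mean square. They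
  are odd functions of the boundary spins, hence have mean zero, and flipping one boundary spin changes them by at
  most \<open>2 \<bar>s\<bar> \<bar>t\<bar>\<^sup>n\<close>, because the recursion for cavity fields contracts by \<open>\<bar>t\<bar>\<close> at each level
  (\<open>cavity_field_flip\<close>). The number of boundary spins is of order \<open>(k - 1)\<^sup>n\<close>. A Poincare inequality with a bounded constant
  therefore gives \<open>\<langle>X\<^sup>2\<rangle> = O(((k - 1) t\<^sup>2)\<^sup>n)\<close>, and \<open>(k - 1) t\<^sup>2 < 1\<close> is itself a consequence of the spectral
  hypothesis, tested on the star around a single vertex (\<open>spectral_width_star\<close>).

  The Poincare inequality is where the spectral width below one enters (\<open>ising_variance_bound\<close>). It holds for
  the projected matrix: shifting the diagonal puts its spectrum into \<open>[\<epsilon>, 1 - \<epsilon>]\<close>, and the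
  Hubbard--Stratonovich transformation then writes the Gibbs measure as a mixture of product measures over a
  Gaussian field whose density is strongly log-concave. Concentration for such mixtures follows from the
  Prekopa--Leindler inequality and a bounded-difference estimate for product measures
  (\<open>prekopa_leindler\<close>, \<open>product_mgf\<close>, \<open>ising_exp_concentration\<close>).

  Finally, the weight matrix differs from its projection by the rank-one term \<open>(\<beta> k / N) 1 1\<^sup>T\<close>, which for
  \<open>\<beta> \<le> 0\<close> only lowers the Gibbs weights. Since the magnetisation has variance \<open>O(N)\<close> in the projected model, the
  partition functions differ by a bounded factor (\<open>perp_le_weight\<close>), and second moments of nonnegative quantities
  can be transferred from the projected model to the original one.
\<close>

section \<open>The Prekopa--Leindler inequality\<close>

text \<open>The one-dimensional Brunn--Minkowski inequality. Compactness is avoided by translating \<open>A\<close> and \<open>B\<close> by points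
  that almost attain \<open>Inf B\<close> and \<open>Sup A\<close>.\<close>

lemma emeasure_half_sum_ge:
  fixes A B C :: "real set"
  assumes [measurable]: "A \<in> sets borel" "B \<in> sets borel" "C \<in> sets borel"
    and "bounded A" "bounded B" "A \<noteq> {}" "B \<noteq> {}"
    and sum: "\<And>a b. a \<in> A \<Longrightarrow> b \<in> B \<Longrightarrow> (a + b) / 2 \<in> C"
  shows "emeasure lborel A + emeasure lborel B \<le> 2 * emeasure lborel C"
proof (rule ennreal_le_epsilon)
  fix e :: real assume "0 < e"
  have bA: "bdd_above A" and bB: "bdd_below B"
    using assms by (auto intro: bounded_imp_bdd_above bounded_imp_bdd_below)
  obtain a' where a': "a' \<in> A" "Sup A - e / 2 < a'"
    using less_cSup_iff[OF \<open>A \<noteq> {}\<close> bA, of "Sup A - e / 2"] \<open>0 < e\<close> by auto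
  obtain b' where b': "b' \<in> B" "b' < Inf B + e / 2"
    using cInf_less_iff[OF \<open>B \<noteq> {}\<close> bB, of "Inf B + e / 2"] \<open>0 < e\<close> by auto
  define A1 where "A1 = {x. x - b' \<in> A}"
  define B1 where "B1 = {x. x - a' \<in> B}"
  define D where "D = {x. x / 2 \<in> C}"
  have meas[measurable]: "A1 \<in> sets borel" "B1 \<in> sets borel" "D \<in> sets borel"
    unfolding A1_def B1_def D_def by measurable
  have shift: "emeasure lborel {x. x - t \<in> E} = emeasure lborel E"
    if [measurable]: "E \<in> sets borel" for E and t :: real
  proof -
    have "emeasure lborel E = (\<integral>\<^sup>+x. indicator E x \<partial>lborel)"
      using that by simp
    also have "\<dots> = (\<integral>\<^sup>+x. indicator E (- t + 1 * x) \<partial>lborel)"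
      using nn_integral_real_affine[of "indicator E" 1 "-t"] that by simp
    also have "\<dots> = (\<integral>\<^sup>+x. indicator {x. x - t \<in> E} x \<partial>lborel)"
      by (intro nn_integral_cong) (auto simp: indicator_def)
    also have "\<dots> = emeasure lborel {x. x - t \<in> E}"
      by (intro nn_integral_indicator) simp
    finally show ?thesis ..
  qed
  have scale: "emeasure lborel D = 2 * emeasure lborel C"
  proof -
    have "emeasure lborel D = (\<integral>\<^sup>+x. indicator D x \<partial>lborel)"
      by simp
    also have "\<dots> = 2 * (\<integral>\<^sup>+x. indicator D (0 + 2 * x) \<partial>lborel)"
      using nn_integral_real_affine[of "indicator D" 2 "0"] by simp
    also have "(\<integral>\<^sup>+x. indicator D (0 + 2 * x) \<partial>lborel) = (\<integral>\<^sup>+x. indicator C x \<partial>lborel)"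
      by (intro nn_integral_cong) (auto simp: indicator_def D_def)
    finally show ?thesis by simp
  qed
  \<comment> \<open>Both translates lie in the doubled set, and they overlap only in a tiny interval near \<open>Sup A + Inf B\<close>.\<close>
  have "A1 \<inter> B1 \<subseteq> {a' + Inf B .. Sup A + b'}"
  proof
    fix x assume "x \<in> A1 \<inter> B1"
    then have "x - b' \<le> Sup A" "Inf B \<le> x - a'"
      using bA bB by (auto simp: A1_def B1_def intro: cSup_upper cInf_lower)
    then show "x \<in> {a' + Inf B .. Sup A + b'}" by auto
  qed
  then have "emeasure lborel (A1 \<inter> B1) \<le> emeasure lborel {a' + Inf B .. Sup A + b'}"
    by (intro emeasure_mono) auto
  also have "\<dots> \<le> ennreal e"
    using a' b' \<open>0 < e\<close> by (cases "a' + Inf B \<le> Sup A + b'") (auto intro!: ennreal_leI)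
  finally have int: "emeasure lborel (A1 \<inter> B1) \<le> ennreal e" .
  have sub: "A1 \<union> B1 \<subseteq> D"
  proof
    fix x assume "x \<in> A1 \<union> B1"
    then show "x \<in> D"
      using sum[of "x - b'" b'] sum[of a' "x - a'"] a' b' by (auto simp: A1_def B1_def D_def)
  qed
  have "emeasure lborel A + emeasure lborel B = emeasure lborel A1 + emeasure lborel B1"
    unfolding A1_def B1_def by (simp add: shift)
  also have "\<dots> = emeasure lborel (A1 \<union> B1) + emeasure lborel (A1 \<inter> B1)"
    using emeasure_Un_Int[of A1 lborel B1] by simp
  also have "\<dots> \<le> 2 * emeasure lborel C + ennreal e"
    using int scale emeasure_mono[OF sub, of lborel] by (intro add_mono) auto
  finally show "emeasure lborel A + emeasure lborel B \<le> 2 * emeasure lborel C + ennreal e" .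
qed

lemma nn_integral_layer_cake_unit:
  fixes u :: "real \<Rightarrow> ennreal"
  assumes [measurable]: "u \<in> borel_measurable borel"
  shows "(\<integral>\<^sup>+l. indicator {0<..<1} l * emeasure lborel {x. ennreal l < u x} \<partial>lborel) = (\<integral>\<^sup>+x. min (u x) 1 \<partial>lborel)"
proof -
  let ?k = "\<lambda>l x. indicator {0<..<1} l * indicator {x. ennreal l < u x} x :: ennreal"
  have m[measurable]: "(\<lambda>(l, x). ?k l x) \<in> borel_measurable (lborel \<Otimes>\<^sub>M lborel)"
    unfolding indicator_def by measurable
  have "(\<integral>\<^sup>+l. indicator {0<..<1} l * emeasure lborel {x. ennreal l < u x} \<partial>lborel)
      = (\<integral>\<^sup>+l. \<integral>\<^sup>+x. ?k l x \<partial>lborel \<partial>lborel)"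
    by (intro nn_integral_cong) (simp add: nn_integral_cmult)
  also have "\<dots> = (\<integral>\<^sup>+x. \<integral>\<^sup>+l. ?k l x \<partial>lborel \<partial>lborel)"
    using lborel_pair.Fubini'[OF m] by simp
  also have "\<dots> = (\<integral>\<^sup>+x. min (u x) 1 \<partial>lborel)"
  proof (rule nn_integral_cong)
    fix x :: real
    have "min (u x) 1 \<noteq> \<infinity>"
      using min.cobounded2[of "u x" 1] by (auto simp: top_unique simp del: min.cobounded2)
    then obtain c where c: "0 \<le> c" "min (u x) 1 = ennreal c"
      by (cases "min (u x) 1") auto
    have "(\<integral>\<^sup>+l. ?k l x \<partial>lborel) = (\<integral>\<^sup>+l. indicator {0<..<c} l \<partial>lborel)"
    proof (rule nn_integral_cong)
      fix l :: real
      have "(0 < l \<and> l < 1 \<and> ennreal l < u x) \<longleftrightarrow> (0 < l \<and> l < c)"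
      proof (cases "0 < l")
        case True
        then have "(l < 1 \<and> ennreal l < u x) \<longleftrightarrow> ennreal l < min (u x) 1" by (auto simp: ennreal_less_one_iff)
        also have "\<dots> \<longleftrightarrow> l < c" using True c by (simp add: ennreal_less_iff)
        finally show ?thesis using True by simp
      qed simp
      then show "?k l x = indicator {0<..<c} l" by (auto simp: indicator_def)
    qed
    also have "\<dots> = ennreal c" using c by simp
    finally show "(\<integral>\<^sup>+l. ?k l x \<partial>lborel) = min (u x) 1" using c by simp
  qed
  finally show ?thesis .
qed

text \<open>When both suprema are one, the superlevel sets at every level below one are nonempty, so that
  Brunn--Minkowski applies to them; integrating over the level gives an arithmetic-mean form of the inequality.\<close>

lemma prekopa_leindler_normalised:
  fixes f g h :: "real \<Rightarrow> ennreal"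
  assumes [measurable]: "f \<in> borel_measurable borel" "g \<in> borel_measurable borel" "h \<in> borel_measurable borel"
    and le1: "\<And>x. f x \<le> 1" "\<And>x. g x \<le> 1"
    and sup1: "\<And>l. l < 1 \<Longrightarrow> \<exists>x. l < f x" "\<And>l. l < 1 \<Longrightarrow> \<exists>x. l < g x"
    and bdd: "bounded {x. f x \<noteq> 0}" "bounded {x. g x \<noteq> 0}"
    and fgh: "\<And>x y. f x * g y \<le> (h ((x + y) / 2))\<^sup>2"
  shows "(\<integral>\<^sup>+x. f x \<partial>lborel) + (\<integral>\<^sup>+x. g x \<partial>lborel) \<le> 2 * (\<integral>\<^sup>+x. h x \<partial>lborel)"
proof -
  let ?I = "indicator {0<..<1} :: real \<Rightarrow> ennreal"
  let ?m = "\<lambda>u l. ?I l * emeasure lborel {x. ennreal l < u x}"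
  have m[measurable]: "?m u \<in> borel_measurable borel" if [measurable]: "u \<in> borel_measurable borel" for u
  proof -
    have "(\<lambda>l. \<integral>\<^sup>+x. indicator {x. ennreal l < u x} x \<partial>lborel) \<in> borel_measurable borel"
      unfolding indicator_def by measurable
    moreover have "(\<integral>\<^sup>+x. indicator {x. ennreal l < u x} x \<partial>lborel) = emeasure lborel {x. ennreal l < u x}" for l
      by (intro nn_integral_indicator) simp
    ultimately show ?thesis by simp
  qed
  have level: "?m f l + ?m g l \<le> 2 * ?m h l" for l :: real
  proof (cases "0 < l \<and> l < 1")
    case True
    have "emeasure lborel {x. ennreal l < f x} + emeasure lborel {x. ennreal l < g x}
        \<le> 2 * emeasure lborel {x. ennreal l < h x}"
    proof (rule emeasure_half_sum_ge)
      show "bounded {x. ennreal l < f x}" "bounded {x. ennreal l < g x}"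
        by (rule bounded_subset[OF bdd(1)], force, rule bounded_subset[OF bdd(2)], force)
      show "{x. ennreal l < f x} \<noteq> {}" "{x. ennreal l < g x} \<noteq> {}"
        using sup1[of "ennreal l"] True by (auto simp: ennreal_less_one_iff)
    next
      fix a b assume "a \<in> {x. ennreal l < f x}" "b \<in> {x. ennreal l < g x}"
      then have "ennreal l < f a" "ennreal l < g b" by auto
      then have "ennreal l * ennreal l < ennreal l * g b"
        using True by (intro ennreal_mult_strict_left_mono) auto
      also have "\<dots> \<le> f a * g b"
        using \<open>ennreal l < f a\<close> by (intro mult_right_mono) auto
      also note fgh[of a b]
      finally have "(ennreal l)\<^sup>2 < (h ((a + b) / 2))\<^sup>2" by (simp add: power2_eq_square)
      then have "ennreal l < h ((a + b) / 2)"
        using power_mono[of "h ((a + b) / 2)" "ennreal l" 2] by (intro not_le_imp_less notI) auto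
      then show "(a + b) / 2 \<in> {x. ennreal l < h x}" by simp
    qed measurable
    then show ?thesis using True by simp
  qed auto
  have "(\<integral>\<^sup>+x. f x \<partial>lborel) + (\<integral>\<^sup>+x. g x \<partial>lborel)
      = (\<integral>\<^sup>+x. min (f x) 1 \<partial>lborel) + (\<integral>\<^sup>+x. min (g x) 1 \<partial>lborel)"
    using le1 by (simp add: min_absorb1)
  also have "\<dots> = (\<integral>\<^sup>+l. ?m f l \<partial>lborel) + (\<integral>\<^sup>+l. ?m g l \<partial>lborel)"
    by (simp add: nn_integral_layer_cake_unit)
  also have "\<dots> = (\<integral>\<^sup>+l. ?m f l + ?m g l \<partial>lborel)"
    by (rule nn_integral_add[symmetric]) auto
  also have "\<dots> \<le> (\<integral>\<^sup>+l. 2 * ?m h l \<partial>lborel)"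
    by (intro nn_integral_mono level)
  also have "\<dots> = 2 * (\<integral>\<^sup>+x. min (h x) 1 \<partial>lborel)"
    by (subst nn_integral_cmult) (auto simp: nn_integral_layer_cake_unit)
  also have "\<dots> \<le> 2 * (\<integral>\<^sup>+x. h x \<partial>lborel)"
    by (intro mult_left_mono nn_integral_mono) auto
  finally show ?thesis .
qed

text \<open>Dividing \<open>f\<close> and \<open>g\<close> by their suprema \<open>a\<close>, \<open>b\<close> and \<open>h\<close> by \<open>\<surd>(a b)\<close> keeps the hypothesis and leads to the
  normalised case; the inequality of arithmetic and geometric means turns its sum into a product.\<close>

lemma prekopa_leindler_bounded:
  fixes f g h :: "real \<Rightarrow> ennreal"
  assumes [measurable]: "f \<in> borel_measurable borel" "g \<in> borel_measurable borel" "h \<in> borel_measurable borel"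
    and fin: "(SUP x. f x) < \<infinity>" "(SUP x. g x) < \<infinity>"
    and bdd: "bounded {x. f x \<noteq> 0}" "bounded {x. g x \<noteq> 0}"
    and fgh: "\<And>x y. f x * g y \<le> (h ((x + y) / 2))\<^sup>2"
  shows "(\<integral>\<^sup>+x. f x \<partial>lborel) * (\<integral>\<^sup>+x. g x \<partial>lborel) \<le> (\<integral>\<^sup>+x. h x \<partial>lborel)\<^sup>2"
proof (cases "(SUP x. f x) = 0 \<or> (SUP x. g x) = 0")
  case True
  then have "(\<forall>x. f x = 0) \<or> (\<forall>x. g x = 0)"
    by (auto simp: SUP_eq_iff bot_ennreal[symmetric] simp del: bot_ennreal)
  then show ?thesis by auto
next
  case False
  obtain a where a: "(SUP x. f x) = ennreal a" "0 < a"
    using fin False by (cases "SUP x. f x") (auto simp: top_unique less_le)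
  obtain b where b: "(SUP x. g x) = ennreal b" "0 < b"
    using fin False by (cases "SUP x. g x") (auto simp: top_unique less_le)
  have one: "ennreal c * ennreal (1 / c) = 1" if "0 < c" for c
    using that by (simp add: ennreal_mult[symmetric])
  have sup: "\<exists>x. l < ennreal (1 / c) * u x"
    if c: "(SUP x. u x) = ennreal c" "0 < c" and "l < 1" for l c and u :: "real \<Rightarrow> ennreal"
  proof -
    have "ennreal c * l < ennreal c * 1"
      using that by (intro ennreal_mult_strict_left_mono) auto
    then have "ennreal c * l < (SUP x. u x)"
      using c(1) by simp
    then obtain x where x: "ennreal c * l < u x"
      unfolding less_SUP_iff by blast
    have "l = ennreal (1 / c) * (ennreal c * l)"
      unfolding mult.assoc[symmetric] mult.commute[of "ennreal (1 / c)"] one[OF c(2)] by simp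
    also have "\<dots> < ennreal (1 / c) * u x"
      using x c by (intro ennreal_mult_strict_left_mono) auto
    finally show ?thesis by blast
  qed
  have le: "ennreal (1 / c) * u x \<le> 1"
    if c: "(SUP x. u x) = ennreal c" "0 < c" for x c and u :: "real \<Rightarrow> ennreal"
  proof -
    have "u x \<le> ennreal c" unfolding c(1)[symmetric] by (rule SUP_upper) simp
    then have "ennreal (1 / c) * u x \<le> ennreal (1 / c) * ennreal c" by (intro mult_left_mono) auto
    then show ?thesis using one[OF c(2)] by (simp add: mult.commute)
  qed
  define c where "c = sqrt (a * b)"
  have c: "0 < c" "c\<^sup>2 = a * b" using a b by (auto simp: c_def)
  have cc: "(ennreal (1 / c))\<^sup>2 = ennreal (1 / a) * ennreal (1 / b)"
    using a b c by (simp add: ennreal_power ennreal_mult[symmetric] power_divide)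
  define F where "F = (\<integral>\<^sup>+x. f x \<partial>lborel)"
  define G where "G = (\<integral>\<^sup>+x. g x \<partial>lborel)"
  define H where "H = (\<integral>\<^sup>+x. h x \<partial>lborel)"
  have "(\<integral>\<^sup>+x. ennreal (1 / a) * f x \<partial>lborel) + (\<integral>\<^sup>+x. ennreal (1 / b) * g x \<partial>lborel)
      \<le> 2 * (\<integral>\<^sup>+x. ennreal (1 / c) * h x \<partial>lborel)"
  proof (rule prekopa_leindler_normalised)
    fix x y
    have "ennreal (1 / a) * f x * (ennreal (1 / b) * g y) = (ennreal (1 / c))\<^sup>2 * (f x * g y)"
      unfolding cc by (simp add: ac_simps)
    also have "\<dots> \<le> (ennreal (1 / c))\<^sup>2 * (h ((x + y) / 2))\<^sup>2"
      by (intro mult_left_mono fgh) auto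
    finally show "ennreal (1 / a) * f x * (ennreal (1 / b) * g y) \<le> (ennreal (1 / c) * h ((x + y) / 2))\<^sup>2"
      by (simp add: power_mult_distrib)
  next
    show "bounded {x. ennreal (1 / a) * f x \<noteq> 0}" "bounded {x. ennreal (1 / b) * g x \<noteq> 0}"
      by (rule bounded_subset[OF bdd(1)], force, rule bounded_subset[OF bdd(2)], force)
  qed (use a b le sup in auto)
  then have *: "ennreal (1 / a) * F + ennreal (1 / b) * G \<le> 2 * (ennreal (1 / c) * H)"
    unfolding F_def G_def H_def by (simp add: nn_integral_cmult)
  have "F * G \<le> H\<^sup>2"
  proof (cases "H = \<infinity>")
    case True then show ?thesis by (simp add: power2_eq_square ennreal_top_mult)
  next
    case False
    then obtain H' where H': "H = ennreal H'" "0 \<le> H'" by (cases H) auto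
    have fin: "2 * (ennreal (1 / c) * H) < \<infinity>"
      using H' by (simp add: ennreal_mult[symmetric] ennreal_mult_less_top)
    have "ennreal (1 / a) * F < \<infinity>" "ennreal (1 / b) * G < \<infinity>"
      using le_less_trans[OF * fin] by auto
    then have "F < \<infinity>" "G < \<infinity>"
      using a b by (auto simp: ennreal_mult_less_top)
    then obtain F' G' where FG: "F = ennreal F'" "0 \<le> F'" "G = ennreal G'" "0 \<le> G'"
      by (cases F; cases G) auto
    have "ennreal (1 / a * F' + 1 / b * G') = ennreal (1 / a) * F + ennreal (1 / b) * G"
      using a b FG by (subst ennreal_plus) (auto simp: ennreal_mult[symmetric])
    also note *
    also have "2 * (ennreal (1 / c) * H) = ennreal (2 * (1 / c * H'))"
      using c H' by (simp add: ennreal_mult[symmetric] flip: ennreal_numeral)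
    finally have "ennreal (1 / a * F' + 1 / b * G') \<le> ennreal (2 * (1 / c * H'))" .
    then have **: "1 / a * F' + 1 / b * G' \<le> 2 * (1 / c * H')"
      using c H' by (subst (asm) ennreal_le_iff) auto
    have "4 * ((1 / a * F') * (1 / b * G')) \<le> (1 / a * F' + 1 / b * G')\<^sup>2"
      using sum_squares_bound[of "1 / a * F'" "1 / b * G'"] by (simp add: power2_sum)
    also have "\<dots> \<le> (2 * (1 / c * H'))\<^sup>2"
      using ** a b FG by (intro power_mono) auto
    finally have "(F' * G') / (a * b) \<le> H'\<^sup>2 / c\<^sup>2"
      by (simp add: power_mult_distrib power_divide)
    then have "F' * G' \<le> H'\<^sup>2"
      using a b c by (simp add: divide_right_mono field_simps)
    then show ?thesis
      using FG H' by (simp add: ennreal_mult[symmetric] ennreal_power)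
  qed
  then show ?thesis unfolding F_def G_def H_def .
qed

text \<open>Truncation: \<open>f\<close> and \<open>g\<close> are monotone limits of bounded functions with bounded support, and decreasing them keeps
  the hypothesis.\<close>

lemma prekopa_leindler_real:
  fixes f g h :: "real \<Rightarrow> ennreal"
  assumes [measurable]: "f \<in> borel_measurable borel" "g \<in> borel_measurable borel" "h \<in> borel_measurable borel"
    and fgh: "\<And>x y. f x * g y \<le> (h ((x + y) / 2))\<^sup>2"
  shows "(\<integral>\<^sup>+x. f x \<partial>lborel) * (\<integral>\<^sup>+x. g x \<partial>lborel) \<le> (\<integral>\<^sup>+x. h x \<partial>lborel)\<^sup>2"
proof -
  define T where "T = (\<lambda>(u::real \<Rightarrow> ennreal) (n::nat) x. min (u x) (of_nat n) * indicator {- real n .. real n} x)"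
  have [measurable]: "T u n \<in> borel_measurable borel" if [measurable]: "u \<in> borel_measurable borel" for u n
    unfolding T_def by measurable
  have Tle: "T u n x \<le> u x" for u n x
    by (auto simp: T_def indicator_def)
  have inc: "incseq (T u)" for u
    unfolding T_def by (intro incseq_SucI le_funI mult_mono) (auto simp: indicator_def intro: min.coboundedI2 min.mono)
  have SUP: "(SUP n. T u n x) = u x" for u x
  proof (rule antisym)
    show "(SUP n. T u n x) \<le> u x" using Tle by (intro SUP_least)
    show "u x \<le> (SUP n. T u n x)"
    proof (rule le_SUP_iff[THEN iffD2], intro allI impI)
      fix y assume "y < u x"
      then have "y < \<infinity>" by (rule less_le_trans) simp
      then obtain n1 where n1: "y < of_nat n1" using ennreal_Ex_less_of_nat[of y] by auto
      obtain n2 where n2: "\<bar>x\<bar> \<le> real n2" using real_arch_simple by blast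
      have "y < T u (max n1 n2) x"
        using \<open>y < u x\<close> n1 n2 by (auto simp: T_def indicator_def less_le_trans split: split_max)
      then show "\<exists>n\<in>UNIV. y < T u n x" by blast
    qed
  qed
  have int: "(\<integral>\<^sup>+x. u x \<partial>lborel) = (SUP n. \<integral>\<^sup>+x. T u n x \<partial>lborel)"
    if [measurable]: "u \<in> borel_measurable borel" for u
    using nn_integral_monotone_convergence_SUP[OF inc, of u lborel] SUP by simp
  have mn: "(\<integral>\<^sup>+x. T f m x \<partial>lborel) * (\<integral>\<^sup>+x. T g n x \<partial>lborel) \<le> (\<integral>\<^sup>+x. h x \<partial>lborel)\<^sup>2" for m n
  proof (rule prekopa_leindler_bounded)
    have fin: "(SUP x. T u n x) < \<infinity>" for u n
    proof -
      have "(SUP x. T u n x) \<le> of_nat n"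
        by (intro SUP_least) (auto simp: T_def indicator_def)
      also have "\<dots> < \<infinity>" by (simp add: ennreal_of_nat_eq_real_of_nat)
      finally show ?thesis .
    qed
    show "(SUP x. T f m x) < \<infinity>" "(SUP x. T g n x) < \<infinity>" by (fact fin)+
    have "bounded {x. T u n x \<noteq> 0}" for u n
      by (rule bounded_subset[OF bounded_closed_interval[of "- real n" "real n"]]) (auto simp: T_def indicator_def)
    then show "bounded {x. T f m x \<noteq> 0}" "bounded {x. T g n x \<noteq> 0}" by auto
    show "T f m x * T g n y \<le> (h ((x + y) / 2))\<^sup>2" for x y
      using fgh[of x y] mult_mono[OF Tle[of f m x] Tle[of g n y]] by auto
  qed auto
  have "(\<integral>\<^sup>+x. f x \<partial>lborel) * (\<integral>\<^sup>+x. g x \<partial>lborel)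
      = (SUP n. (\<integral>\<^sup>+x. f x \<partial>lborel) * (\<integral>\<^sup>+x. T g n x \<partial>lborel))"
    by (simp add: int[of g] SUP_mult_left_ennreal)
  also have "\<dots> = (SUP n. SUP m. (\<integral>\<^sup>+x. T f m x \<partial>lborel) * (\<integral>\<^sup>+x. T g n x \<partial>lborel))"
    by (simp add: int[of f] SUP_mult_right_ennreal)
  also have "\<dots> \<le> (\<integral>\<^sup>+x. h x \<partial>lborel)\<^sup>2"
    by (intro SUP_least mn)
  finally show ?thesis .
qed

interpretation lborel_product: product_sigma_finite "\<lambda>_ :: 'i. lborel :: real measure"
  by standard

lemma borel_measurable_slice:
  fixes u :: "('i \<Rightarrow> real) \<Rightarrow> ennreal"
  assumes u: "u \<in> borel_measurable (PiM (insert i I) (\<lambda>_. lborel))" and "i \<notin> I" "x \<in> extensional I"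
  shows "(\<lambda>t. u (x(i := t))) \<in> borel_measurable borel"
proof -
  have "x \<in> space (PiM I (\<lambda>_. lborel :: real measure))"
    using assms(3) by (simp add: space_PiM PiE_def)
  from measurable_comp[OF measurable_component_update[OF this assms(2)] u]
  show ?thesis by (simp add: comp_def)
qed

lemma borel_measurable_nn_integral_slice:
  fixes u :: "('i \<Rightarrow> real) \<Rightarrow> ennreal"
  assumes u: "u \<in> borel_measurable (PiM (insert i I) (\<lambda>_. lborel))"
  shows "(\<lambda>x. \<integral>\<^sup>+t. u (x(i := t)) \<partial>lborel) \<in> borel_measurable (PiM I (\<lambda>_. lborel))"
proof -
  have "(\<lambda>(x, t). x(i := t)) \<in> PiM I (\<lambda>_. lborel) \<Otimes>\<^sub>M lborel \<rightarrow>\<^sub>M PiM (insert i I) (\<lambda>_. lborel :: real measure)"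
    by (rule measurable_add_dim)
  from measurable_compose[OF this u]
  have "(\<lambda>(x, t). u (x(i := t))) \<in> borel_measurable (PiM I (\<lambda>_. lborel) \<Otimes>\<^sub>M lborel)"
    by (simp add: case_prod_unfold)
  then show ?thesis by measurable
qed

text \<open>Prekopa--Leindler for midpoints. The one-dimensional case on a slice shows that the marginals
  satisfy the same hypothesis, so the dimension can be reduced one coordinate at a time.\<close>

theorem prekopa_leindler:
  fixes f g h :: "('i \<Rightarrow> real) \<Rightarrow> ennreal"
  assumes "finite I"
    and "f \<in> borel_measurable (PiM I (\<lambda>_. lborel))" "g \<in> borel_measurable (PiM I (\<lambda>_. lborel))"
      "h \<in> borel_measurable (PiM I (\<lambda>_. lborel))"
    and "\<And>x y. x \<in> extensional I \<Longrightarrow> y \<in> extensional I \<Longrightarrow> f x * g y \<le> (h (\<lambda>i. (x i + y i) / 2))\<^sup>2"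
  shows "(\<integral>\<^sup>+x. f x \<partial>PiM I (\<lambda>_. lborel)) * (\<integral>\<^sup>+x. g x \<partial>PiM I (\<lambda>_. lborel))
     \<le> (\<integral>\<^sup>+x. h x \<partial>PiM I (\<lambda>_. lborel))\<^sup>2"
  using assms
proof (induction I arbitrary: f g h rule: finite_induct)
  case empty
  then show ?case
    using empty(4)[of "\<lambda>_. undefined" "\<lambda>_. undefined"] by (simp add: PiM_empty nn_integral_count_space_finite)
next
  case (insert i I)
  note [measurable] = insert.prems(1-3)
  note [simp] = insert.hyps
  have "(\<integral>\<^sup>+x. \<integral>\<^sup>+t. f (x(i := t)) \<partial>lborel \<partial>PiM I (\<lambda>_. lborel)) * (\<integral>\<^sup>+x. \<integral>\<^sup>+t. g (x(i := t)) \<partial>lborel \<partial>PiM I (\<lambda>_. lborel))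
     \<le> (\<integral>\<^sup>+x. \<integral>\<^sup>+t. h (x(i := t)) \<partial>lborel \<partial>PiM I (\<lambda>_. lborel))\<^sup>2"
  proof (rule insert.IH)
    fix x y :: "'i \<Rightarrow> real" assume xy: "x \<in> extensional I" "y \<in> extensional I"
    have mid: "(\<lambda>j. (x j + y j) / 2) \<in> extensional I"
      using xy by (auto simp: extensional_def)
    show "(\<integral>\<^sup>+t. f (x(i := t)) \<partial>lborel) * (\<integral>\<^sup>+t. g (y(i := t)) \<partial>lborel)
        \<le> (\<integral>\<^sup>+t. h ((\<lambda>j. (x j + y j) / 2)(i := t)) \<partial>lborel)\<^sup>2"
    proof (rule prekopa_leindler_real)
      fix s t
      have e: "x(i := s) \<in> extensional (insert i I)" "y(i := t) \<in> extensional (insert i I)"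
        using xy by (auto simp: extensional_def)
      have "(\<lambda>j. ((x(i := s)) j + (y(i := t)) j) / 2) = (\<lambda>j. (x j + y j) / 2)(i := (s + t) / 2)"
        by auto
      with insert.prems(4)[OF e]
      show "f (x(i := s)) * g (y(i := t)) \<le> (h ((\<lambda>j. (x j + y j) / 2)(i := (s + t) / 2)))\<^sup>2"
        by metis
    qed (rule borel_measurable_slice insert.prems insert.hyps xy mid)+
  qed (rule borel_measurable_nn_integral_slice insert.prems)+
  then show ?case
    using insert.prems by (simp add: lborel_product.product_nn_integral_insert)
qed

lemma nn_integral_PiM_shift:
  fixes c :: "'i \<Rightarrow> real"
  assumes "finite I" "f \<in> borel_measurable (PiM I (\<lambda>_. lborel))"
  shows "(\<integral>\<^sup>+x. f (\<lambda>i\<in>I. x i + c i) \<partial>PiM I (\<lambda>_. lborel)) = (\<integral>\<^sup>+x. f x \<partial>PiM I (\<lambda>_. lborel))"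
  using assms
proof (induction I arbitrary: f rule: finite_induct)
  case empty
  then show ?case by (simp add: PiM_empty nn_integral_count_space_finite restrict_def)
next
  case (insert i I)
  note [measurable] = insert.prems
  note [simp] = insert.hyps
  note [measurable] = borel_measurable_nn_integral_slice[OF insert.prems]
  have [measurable]: "(\<lambda>x. f (\<lambda>j\<in>insert i I. x j + c j)) \<in> borel_measurable (PiM (insert i I) (\<lambda>_. lborel))"
    by (rule measurable_compose[OF _ insert.prems]) (intro measurable_restrict, measurable)
  have "(\<integral>\<^sup>+x. f (\<lambda>j\<in>insert i I. x j + c j) \<partial>PiM (insert i I) (\<lambda>_. lborel))
     = (\<integral>\<^sup>+x. \<integral>\<^sup>+t. f (\<lambda>j\<in>insert i I. (x(i := t)) j + c j) \<partial>lborel \<partial>PiM I (\<lambda>_. lborel))"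
    by (rule lborel_product.product_nn_integral_insert) auto
  also have "\<dots> = (\<integral>\<^sup>+x. \<integral>\<^sup>+t. f ((\<lambda>j\<in>I. x j + c j)(i := c i + 1 * t)) \<partial>lborel \<partial>PiM I (\<lambda>_. lborel))"
  proof (intro nn_integral_cong arg_cong[where f = f])
    fix x :: "'i \<Rightarrow> real" and t
    show "(\<lambda>j\<in>insert i I. (x(i := t)) j + c j) = (\<lambda>j\<in>I. x j + c j)(i := c i + 1 * t)"
      using insert.hyps by (auto simp: restrict_def fun_eq_iff)
  qed
  also have "\<dots> = (\<integral>\<^sup>+x. \<integral>\<^sup>+t. f ((\<lambda>j\<in>I. x j + c j)(i := t)) \<partial>lborel \<partial>PiM I (\<lambda>_. lborel))"
  proof (rule nn_integral_cong)
    fix x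
    show "(\<integral>\<^sup>+t. f ((\<lambda>j\<in>I. x j + c j)(i := c i + 1 * t)) \<partial>lborel) = (\<integral>\<^sup>+t. f ((\<lambda>j\<in>I. x j + c j)(i := t)) \<partial>lborel)"
    proof -
      have "(\<lambda>t. f ((\<lambda>j\<in>I. x j + c j)(i := t))) \<in> borel_measurable borel"
        by (rule borel_measurable_slice[OF insert.prems insert.hyps(2)]) simp
      from nn_integral_real_affine[OF this, of 1 "c i"] show ?thesis by simp
    qed
  qed
  also have "\<dots> = (\<integral>\<^sup>+x. \<integral>\<^sup>+t. f (x(i := t)) \<partial>lborel \<partial>PiM I (\<lambda>_. lborel))"
    by (rule insert.IH) measurable
  also have "\<dots> = (\<integral>\<^sup>+x. f x \<partial>PiM (insert i I) (\<lambda>_. lborel))"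
    by (rule lborel_product.product_nn_integral_insert[symmetric]) auto
  finally show ?case .
qed

lemma nn_integral_gaussian_finite:
  fixes e :: real
  assumes "0 < e" "finite I"
  shows "(\<integral>\<^sup>+x. ennreal (exp (- (e * (\<Sum>i\<in>I. (x i)\<^sup>2)))) \<partial>PiM I (\<lambda>_. lborel)) < \<infinity>"
proof -
  have one: "(\<integral>\<^sup>+t. ennreal (exp (- (e * t\<^sup>2))) \<partial>lborel) < \<infinity>"
  proof -
    define s where "s = 1 / sqrt (2 * e)"
    have s: "0 < s" "s\<^sup>2 = 1 / (2 * e)" using assms by (auto simp: s_def power_divide)
    have "exp (- (e * t\<^sup>2)) = sqrt (2 * pi * s\<^sup>2) * normal_density 0 s t" for t
      using s assms by (simp add: normal_density_def)
    then have "integrable lborel (\<lambda>t. exp (- (e * t\<^sup>2)))"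
      using s by (simp only:) (intro integrable_mult_right integrable_normal_density)
    then show ?thesis
      by (simp add: integrable_iff_bounded)
  qed
  have "(\<integral>\<^sup>+x. ennreal (exp (- (e * (\<Sum>i\<in>I. (x i)\<^sup>2)))) \<partial>PiM I (\<lambda>_. lborel))
      = (\<integral>\<^sup>+x. (\<Prod>i\<in>I. ennreal (exp (- (e * (x i)\<^sup>2)))) \<partial>PiM I (\<lambda>_. lborel))"
    by (intro nn_integral_cong) (simp add: prod_ennreal exp_sum[symmetric] assms sum_distrib_left sum_negf)
  also have "\<dots> = (\<Prod>i\<in>I. \<integral>\<^sup>+t. ennreal (exp (- (e * t\<^sup>2))) \<partial>lborel)"
    by (rule lborel_product.product_nn_integral_prod) (use assms in auto)
  also have "\<dots> < \<infinity>"
    using one by (simp add: ennreal_prod_eq_top less_top power_less_top_ennreal)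
  finally show ?thesis .
qed

section \<open>Concentration for product measures on spins\<close>

definition quad :: "'v set \<Rightarrow> ('v \<Rightarrow> 'v \<Rightarrow> real) \<Rightarrow> ('v \<Rightarrow> real) \<Rightarrow> real" where
  "quad V A x = (\<Sum>i\<in>V. \<Sum>j\<in>V. x i * A i j * x j)"

definition mat_app :: "'v set \<Rightarrow> ('v \<Rightarrow> 'v \<Rightarrow> real) \<Rightarrow> ('v \<Rightarrow> real) \<Rightarrow> 'v \<Rightarrow> real" where
  "mat_app V A x i = (\<Sum>j\<in>V. A i j * x j)"

definition sqnorm :: "'v set \<Rightarrow> ('v \<Rightarrow> real) \<Rightarrow> real" where
  "sqnorm V x = (\<Sum>i\<in>V. (x i)\<^sup>2)"

lemma sqnorm_nonneg: "0 \<le> sqnorm V x"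
  by (simp add: sqnorm_def sum_nonneg)

lemma quad_conv: "quad V A x = (\<Sum>i\<in>V. x i * mat_app V A x i)"
  by (simp add: quad_def mat_app_def sum_distrib_left mult.assoc)

lemma mat_app_add_scaled: "mat_app V A (\<lambda>i. x i + t * y i) i = mat_app V A x i + t * mat_app V A y i"
  by (simp add: mat_app_def algebra_simps sum.distrib sum_distrib_left)

lemma mat_app_symmetric:
  assumes "\<And>i j. A i j = A j i"
  shows "(\<Sum>i\<in>V. x i * mat_app V A y i) = (\<Sum>i\<in>V. y i * mat_app V A x i)"
proof -
  have "(\<Sum>i\<in>V. x i * mat_app V A y i) = (\<Sum>i\<in>V. \<Sum>j\<in>V. x i * (A i j * y j))"
    by (simp add: mat_app_def sum_distrib_left)
  also have "\<dots> = (\<Sum>j\<in>V. \<Sum>i\<in>V. x i * (A i j * y j))" by (rule sum.swap)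
  also have "\<dots> = (\<Sum>j\<in>V. y j * mat_app V A x j)"
    unfolding mat_app_def sum_distrib_left
    by (intro sum.cong refl) (use assms in \<open>simp add: mult.commute mult.left_commute\<close>)
  finally show ?thesis .
qed

lemma quad_add_scaled:
  assumes "\<And>i j. A i j = A j i"
  shows "quad V A (\<lambda>i. x i + t * y i) = quad V A x + 2 * t * (\<Sum>i\<in>V. y i * mat_app V A x i) + t\<^sup>2 * quad V A y"
proof -
  have "quad V A (\<lambda>i. x i + t * y i)
      = quad V A x + t * (\<Sum>i\<in>V. x i * mat_app V A y i) + t * (\<Sum>i\<in>V. y i * mat_app V A x i) + t\<^sup>2 * quad V A y"
    unfolding quad_conv mat_app_add_scaled
    by (simp add: algebra_simps sum.distrib sum_distrib_left power2_eq_square)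
  then show ?thesis
    using mat_app_symmetric[OF assms, where x = x and y = y and V = V] by simp
qed

text \<open>For \<open>0 \<le> A \<le> c\<close> one has \<open>A\<^sup>2 \<le> c A\<close>: expand \<open>0 \<le> \<langle>x - A x / c, A (x - A x / c)\<rangle>\<close>.\<close>

lemma sqnorm_mat_app_le:
  assumes sym: "\<And>i j. A i j = A j i" and "0 < c"
    and nonneg: "\<And>x. 0 \<le> quad V A x" and le: "\<And>x. quad V A x \<le> c * sqnorm V x"
  shows "sqnorm V (mat_app V A x) \<le> c * quad V A x"
proof -
  let ?y = "mat_app V A x"
  have "0 \<le> quad V A (\<lambda>i. x i + (- 1 / c) * ?y i)" by (rule nonneg)
  also have "\<dots> = quad V A x + 2 * (- 1 / c) * (\<Sum>i\<in>V. ?y i * ?y i) + (- 1 / c)\<^sup>2 * quad V A ?y"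
    by (rule quad_add_scaled[OF sym])
  also have "\<dots> \<le> quad V A x + 2 * (- 1 / c) * sqnorm V ?y + (- 1 / c)\<^sup>2 * (c * sqnorm V ?y)"
  proof -
    have "(\<Sum>i\<in>V. ?y i * ?y i) = sqnorm V ?y" by (simp add: sqnorm_def power2_eq_square)
    moreover have "(- 1 / c)\<^sup>2 * quad V A ?y \<le> (- 1 / c)\<^sup>2 * (c * sqnorm V ?y)"
      by (rule mult_left_mono[OF le]) simp
    ultimately show ?thesis by simp
  qed
  also have "\<dots> = quad V A x - sqnorm V ?y / c"
    using \<open>0 < c\<close> by (simp add: power2_eq_square field_simps)
  finally show ?thesis using \<open>0 < c\<close> by (simp add: field_simps)
qed

definition spin_cfgs :: "'v set \<Rightarrow> ('v \<Rightarrow> real) set" where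
  "spin_cfgs V = PiE V (\<lambda>_. {-1, 1})"

lemma finite_spin_cfgs: "finite V \<Longrightarrow> finite (spin_cfgs V)"
  unfolding spin_cfgs_def by (rule finite_PiE) auto

lemma spin_cfgs_nonempty: "spin_cfgs V \<noteq> {}"
  by (auto simp: spin_cfgs_def PiE_eq_empty_iff)

lemma spin_cfgs_D: "\<sigma> \<in> spin_cfgs V \<Longrightarrow> i \<in> V \<Longrightarrow> \<sigma> i = 1 \<or> \<sigma> i = -1"
  by (auto simp: spin_cfgs_def PiE_def Pi_def)

lemma spin_cfgs_upd: "\<sigma> \<in> spin_cfgs V \<Longrightarrow> i \<in> V \<Longrightarrow> s = 1 \<or> s = -1 \<Longrightarrow> \<sigma>(i := s) \<in> spin_cfgs V"
  by (auto simp: spin_cfgs_def PiE_def Pi_def extensional_def)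

lemma sum_spin_cfgs_insert:
  fixes F :: "('v \<Rightarrow> real) \<Rightarrow> 'b :: comm_monoid_add"
  assumes "finite V" "i \<notin> V"
  shows "(\<Sum>\<sigma>\<in>spin_cfgs (insert i V). F \<sigma>) = (\<Sum>\<sigma>\<in>spin_cfgs V. F (\<sigma>(i := 1)) + F (\<sigma>(i := -1)))"
proof -
  have inj: "inj_on (\<lambda>(y, g). g(i := y)) ({-1, 1 :: real} \<times> spin_cfgs V)"
    using assms unfolding spin_cfgs_def by (rule_tac inj_combinator) auto
  have "(\<Sum>\<sigma>\<in>spin_cfgs (insert i V). F \<sigma>) = (\<Sum>p\<in>{-1, 1 :: real} \<times> spin_cfgs V. F (case p of (y, g) \<Rightarrow> g(i := y)))"
    unfolding spin_cfgs_def PiE_insert_eq by (rule sum.reindex_cong[OF inj[unfolded spin_cfgs_def]]) auto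
  also have "\<dots> = (\<Sum>y\<in>{-1, 1 :: real}. \<Sum>g\<in>spin_cfgs V. F (g(i := y)))"
    by (simp add: sum.cartesian_product case_prod_unfold)
  also have "\<dots> = (\<Sum>\<sigma>\<in>spin_cfgs V. F (\<sigma>(i := 1)) + F (\<sigma>(i := -1)))"
    by (simp add: sum.distrib add.commute)
  finally show ?thesis .
qed

lemma tanh_le_self: "0 \<le> z \<Longrightarrow> tanh z \<le> (z :: real)"
proof -
  assume "0 \<le> z"
  have "(\<lambda>z. z - tanh z) 0 \<le> (\<lambda>z. z - tanh z :: real) z"
  proof (rule DERIV_nonneg_imp_nondecreasing[OF \<open>0 \<le> z\<close>])
    fix x :: real
    have "((\<lambda>z. z - tanh z) has_real_derivative 1 - (1 - (tanh x)\<^sup>2)) (at x)"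
      by (auto intro!: derivative_eq_intros)
    then show "\<exists>y. ((\<lambda>z. z - tanh z) has_real_derivative y) (at x) \<and> 0 \<le> y"
      by force
  qed
  then show ?thesis by simp
qed

lemma abs_tanh_le: "\<bar>tanh x\<bar> \<le> \<bar>x :: real\<bar>"
  using tanh_le_self[of x] tanh_le_self[of "- x"] by (cases "0 \<le> x") (auto simp: abs_if)

lemma cosh_le_exp_half_square: "cosh (z :: real) \<le> exp (z\<^sup>2 / 2)"
proof -
  have pos: "cosh z \<le> exp (z\<^sup>2 / 2)" if "0 \<le> z" for z :: real
  proof -
    have "(\<lambda>z. z\<^sup>2 / 2 - ln (cosh z)) 0 \<le> (\<lambda>z. z\<^sup>2 / 2 - ln (cosh z) :: real) z"
    proof (rule DERIV_nonneg_imp_nondecreasing[OF that])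
      fix x :: real assume "0 \<le> x"
      have "((\<lambda>z. z\<^sup>2 / 2 - ln (cosh z)) has_real_derivative x - tanh x) (at x)"
        by (auto intro!: derivative_eq_intros simp: tanh_def field_simps)
      then show "\<exists>y. ((\<lambda>z. z\<^sup>2 / 2 - ln (cosh z)) has_real_derivative y) (at x) \<and> 0 \<le> y"
        using tanh_le_self[OF \<open>0 \<le> x\<close>] by force
    qed
    then have "ln (cosh z) \<le> z\<^sup>2 / 2" by simp
    then have "exp (ln (cosh z)) \<le> exp (z\<^sup>2 / 2)" by (simp only: exp_le_cancel_iff)
    moreover have "exp (ln (cosh z)) = cosh z" by (intro exp_ln cosh_real_pos)
    ultimately show ?thesis by simp
  qed
  show ?thesis
    using pos[of z] pos[of "- z"] by (cases "0 \<le> z") auto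
qed

text \<open>The extremal case is \<open>p = q\<close>, where the left-hand side is \<open>(p + q)\<^sup>2 cosh\<^sup>2 ((a - b) / 2)\<close>.\<close>

lemma two_point_mgf:
  fixes p q a b r :: real
  assumes "0 \<le> p" "0 \<le> q" "\<bar>a - b\<bar> \<le> r"
  shows "(p * exp a + q * exp b) * (p * exp (- a) + q * exp (- b)) \<le> (p + q)\<^sup>2 * exp (r\<^sup>2 / 4)"
proof -
  let ?d = "a - b"
  have e: "exp a * exp (- a) = 1" "exp b * exp (- b) = 1"
    by (simp_all flip: exp_add)
  have "exp a * exp (- b) + exp b * exp (- a) = 2 * cosh ?d"
    by (simp add: cosh_def flip: exp_add)
  moreover have "(p * exp a + q * exp b) * (p * exp (- a) + q * exp (- b))
      = p\<^sup>2 * (exp a * exp (- a)) + q\<^sup>2 * (exp b * exp (- b)) + p * q * (exp a * exp (- b) + exp b * exp (- a))"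
    by (simp add: algebra_simps power2_eq_square)
  ultimately have "(p * exp a + q * exp b) * (p * exp (- a) + q * exp (- b)) = p\<^sup>2 + q\<^sup>2 + p * q * (2 * cosh ?d)"
    by (simp only: e mult_1_right)
  also have "\<dots> \<le> (p + q)\<^sup>2 * (cosh (?d / 2))\<^sup>2"
  proof -
    have c: "cosh ?d = 2 * (cosh (?d / 2))\<^sup>2 - 1"
      using cosh_double_cosh[of "?d / 2"] by (simp only: mult_2 field_sum_of_halves)
    have "(p + q)\<^sup>2 * (cosh (?d / 2))\<^sup>2 - (p\<^sup>2 + q\<^sup>2 + p * q * (2 * cosh ?d)) = (p - q)\<^sup>2 * ((cosh (?d / 2))\<^sup>2 - 1)"
      unfolding c by (simp add: power2_eq_square algebra_simps)
    moreover have "1 \<le> (cosh (?d / 2))\<^sup>2"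
      using cosh_real_ge_1[of "?d / 2"] by (simp add: one_le_power)
    ultimately show ?thesis by (smt (verit) mult_nonneg_nonneg zero_le_power2)
  qed
  also have "\<dots> \<le> (p + q)\<^sup>2 * (exp ((?d / 2)\<^sup>2 / 2))\<^sup>2"
    by (intro mult_left_mono power_mono cosh_le_exp_half_square) auto
  also have "(exp ((?d / 2)\<^sup>2 / 2))\<^sup>2 = exp (?d\<^sup>2 / 4)"
    by (simp add: power2_eq_square field_simps flip: exp_add)
  also have "(p + q)\<^sup>2 * exp (?d\<^sup>2 / 4) \<le> (p + q)\<^sup>2 * exp (r\<^sup>2 / 4)"
    using assms(3) power_mono[of "\<bar>?d\<bar>" r 2] by (intro mult_left_mono) auto
  finally show ?thesis .
qed

text \<open>The bounded-difference inequality for unnormalised product measures on spins. Having both signs of \<open>g\<close> removes the need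
  to centre it. Averaging out one spin replaces \<open>g\<close> by a logarithm \<open>ln E\<close> with the same differences in the other coordinates.\<close>

lemma product_mgf:
  fixes p :: "'v \<Rightarrow> real \<Rightarrow> real"
  assumes "finite V" "\<And>i s. 0 < p i s"
    and "\<And>\<sigma> i. \<sigma> \<in> spin_cfgs V \<Longrightarrow> i \<in> V \<Longrightarrow> \<bar>g (\<sigma>(i := - \<sigma> i)) - g \<sigma>\<bar> \<le> r i"
  shows "(\<Sum>\<sigma>\<in>spin_cfgs V. (\<Prod>i\<in>V. p i (\<sigma> i)) * exp (g \<sigma>)) * (\<Sum>\<sigma>\<in>spin_cfgs V. (\<Prod>i\<in>V. p i (\<sigma> i)) * exp (- g \<sigma>))
     \<le> (\<Sum>\<sigma>\<in>spin_cfgs V. \<Prod>i\<in>V. p i (\<sigma> i))\<^sup>2 * exp (\<Sum>i\<in>V. (r i)\<^sup>2 / 4)"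
  using assms(1,3)
proof (induction V arbitrary: g rule: finite_induct)
  case empty
  then show ?case by (simp add: spin_cfgs_def flip: exp_add)
next
  case (insert i V)
  let ?w = "\<lambda>\<sigma>. \<Prod>j\<in>V. p j (\<sigma> j)"
  define P where "P = p i 1 + p i (-1)"
  have P: "0 < P" using assms(2) by (simp add: P_def add_pos_pos)
  define E where "E = (\<lambda>\<sigma>. (p i 1 * exp (g (\<sigma>(i := 1))) + p i (-1) * exp (g (\<sigma>(i := -1)))) / P)"
  have E: "0 < E \<sigma>" for \<sigma> using P assms(2) by (simp add: E_def add_pos_pos)
  have w: "(\<Prod>j\<in>insert i V. p j ((\<sigma>(i := s)) j)) = p i s * ?w \<sigma>" for \<sigma> s
    using insert.hyps by (auto intro!: prod.cong)
  have ins: "\<sigma>(i := s) \<in> spin_cfgs (insert i V)" if "\<sigma> \<in> spin_cfgs V" "s = 1 \<or> s = -1" for \<sigma> s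
    using that by (auto simp: spin_cfgs_def PiE_def Pi_def extensional_def)
  have wpos: "0 \<le> ?w \<sigma>" for \<sigma> by (intro prod_nonneg) (use assms(2) less_imp_le in blast)
  have IH: "(\<Sum>\<sigma>\<in>spin_cfgs V. ?w \<sigma> * exp (ln (E \<sigma>))) * (\<Sum>\<sigma>\<in>spin_cfgs V. ?w \<sigma> * exp (- ln (E \<sigma>)))
     \<le> (\<Sum>\<sigma>\<in>spin_cfgs V. ?w \<sigma>)\<^sup>2 * exp (\<Sum>i\<in>V. (r i)\<^sup>2 / 4)"
  proof (rule insert.IH)
    fix \<sigma> j assume \<sigma>: "\<sigma> \<in> spin_cfgs V" and j: "j \<in> V"
    have le: "E \<tau>' \<le> exp (r j) * E \<tau>"
      if "\<tau> \<in> spin_cfgs V" "\<tau>' = \<tau>(j := - \<tau> j)" for \<tau> \<tau>'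
    proof -
      have "g (\<tau>'(i := s)) \<le> r j + g (\<tau>(i := s))" if s: "s = 1 \<or> s = -1" for s
      proof -
        have "\<tau>'(i := s) = (\<tau>(i := s))(j := - (\<tau>(i := s)) j)"
          using \<open>\<tau>' = _\<close> j insert.hyps by auto
        moreover have "\<bar>g ((\<tau>(i := s))(j := - (\<tau>(i := s)) j)) - g (\<tau>(i := s))\<bar> \<le> r j"
          by (rule insert.prems[OF ins[OF \<open>\<tau> \<in> _\<close> s]]) (use j in simp)
        ultimately show ?thesis
          by (simp only: abs_le_iff) linarith
      qed
      then have "p i 1 * exp (g (\<tau>'(i := 1))) + p i (-1) * exp (g (\<tau>'(i := -1)))
          \<le> p i 1 * exp (r j + g (\<tau>(i := 1))) + p i (-1) * exp (r j + g (\<tau>(i := -1)))"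
        using assms(2) by (intro add_mono mult_left_mono) (auto intro: less_imp_le)
      then have "E \<tau>' \<le> (p i 1 * exp (r j + g (\<tau>(i := 1))) + p i (-1) * exp (r j + g (\<tau>(i := -1)))) / P"
        unfolding E_def using P by (intro divide_right_mono) auto
      also have "\<dots> = exp (r j) * E \<tau>"
        by (simp add: E_def exp_add algebra_simps)
      finally show ?thesis .
    qed
    have "ln (E b) \<le> r j + ln (E a)" if "E b \<le> exp (r j) * E a" for a b
    proof -
      have "ln (E b) \<le> ln (exp (r j) * E a)"
        using that E[of b] by (intro ln_mono) auto
      then show ?thesis using E[of a] by (simp add: ln_mult)
    qed
    moreover have "E (\<sigma>(j := - \<sigma> j)) \<le> exp (r j) * E \<sigma>"
      using le \<sigma> by simp
    moreover have "E \<sigma> \<le> exp (r j) * E (\<sigma>(j := - \<sigma> j))"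
    proof (rule le)
      show "\<sigma>(j := - \<sigma> j) \<in> spin_cfgs V" using spin_cfgs_upd[OF \<sigma> j] spin_cfgs_D[OF \<sigma> j] by auto
    qed auto
    ultimately show "\<bar>ln (E (\<sigma>(j := - \<sigma> j))) - ln (E \<sigma>)\<bar> \<le> r j"
      by (smt (verit))
  qed
  have A: "(\<Sum>\<sigma>\<in>spin_cfgs (insert i V). (\<Prod>j\<in>insert i V. p j (\<sigma> j)) * exp (g \<sigma>))
      = P * (\<Sum>\<sigma>\<in>spin_cfgs V. ?w \<sigma> * exp (ln (E \<sigma>)))"
    unfolding sum_spin_cfgs_insert[OF insert.hyps] w sum_distrib_left
  proof (rule sum.cong[OF refl])
    fix \<sigma>
    have "P * exp (ln (E \<sigma>)) = p i 1 * exp (g (\<sigma>(i := 1))) + p i (-1) * exp (g (\<sigma>(i := -1)))"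
      using E[of \<sigma>] P by (simp add: E_def)
    moreover have "p i 1 * ?w \<sigma> * exp (g (\<sigma>(i := 1))) + p i (-1) * ?w \<sigma> * exp (g (\<sigma>(i := -1)))
        = ?w \<sigma> * (p i 1 * exp (g (\<sigma>(i := 1))) + p i (-1) * exp (g (\<sigma>(i := -1))))"
      by (simp add: algebra_simps)
    ultimately show "p i 1 * ?w \<sigma> * exp (g (\<sigma>(i := 1))) + p i (-1) * ?w \<sigma> * exp (g (\<sigma>(i := -1))) = P * (?w \<sigma> * exp (ln (E \<sigma>)))"
      by (metis mult.left_commute)
  qed
  have B: "(\<Sum>\<sigma>\<in>spin_cfgs (insert i V). (\<Prod>j\<in>insert i V. p j (\<sigma> j)) * exp (- g \<sigma>))
      \<le> P * exp ((r i)\<^sup>2 / 4) * (\<Sum>\<sigma>\<in>spin_cfgs V. ?w \<sigma> * exp (- ln (E \<sigma>)))"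
    unfolding sum_spin_cfgs_insert[OF insert.hyps] w sum_distrib_left
  proof (rule sum_mono)
    fix \<sigma> assume \<sigma>: "\<sigma> \<in> spin_cfgs V"
    let ?S = "p i 1 * exp (- g (\<sigma>(i := 1))) + p i (-1) * exp (- g (\<sigma>(i := -1)))"
    have "\<bar>g (\<sigma>(i := 1)) - g (\<sigma>(i := -1))\<bar> \<le> r i"
    proof -
      have "\<bar>g ((\<sigma>(i := -1))(i := - (\<sigma>(i := -1)) i)) - g (\<sigma>(i := -1))\<bar> \<le> r i"
        by (rule insert.prems[OF ins[OF \<sigma>]]) simp_all
      then show ?thesis by (simp only: fun_upd_same fun_upd_upd minus_minus)
    qed
    then have "(P * E \<sigma>) * ?S \<le> P\<^sup>2 * exp ((r i)\<^sup>2 / 4)"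
      unfolding E_def P_def using two_point_mgf[of "p i 1" "p i (-1)"] assms(2) P
      by (simp add: P_def less_imp_le)
    then have "?S \<le> P * exp ((r i)\<^sup>2 / 4) / E \<sigma>"
    proof -
      assume "(P * E \<sigma>) * ?S \<le> P\<^sup>2 * exp ((r i)\<^sup>2 / 4)"
      then have "P * (E \<sigma> * ?S) \<le> P * (P * exp ((r i)\<^sup>2 / 4))"
        by (simp only: power2_eq_square mult.assoc)
      then have "E \<sigma> * ?S \<le> P * exp ((r i)\<^sup>2 / 4)"
        using P by (rule mult_left_le_imp_le)
      then show ?thesis
        using E[of \<sigma>] by (simp only: pos_le_divide_eq mult.commute)
    qed
    then have "?w \<sigma> * ?S \<le> ?w \<sigma> * (P * exp ((r i)\<^sup>2 / 4) / E \<sigma>)"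
      using wpos by (rule mult_left_mono)
    moreover have "exp (- ln (E \<sigma>)) = 1 / E \<sigma>"
      using E[of \<sigma>] by (simp add: exp_minus inverse_eq_divide)
    moreover have "p i 1 * ?w \<sigma> * exp (- g (\<sigma>(i := 1))) + p i (-1) * ?w \<sigma> * exp (- g (\<sigma>(i := -1))) = ?w \<sigma> * ?S"
      by (simp add: algebra_simps)
    ultimately show "p i 1 * ?w \<sigma> * exp (- g (\<sigma>(i := 1))) + p i (-1) * ?w \<sigma> * exp (- g (\<sigma>(i := -1)))
        \<le> P * exp ((r i)\<^sup>2 / 4) * (?w \<sigma> * exp (- ln (E \<sigma>)))"
      by (simp add: ac_simps)
  qed
  have C: "(\<Sum>\<sigma>\<in>spin_cfgs (insert i V). \<Prod>j\<in>insert i V. p j (\<sigma> j)) = P * (\<Sum>\<sigma>\<in>spin_cfgs V. ?w \<sigma>)"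
    unfolding sum_spin_cfgs_insert[OF insert.hyps] w sum_distrib_left
    by (intro sum.cong refl) (simp add: P_def algebra_simps)
  let ?X = "\<Sum>\<sigma>\<in>spin_cfgs V. ?w \<sigma> * exp (ln (E \<sigma>))" and ?Y = "\<Sum>\<sigma>\<in>spin_cfgs V. ?w \<sigma> * exp (- ln (E \<sigma>))"
  have "(P * ?X) * (\<Sum>\<sigma>\<in>spin_cfgs (insert i V). (\<Prod>j\<in>insert i V. p j (\<sigma> j)) * exp (- g \<sigma>))
      \<le> (P * ?X) * (P * exp ((r i)\<^sup>2 / 4) * ?Y)"
    using B P wpos by (intro mult_left_mono) (auto intro!: mult_nonneg_nonneg sum_nonneg)
  also have "\<dots> = (P\<^sup>2 * exp ((r i)\<^sup>2 / 4)) * (?X * ?Y)"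
    by (simp add: power2_eq_square)
  also have "\<dots> \<le> (P\<^sup>2 * exp ((r i)\<^sup>2 / 4)) * ((\<Sum>\<sigma>\<in>spin_cfgs V. ?w \<sigma>)\<^sup>2 * exp (\<Sum>i\<in>V. (r i)\<^sup>2 / 4))"
    using IH by (intro mult_left_mono) auto
  also have "\<dots> = (P * (\<Sum>\<sigma>\<in>spin_cfgs V. ?w \<sigma>))\<^sup>2 * exp (\<Sum>i\<in>insert i V. (r i)\<^sup>2 / 4)"
    using insert.hyps by (simp add: power_mult_distrib exp_add)
  finally show ?case unfolding A C .
qed

section \<open>A Poincare inequality for Ising models of spectral width below one\<close>

lemma quad_cong: "(\<And>i. i \<in> V \<Longrightarrow> x i = y i) \<Longrightarrow> quad V A x = quad V A y"
  unfolding quad_def by (intro sum.cong) auto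

lemma borel_measurable_quad: "quad V A \<in> borel_measurable (PiM V (\<lambda>_. lborel))"
  unfolding quad_def
  by (intro borel_measurable_sum borel_measurable_times borel_measurable_const)
    (use measurable_component_singleton[of _ V "\<lambda>_. lborel :: real measure"] in simp_all)

lemma borel_measurable_mat_app: "(\<lambda>x. mat_app V A x i) \<in> borel_measurable (PiM V (\<lambda>_. lborel))"
  unfolding mat_app_def
  by (intro borel_measurable_sum borel_measurable_times borel_measurable_const)
    (use measurable_component_singleton[of _ V "\<lambda>_. lborel :: real measure"] in simp_all)

lemma square_sum_le_weighted:
  fixes a b p q :: real
  assumes "0 < p" "0 < q" "p + q = 1"
  shows "(a + b)\<^sup>2 \<le> a\<^sup>2 / p + b\<^sup>2 / q"
proof -
  have q: "q = 1 - p" using assms by simp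
  have "0 \<le> (q * a - p * b)\<^sup>2" by simp
  also have "\<dots> = q * a\<^sup>2 + p * b\<^sup>2 - (a + b)\<^sup>2 * (p * q)"
    unfolding q power2_eq_square by (simp add: algebra_simps)
  finally have "(a + b)\<^sup>2 * (p * q) \<le> q * a\<^sup>2 + p * b\<^sup>2" by simp
  also have "\<dots> = (a\<^sup>2 / p + b\<^sup>2 / q) * (p * q)"
    using assms(1,2) by (simp add: distrib_right)
  finally show ?thesis using assms by (simp only: mult_le_cancel_right_pos mult_pos_pos)
qed

text \<open>The Gibbs weight \<open>exp (\<langle>\<sigma>, A \<sigma>\<rangle> / 2)\<close> is a Gaussian average of the product weights \<open>exp \<langle>A \<psi>, \<sigma>\<rangle>\<close>.
  The three partial sums \<open>G f\<close>, \<open>G (- f)\<close> and \<open>G 0\<close> over \<open>\<sigma>\<close> satisfy the hypothesis of Prekopa--Leindler in the variable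
  \<open>\<psi>\<close>: the bounded-difference inequality costs at most \<open>\<bar>A z\<bar>\<^sup>2 / (1 - \<epsilon>)\<close>, where \<open>z\<close> is half the difference of the two
  points, and this is compensated by the Gaussian factor because \<open>A\<^sup>2 \<le> (1 - \<epsilon>) A\<close>. The substitution \<open>\<phi> = A \<psi>\<close> avoids
  inverting \<open>A\<close>.\<close>

lemma ising_exp_concentration:
  fixes V :: "'v set" and A :: "'v \<Rightarrow> 'v \<Rightarrow> real" and \<epsilon> :: real
  defines "Z \<equiv> \<lambda>g. \<Sum>\<sigma>\<in>spin_cfgs V. exp (1/2 * quad V A \<sigma> + g \<sigma>)"
  assumes fin: "finite V" and sym: "\<And>i j. A i j = A j i" and eps: "0 < \<epsilon>" "\<epsilon> < 1"
    and lower: "\<And>x. \<epsilon> * sqnorm V x \<le> quad V A x" and upper: "\<And>x. quad V A x \<le> (1 - \<epsilon>) * sqnorm V x"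
    and diff: "\<And>\<sigma> i. \<sigma> \<in> spin_cfgs V \<Longrightarrow> i \<in> V \<Longrightarrow> \<bar>f (\<sigma>(i := - \<sigma> i)) - f \<sigma>\<bar> \<le> c i"
  shows "Z f * Z (\<lambda>\<sigma>. - f \<sigma>) \<le> (Z (\<lambda>_. 0))\<^sup>2 * exp (sqnorm V c / (4 * \<epsilon>))"
proof -
  let ?M = "PiM V (\<lambda>_. lborel :: real measure)"
  define K where "K = sqnorm V c / (4 * \<epsilon>)"
  define S where "S = spin_cfgs V"
  have finS: "finite S" using finite_spin_cfgs[OF fin] by (simp add: S_def)
  define G where "G = (\<lambda>g \<psi>. \<Sum>\<sigma>\<in>S. exp (g \<sigma> - 1/2 * quad V A \<psi> + (\<Sum>i\<in>V. mat_app V A \<psi> i * \<sigma> i)))"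
  have Gpos: "0 \<le> G g \<psi>" for g \<psi> by (auto simp: G_def intro: sum_nonneg)
  have Gmeas[measurable]: "G g \<in> borel_measurable ?M" for g
    unfolding G_def
    by (intro borel_measurable_sum borel_measurable_exp borel_measurable_add borel_measurable_diff
        borel_measurable_times borel_measurable_const borel_measurable_quad borel_measurable_mat_app
        measurable_compose[OF _ borel_measurable_exp])
  have quad_nonneg: "0 \<le> quad V A x" for x
    using lower[of x] eps sqnorm_nonneg[of V x] by (smt (verit) mult_nonneg_nonneg)
  have mid: "G f x * G (\<lambda>\<sigma>. - f \<sigma>) y \<le> (G (\<lambda>_. 0) (\<lambda>i. (x i + y i) / 2))\<^sup>2 * exp K" for x y
  proof -
  \<comment> \<open>The quadratic terms of \<open>x\<close> and \<open>y\<close> exceed those of the midpoint \<open>u\<close> by \<open>quad V A z\<close>, which pays for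
      the tilts \<open>\<plusminus>A z\<close> of the product measure with field \<open>A u\<close>.\<close>
    define u where "u = (\<lambda>i. (x i + y i) / 2)"
    define z where "z = (\<lambda>i. (x i - y i) / 2)"
    have x: "x = (\<lambda>i. u i + 1 * z i)" and y: "y = (\<lambda>i. u i + (- 1) * z i)"
      by (auto simp: u_def z_def field_simps)
    define m where "m = mat_app V A u"
    define d where "d = mat_app V A z"
    define B where "B = (\<Sum>i\<in>V. z i * mat_app V A u i)"
    have px: "mat_app V A x i = m i + d i" for i
      unfolding x mat_app_add_scaled by (simp add: m_def d_def)
    have py: "mat_app V A y i = m i - d i" for i
      unfolding y mat_app_add_scaled by (simp add: m_def d_def)
    have qx: "quad V A x = quad V A u + 2 * B + quad V A z"
      unfolding x quad_add_scaled[OF sym] by (simp add: B_def)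
    have qy: "quad V A y = quad V A u - 2 * B + quad V A z"
      unfolding y quad_add_scaled[OF sym] by (simp add: B_def)
    define g where "g = (\<lambda>\<sigma>. f \<sigma> + (\<Sum>i\<in>V. d i * \<sigma> i))"
    define w where "w = (\<lambda>\<sigma>. \<Prod>i\<in>V. exp (m i * \<sigma> i))"
    have w: "w \<sigma> = exp (\<Sum>i\<in>V. m i * \<sigma> i)" for \<sigma>
      by (simp add: w_def exp_sum fin)
    have bd: "(\<Sum>\<sigma>\<in>S. w \<sigma> * exp (g \<sigma>)) * (\<Sum>\<sigma>\<in>S. w \<sigma> * exp (- g \<sigma>))
        \<le> (\<Sum>\<sigma>\<in>S. w \<sigma>)\<^sup>2 * exp (\<Sum>i\<in>V. (c i + 2 * \<bar>d i\<bar>)\<^sup>2 / 4)"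
      unfolding w_def S_def
    proof (rule product_mgf[where p = "\<lambda>i s. exp (m i * s)"])
      fix \<sigma> i assume \<sigma>: "\<sigma> \<in> spin_cfgs V" and i: "i \<in> V"
      have "(\<Sum>j\<in>V. d j * (\<sigma>(i := - \<sigma> i)) j) = (\<Sum>j\<in>V. d j * \<sigma> j + (if j = i then - 2 * d i * \<sigma> i else 0))"
        by (intro sum.cong) auto
      also have "\<dots> = (\<Sum>j\<in>V. d j * \<sigma> j) - 2 * d i * \<sigma> i"
        using fin i by (simp add: sum.distrib)
      finally have "g (\<sigma>(i := - \<sigma> i)) - g \<sigma> = f (\<sigma>(i := - \<sigma> i)) - f \<sigma> - 2 * d i * \<sigma> i"
        by (simp only: g_def)
      moreover have "\<bar>2 * d i * \<sigma> i\<bar> = 2 * \<bar>d i\<bar>"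
        using spin_cfgs_D[OF \<sigma> i] by (auto simp: abs_mult)
      ultimately show "\<bar>g (\<sigma>(i := - \<sigma> i)) - g \<sigma>\<bar> \<le> c i + 2 * \<bar>d i\<bar>"
        using diff[OF \<sigma> i] by linarith
    qed (use fin in auto)
    have "(\<Sum>i\<in>V. (c i + 2 * \<bar>d i\<bar>)\<^sup>2 / 4) \<le> (\<Sum>i\<in>V. (c i)\<^sup>2 / (4 * \<epsilon>) + (d i)\<^sup>2 / (1 - \<epsilon>))"
    proof (rule sum_mono)
      fix i
      have "(c i / 2 + \<bar>d i\<bar>)\<^sup>2 \<le> (c i / 2)\<^sup>2 / \<epsilon> + \<bar>d i\<bar>\<^sup>2 / (1 - \<epsilon>)"
        by (rule square_sum_le_weighted) (use eps in auto)
      moreover have "(c i + 2 * \<bar>d i\<bar>)\<^sup>2 / 4 = (c i / 2 + \<bar>d i\<bar>)\<^sup>2"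
        by (simp add: power2_eq_square field_simps)
      moreover have "(c i / 2)\<^sup>2 / \<epsilon> = (c i)\<^sup>2 / (4 * \<epsilon>)"
        by (simp add: power_divide)
      ultimately show "(c i + 2 * \<bar>d i\<bar>)\<^sup>2 / 4 \<le> (c i)\<^sup>2 / (4 * \<epsilon>) + (d i)\<^sup>2 / (1 - \<epsilon>)"
        by simp
    qed
    also have "\<dots> = K + sqnorm V d / (1 - \<epsilon>)"
      by (simp add: K_def sqnorm_def sum.distrib sum_divide_distrib)
    also have "\<dots> \<le> K + quad V A z"
      using sqnorm_mat_app_le[OF sym _ quad_nonneg upper, of z] eps
      by (simp add: d_def pos_divide_le_eq mult.commute)
    finally have expo: "(\<Sum>i\<in>V. (c i + 2 * \<bar>d i\<bar>)\<^sup>2 / 4) \<le> K + quad V A z" .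
    have Gx: "G f x = exp (- 1/2 * quad V A x) * (\<Sum>\<sigma>\<in>S. w \<sigma> * exp (g \<sigma>))"
      unfolding G_def px w g_def sum_distrib_left
      by (intro sum.cong refl) (simp add: distrib_right sum.distrib flip: exp_add)
    have Gy: "G (\<lambda>\<sigma>. - f \<sigma>) y = exp (- 1/2 * quad V A y) * (\<Sum>\<sigma>\<in>S. w \<sigma> * exp (- g \<sigma>))"
      unfolding G_def py w g_def sum_distrib_left
      by (intro sum.cong refl) (simp add: left_diff_distrib sum_subtractf flip: exp_add)
    have Gu: "G (\<lambda>_. 0) u = exp (- 1/2 * quad V A u) * (\<Sum>\<sigma>\<in>S. w \<sigma>)"
      unfolding G_def m_def[symmetric] w sum_distrib_left
      by (intro sum.cong refl) (simp flip: exp_add)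
    have "G f x * G (\<lambda>\<sigma>. - f \<sigma>) y = exp (- quad V A u - quad V A z) *
        ((\<Sum>\<sigma>\<in>S. w \<sigma> * exp (g \<sigma>)) * (\<Sum>\<sigma>\<in>S. w \<sigma> * exp (- g \<sigma>)))"
    proof -
      have "exp (- 1/2 * quad V A x) * exp (- 1/2 * quad V A y) = exp (- quad V A u - quad V A z)"
      proof -
        have "- 1/2 * quad V A x + - 1/2 * quad V A y = - quad V A u - quad V A z"
          unfolding qx qy by (simp add: field_simps)
        then show ?thesis by (simp only: flip: exp_add)
      qed
      then have "exp (- quad V A u - quad V A z) * (a * b) = (exp (- 1/2 * quad V A x) * a) * (exp (- 1/2 * quad V A y) * b)" for a b
        by (simp add: mult_ac)
      then show ?thesis unfolding Gx Gy ..
    qed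
    also have "\<dots> \<le> exp (- quad V A u - quad V A z) * ((\<Sum>\<sigma>\<in>S. w \<sigma>)\<^sup>2 * exp (K + quad V A z))"
    proof (rule mult_left_mono)
      have "(\<Sum>\<sigma>\<in>S. w \<sigma>)\<^sup>2 * exp (\<Sum>i\<in>V. (c i + 2 * \<bar>d i\<bar>)\<^sup>2 / 4) \<le> (\<Sum>\<sigma>\<in>S. w \<sigma>)\<^sup>2 * exp (K + quad V A z)"
        using expo by (intro mult_left_mono) auto
      with bd show "(\<Sum>\<sigma>\<in>S. w \<sigma> * exp (g \<sigma>)) * (\<Sum>\<sigma>\<in>S. w \<sigma> * exp (- g \<sigma>)) \<le> (\<Sum>\<sigma>\<in>S. w \<sigma>)\<^sup>2 * exp (K + quad V A z)"
        by linarith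
    qed simp
    also have "\<dots> = (G (\<lambda>_. 0) u)\<^sup>2 * exp K"
    proof -
      have "exp (- quad V A u - quad V A z) * exp (K + quad V A z) = (exp (- 1/2 * quad V A u))\<^sup>2 * exp K"
        by (simp add: power2_eq_square flip: exp_add)
      then have "exp (- quad V A u - quad V A z) * (a * exp (K + quad V A z)) = ((exp (- 1/2 * quad V A u))\<^sup>2 * a) * exp K" for a
        by (simp add: mult_ac)
      then show ?thesis unfolding Gu power_mult_distrib .
    qed
    finally show ?thesis unfolding u_def .
  qed
  define C where "C = (\<integral>\<^sup>+\<psi>. ennreal (exp (- 1/2 * quad V A \<psi>)) \<partial>?M)"
  have eq_meas[measurable]: "(\<lambda>\<psi>. ennreal (exp (- 1/2 * quad V A \<psi>))) \<in> borel_measurable ?M"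
    by (intro measurable_compose[OF _ measurable_ennreal] measurable_compose[OF _ borel_measurable_exp]
        borel_measurable_times borel_measurable_const borel_measurable_quad)
  have shifted: "(\<integral>\<^sup>+\<psi>. ennreal (exp (- 1/2 * quad V A (\<lambda>i. \<psi> i - \<sigma> i))) \<partial>?M) = C" for \<sigma>
  proof -
    have "C = (\<integral>\<^sup>+\<psi>. ennreal (exp (- 1/2 * quad V A (\<lambda>i\<in>V. \<psi> i + - \<sigma> i))) \<partial>?M)"
      unfolding C_def by (rule nn_integral_PiM_shift[OF fin eq_meas, symmetric])
    moreover have "quad V A (\<lambda>i\<in>V. \<psi> i + - \<sigma> i) = quad V A (\<lambda>i. \<psi> i - \<sigma> i)" for \<psi>
      by (intro quad_cong) simp
    ultimately show ?thesis by (simp only:)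
  qed
  have int: "(\<integral>\<^sup>+\<psi>. ennreal (G g \<psi>) \<partial>?M) = ennreal (Z g) * C" for g
  proof -
    \<comment> \<open>completing the square; the mass of the shifted Gaussian does not depend on \<open>\<sigma>\<close>\<close>
    have sq: "g \<sigma> - 1/2 * quad V A \<psi> + (\<Sum>i\<in>V. mat_app V A \<psi> i * \<sigma> i)
        = (1/2 * quad V A \<sigma> + g \<sigma>) + (- 1/2 * quad V A (\<lambda>i. \<psi> i - \<sigma> i))" for \<sigma> \<psi>
    proof -
      have "(\<lambda>i. \<psi> i - \<sigma> i) = (\<lambda>i. \<psi> i + (- 1) * \<sigma> i)" by auto
      then show ?thesis
        by (simp only: quad_add_scaled[OF sym]) (simp add: field_simps)
    qed
    have qmeas: "(\<lambda>\<psi>. quad V A (\<lambda>i. \<psi> i - \<sigma> i)) \<in> borel_measurable ?M" for \<sigma>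
      unfolding quad_def
      by (intro borel_measurable_sum borel_measurable_times borel_measurable_const borel_measurable_diff)
        (use measurable_component_singleton[of _ V "\<lambda>_. lborel :: real measure"] in simp_all)
    have "(\<integral>\<^sup>+\<psi>. ennreal (G g \<psi>) \<partial>?M)
        = (\<integral>\<^sup>+\<psi>. (\<Sum>\<sigma>\<in>S. ennreal (exp (1/2 * quad V A \<sigma> + g \<sigma>)) * ennreal (exp (- 1/2 * quad V A (\<lambda>i. \<psi> i - \<sigma> i)))) \<partial>?M)"
    proof (rule nn_integral_cong)
      fix \<psi>
      have "G g \<psi> = (\<Sum>\<sigma>\<in>S. exp (1/2 * quad V A \<sigma> + g \<sigma>) * exp (- 1/2 * quad V A (\<lambda>i. \<psi> i - \<sigma> i)))"
        unfolding G_def by (intro sum.cong refl) (simp only: sq flip: exp_add)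
      then show "ennreal (G g \<psi>) = (\<Sum>\<sigma>\<in>S. ennreal (exp (1/2 * quad V A \<sigma> + g \<sigma>)) * ennreal (exp (- 1/2 * quad V A (\<lambda>i. \<psi> i - \<sigma> i))))"
        by (simp only: ennreal_mult[symmetric] exp_ge_zero sum_ennreal mult_nonneg_nonneg)
    qed
    also have "\<dots> = (\<Sum>\<sigma>\<in>S. \<integral>\<^sup>+\<psi>. ennreal (exp (1/2 * quad V A \<sigma> + g \<sigma>)) * ennreal (exp (- 1/2 * quad V A (\<lambda>i. \<psi> i - \<sigma> i))) \<partial>?M)"
    proof (rule nn_integral_sum)
      fix \<sigma>
      from qmeas show "(\<lambda>\<psi>. ennreal (exp (1/2 * quad V A \<sigma> + g \<sigma>)) * ennreal (exp (- 1/2 * quad V A (\<lambda>i. \<psi> i - \<sigma> i)))) \<in> borel_measurable ?M"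
        by measurable
    qed
    also have "\<dots> = (\<Sum>\<sigma>\<in>S. ennreal (exp (1/2 * quad V A \<sigma> + g \<sigma>)) * C)"
    proof (rule sum.cong[OF refl])
      fix \<sigma>
      from qmeas have "(\<lambda>\<psi>. ennreal (exp (- 1/2 * quad V A (\<lambda>i. \<psi> i - \<sigma> i)))) \<in> borel_measurable ?M"
        by measurable
      then show "(\<integral>\<^sup>+\<psi>. ennreal (exp (1/2 * quad V A \<sigma> + g \<sigma>)) * ennreal (exp (- 1/2 * quad V A (\<lambda>i. \<psi> i - \<sigma> i))) \<partial>?M)
          = ennreal (exp (1/2 * quad V A \<sigma> + g \<sigma>)) * C"
        using shifted[of \<sigma>] by (simp only: nn_integral_cmult)
    qed
    also have "\<dots> = ennreal (Z g) * C"
    proof -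
      have "ennreal (Z g) = (\<Sum>\<sigma>\<in>S. ennreal (exp (1/2 * quad V A \<sigma> + g \<sigma>)))"
        unfolding Z_def S_def by (rule sum_ennreal[symmetric]) simp
      then show ?thesis by (simp only: sum_distrib_right)
    qed
    finally show ?thesis .
  qed
  have Cfin: "C < \<infinity>"
  proof -
    have "C \<le> (\<integral>\<^sup>+\<psi>. ennreal (exp (- (\<epsilon> / 2 * (\<Sum>i\<in>V. (\<psi> i)\<^sup>2)))) \<partial>?M)"
      unfolding C_def
    proof (intro nn_integral_mono ennreal_leI)
      fix \<psi> show "exp (- 1/2 * quad V A \<psi>) \<le> exp (- (\<epsilon> / 2 * (\<Sum>i\<in>V. (\<psi> i)\<^sup>2)))"
        using lower[of \<psi>] by (simp add: sqnorm_def)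
    qed
    also have "\<dots> < \<infinity>" by (rule nn_integral_gaussian_finite) (use eps fin in auto)
    finally show ?thesis .
  qed
  have Cpos: "C \<noteq> 0"
  proof
    assume "C = 0"
    then have "AE \<psi> in ?M. ennreal (exp (- 1/2 * quad V A \<psi>)) = 0"
      unfolding C_def using nn_integral_0_iff_AE[OF eq_meas] by blast
    moreover have "ennreal (exp t) \<noteq> 0" for t :: real by (simp add: ennreal_eq_0_iff not_le)
    ultimately have "AE \<psi> in ?M. False" by (simp only:)
    then have "emeasure ?M (space ?M) = 0"
      by (simp add: AE_iff_measurable[OF _ refl])
    moreover have "emeasure ?M (PiE V (\<lambda>_. {0..1})) = 1"
      by (subst lborel_product.emeasure_PiM) (use fin in auto)
    moreover have "emeasure ?M (PiE V (\<lambda>_. {0..1})) \<le> emeasure ?M (space ?M)"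
      by (rule emeasure_space)
    ultimately show False by simp
  qed
  have "(\<integral>\<^sup>+\<psi>. ennreal (G f \<psi>) \<partial>?M) * (\<integral>\<^sup>+\<psi>. ennreal (G (\<lambda>\<sigma>. - f \<sigma>) \<psi>) \<partial>?M)
      \<le> (\<integral>\<^sup>+\<psi>. ennreal (exp (K / 2)) * ennreal (G (\<lambda>_. 0) \<psi>) \<partial>?M)\<^sup>2"
  proof (rule prekopa_leindler[OF fin])
    fix x y
    have "(exp (K / 2))\<^sup>2 = exp K" by (simp add: power2_eq_square flip: exp_add)
    then have "G f x * G (\<lambda>\<sigma>. - f \<sigma>) y \<le> (exp (K / 2) * G (\<lambda>_. 0) (\<lambda>i. (x i + y i) / 2))\<^sup>2"
      using mid[of x y] by (simp add: power_mult_distrib mult.commute)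
    then show "ennreal (G f x) * ennreal (G (\<lambda>\<sigma>. - f \<sigma>) y) \<le> (ennreal (exp (K / 2)) * ennreal (G (\<lambda>_. 0) (\<lambda>i. (x i + y i) / 2)))\<^sup>2"
      using Gpos by (simp add: ennreal_mult[symmetric] ennreal_power ennreal_leI)
  qed measurable
  also have "(\<integral>\<^sup>+\<psi>. ennreal (exp (K / 2)) * ennreal (G (\<lambda>_. 0) \<psi>) \<partial>?M) = ennreal (exp (K / 2)) * (ennreal (Z (\<lambda>_. 0)) * C)"
    by (subst nn_integral_cmult) (auto simp: int)
  finally have le: "ennreal (Z f) * C * (ennreal (Z (\<lambda>\<sigma>. - f \<sigma>)) * C) \<le> (ennreal (exp (K / 2)) * (ennreal (Z (\<lambda>_. 0)) * C))\<^sup>2"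
    unfolding int .
  obtain C' where C': "C = ennreal C'" "0 < C'"
    using Cfin Cpos by (cases C) (auto simp: less_le)
  have Zpos: "0 \<le> Z g" for g by (auto simp: Z_def intro: sum_nonneg)
  have "Z f * C' * (Z (\<lambda>\<sigma>. - f \<sigma>) * C') \<le> (exp (K / 2) * (Z (\<lambda>_. 0) * C'))\<^sup>2"
    using le Zpos C' by (simp add: ennreal_mult[symmetric] ennreal_power)
  also have "\<dots> = ((Z (\<lambda>_. 0))\<^sup>2 * exp K) * C'\<^sup>2"
  proof -
    have "(exp (K / 2))\<^sup>2 = exp K" by (simp add: power2_eq_square flip: exp_add)
    then show ?thesis unfolding power_mult_distrib by (simp only: mult_ac)
  qed
  finally have "(Z f * Z (\<lambda>\<sigma>. - f \<sigma>)) * C'\<^sup>2 \<le> ((Z (\<lambda>_. 0))\<^sup>2 * exp K) * C'\<^sup>2"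
    by (simp add: power2_eq_square mult_ac)
  then show ?thesis
    using C' by (simp add: K_def)
qed

text \<open>Poincare inequality: for a centred \<open>f\<close> the exponential bound at a single well-chosen scale \<open>s\<close>, namely
  \<open>s\<^sup>2 \<kappa> = 1\<close>, already controls the second moment, because \<open>2 + y\<^sup>2 \<le> exp y + exp (- y)\<close> and, by Jensen,
  neither exponential moment is below one.\<close>

lemma ising_variance_bound:
  fixes V :: "'v set" and A :: "'v \<Rightarrow> 'v \<Rightarrow> real" and \<delta> :: real
  assumes fin: "finite V" and sym: "\<And>i j. A i j = A j i" and delta: "0 \<le> \<delta>" "\<delta> < 1"
    and lower: "\<And>x. \<alpha> * sqnorm V x \<le> quad V A x" and upper: "\<And>x. quad V A x \<le> (\<alpha> + \<delta>) * sqnorm V x"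
    and diff: "\<And>\<sigma> i. \<sigma> \<in> spin_cfgs V \<Longrightarrow> i \<in> V \<Longrightarrow> \<bar>f (\<sigma>(i := - \<sigma> i)) - f \<sigma>\<bar> \<le> c i"
    and mean: "(\<Sum>\<sigma>\<in>spin_cfgs V. exp (1/2 * quad V A \<sigma>) * f \<sigma>) = 0"
  shows "(\<Sum>\<sigma>\<in>spin_cfgs V. exp (1/2 * quad V A \<sigma>) * (f \<sigma>)\<^sup>2)
      \<le> 2 * sqnorm V c / (1 - \<delta>) * (\<Sum>\<sigma>\<in>spin_cfgs V. exp (1/2 * quad V A \<sigma>))"
proof -
  define \<epsilon> where "\<epsilon> = (1 - \<delta>) / 2"
  have eps: "0 < \<epsilon>" "\<epsilon> < 1" using delta by (auto simp: \<epsilon>_def)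
  \<comment> \<open>Spins square to one, so a multiple of the identity only rescales the weight; this one moves the
    spectrum into \<open>[\<epsilon>, 1 - \<epsilon>]\<close>.\<close>
  define A' where "A' = (\<lambda>i j. A i j + (if i = j then \<epsilon> - \<alpha> else 0))"
  have quad': "quad V A' x = quad V A x + (\<epsilon> - \<alpha>) * sqnorm V x" for x
  proof -
    have "quad V A' x = (\<Sum>i\<in>V. (\<Sum>j\<in>V. x i * A i j * x j) + (\<Sum>j\<in>V. if i = j then (\<epsilon> - \<alpha>) * (x i)\<^sup>2 else 0))"
      unfolding quad_def sum.distrib[symmetric]
      by (intro sum.cong refl) (auto simp: A'_def algebra_simps power2_eq_square)
    also have "\<dots> = quad V A x + (\<epsilon> - \<alpha>) * sqnorm V x"
      using fin by (simp add: quad_def sqnorm_def sum.distrib sum_distrib_left)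
    finally show ?thesis .
  qed
  have sq: "sqnorm V \<sigma> = real (card V)" if "\<sigma> \<in> spin_cfgs V" for \<sigma>
  proof -
    have "(\<sigma> i)\<^sup>2 = 1" if "i \<in> V" for i
      using spin_cfgs_D[OF \<open>\<sigma> \<in> _\<close> that] by auto
    then show ?thesis by (simp add: sqnorm_def)
  qed
  define T where "T = exp (1/2 * ((\<epsilon> - \<alpha>) * real (card V)))"
  have T: "0 < T" by (simp add: T_def)
  define W where "W = (\<lambda>\<sigma>. exp (1/2 * quad V A \<sigma>))"
  have W: "0 < W \<sigma>" for \<sigma> by (simp add: W_def)
  have w': "exp (1/2 * quad V A' \<sigma> + t) = T * (W \<sigma> * exp t)" if "\<sigma> \<in> spin_cfgs V" for \<sigma> t
    by (simp add: quad' sq[OF that] T_def W_def algebra_simps flip: exp_add)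
  define Z where "Z = (\<Sum>\<sigma>\<in>spin_cfgs V. W \<sigma>)"
  define m where "m = (\<Sum>\<sigma>\<in>spin_cfgs V. W \<sigma> * (f \<sigma>)\<^sup>2)"
  have Zpos: "0 < Z"
    unfolding Z_def by (intro sum_pos finite_spin_cfgs fin spin_cfgs_nonempty W)
  have mean': "(\<Sum>\<sigma>\<in>spin_cfgs V. W \<sigma> * f \<sigma>) = 0" using mean by (simp add: W_def)
  have conc: "1 + s\<^sup>2 * (m / Z) / 2 \<le> exp (s\<^sup>2 * (sqnorm V c / (4 * \<epsilon>)))" if "0 \<le> s" for s
  proof -
    define E where "E = (\<lambda>t. \<Sum>\<sigma>\<in>spin_cfgs V. W \<sigma> * exp (t * f \<sigma>))"
    have "(\<Sum>\<sigma>\<in>spin_cfgs V. exp (1/2 * quad V A' \<sigma> + s * f \<sigma>)) * (\<Sum>\<sigma>\<in>spin_cfgs V. exp (1/2 * quad V A' \<sigma> + - (s * f \<sigma>)))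
      \<le> (\<Sum>\<sigma>\<in>spin_cfgs V. exp (1/2 * quad V A' \<sigma> + 0))\<^sup>2 * exp (sqnorm V (\<lambda>i. s * c i) / (4 * \<epsilon>))"
    proof (rule ising_exp_concentration[where f = "\<lambda>\<sigma>. s * f \<sigma>"])
      show "A' i j = A' j i" for i j by (simp add: A'_def sym)
      show "\<epsilon> * sqnorm V x \<le> quad V A' x" for x
        using lower[of x] by (simp add: quad' algebra_simps)
      show "quad V A' x \<le> (1 - \<epsilon>) * sqnorm V x" for x
      proof -
        have "quad V A' x \<le> (\<alpha> + \<delta>) * sqnorm V x + (\<epsilon> - \<alpha>) * sqnorm V x" using upper[of x] by (simp add: quad')
        also have "\<dots> = (\<delta> + \<epsilon>) * sqnorm V x" by (simp add: algebra_simps)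
        also have "\<delta> + \<epsilon> = 1 - \<epsilon>" by (simp add: \<epsilon>_def field_simps)
        finally show ?thesis .
      qed
      fix \<sigma> i assume "\<sigma> \<in> spin_cfgs V" "i \<in> V"
      then have "s * \<bar>f (\<sigma>(i := - \<sigma> i)) - f \<sigma>\<bar> \<le> s * c i"
        using diff \<open>0 \<le> s\<close> by (intro mult_left_mono) auto
      then show "\<bar>s * f (\<sigma>(i := - \<sigma> i)) - s * f \<sigma>\<bar> \<le> s * c i"
        using \<open>0 \<le> s\<close> by (simp only: right_diff_distrib[symmetric] abs_mult abs_of_nonneg)
    qed (use fin eps in auto)
    moreover have "(\<Sum>\<sigma>\<in>spin_cfgs V. exp (1/2 * quad V A' \<sigma> + s * f \<sigma>)) = T * E s"
      unfolding E_def sum_distrib_left by (intro sum.cong refl) (simp only: w')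
    moreover have "(\<Sum>\<sigma>\<in>spin_cfgs V. exp (1/2 * quad V A' \<sigma> + - (s * f \<sigma>))) = T * E (- s)"
      unfolding E_def sum_distrib_left by (intro sum.cong refl) (simp only: w' mult_minus_left)
    moreover have "(\<Sum>\<sigma>\<in>spin_cfgs V. exp (1/2 * quad V A' \<sigma> + 0)) = T * Z"
      unfolding Z_def sum_distrib_left by (intro sum.cong refl) (simp only: w' exp_zero mult_1_right)
    moreover have "sqnorm V (\<lambda>i. s * c i) / (4 * \<epsilon>) = s\<^sup>2 * (sqnorm V c / (4 * \<epsilon>))"
      by (simp add: sqnorm_def power_mult_distrib sum_distrib_left)
    ultimately have "(T * E s) * (T * E (- s)) \<le> (T * Z)\<^sup>2 * exp (s\<^sup>2 * (sqnorm V c / (4 * \<epsilon>)))"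
      by (simp only:)
    then have "T\<^sup>2 * (E s * E (- s)) \<le> T\<^sup>2 * (Z\<^sup>2 * exp (s\<^sup>2 * (sqnorm V c / (4 * \<epsilon>))))"
      by (simp only: power_mult_distrib power2_eq_square[of T] mult_ac)
    then have le: "E s * E (- s) \<le> Z\<^sup>2 * exp (s\<^sup>2 * (sqnorm V c / (4 * \<epsilon>)))"
      using T by (simp add: mult_le_cancel_left_pos)
    have jensen: "Z \<le> E t" for t
    proof -
      have "Z = (\<Sum>\<sigma>\<in>spin_cfgs V. W \<sigma> * (1 + t * f \<sigma>))"
        using mean' by (simp add: Z_def distrib_left sum.distrib mult.left_commute[of _ t] flip: sum_distrib_left)
      also have "\<dots> \<le> E t"
        unfolding E_def by (intro sum_mono mult_left_mono exp_ge_add_one_self less_imp_le[OF W])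
      finally show ?thesis .
    qed
    have quadratic: "2 * Z + s\<^sup>2 * m \<le> E s + E (- s)"
    proof -
      have "2 * Z + s\<^sup>2 * m = (\<Sum>\<sigma>\<in>spin_cfgs V. W \<sigma> * (2 + (s * f \<sigma>)\<^sup>2))"
        by (simp add: Z_def m_def distrib_left sum.distrib sum_distrib_left power_mult_distrib mult_ac)
      also have "\<dots> \<le> (\<Sum>\<sigma>\<in>spin_cfgs V. W \<sigma> * (exp (s * f \<sigma>) + exp (- s * f \<sigma>)))"
      proof (intro sum_mono mult_left_mono less_imp_le[OF W])
        fix \<sigma>
        let ?y = "s * f \<sigma>"
        have pos: "2 + y\<^sup>2 \<le> exp y + exp (- y)" if "0 \<le> y" for y :: real
        proof -
          have "1 + y + y\<^sup>2 / 2 \<le> exp y" using exp_lower_Taylor_quadratic[OF that] .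
          have "(\<lambda>y. exp y + exp (- y) - y\<^sup>2) 0 \<le> (\<lambda>y :: real. exp y + exp (- y) - y\<^sup>2) y"
          proof (rule DERIV_nonneg_imp_nondecreasing[OF that])
            fix x :: real assume x: "0 \<le> x"
            have d: "((\<lambda>y. exp y + exp (- y) - y\<^sup>2) has_real_derivative exp x - exp (- x) - 2 * x) (at x)"
              by (auto intro!: derivative_eq_intros)
            have "(\<lambda>x. exp x - exp (- x) - 2 * x) 0 \<le> (\<lambda>x :: real. exp x - exp (- x) - 2 * x) x"
            proof (rule DERIV_nonneg_imp_nondecreasing[OF x])
              fix t :: real
              have "((\<lambda>x. exp x - exp (- x) - 2 * x) has_real_derivative exp t + exp (- t) - 2) (at t)"
                by (auto intro!: derivative_eq_intros)
              moreover have "2 \<le> exp t + exp (- t)"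
                using cosh_real_ge_1[of t] by (simp add: cosh_def)
              ultimately show "\<exists>y. ((\<lambda>x. exp x - exp (- x) - 2 * x) has_real_derivative y) (at t) \<and> 0 \<le> y"
                by force
            qed
            with d show "\<exists>z. ((\<lambda>y. exp y + exp (- y) - y\<^sup>2) has_real_derivative z) (at x) \<and> 0 \<le> z"
              by force
          qed
          then show ?thesis by simp
        qed
        show "2 + ?y\<^sup>2 \<le> exp ?y + exp (- s * f \<sigma>)"
          using pos[of ?y] pos[of "- ?y"] by (cases "0 \<le> ?y") (auto simp: add.commute)
      qed
      also have "\<dots> = E s + E (- s)"
        by (simp add: E_def distrib_left sum.distrib)
      finally show ?thesis .
    qed
    have "Z * E t \<le> Z\<^sup>2 * exp (s\<^sup>2 * (sqnorm V c / (4 * \<epsilon>)))" if "t = s \<or> t = - s" for t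
    proof -
      have "Z * E t \<le> E (- t) * E t"
        using jensen[of t] jensen[of "- t"] Zpos by (intro mult_right_mono) auto
      also have "\<dots> = E s * E (- s)" using that by auto
      finally show ?thesis using le by linarith
    qed
    from this[of s] this[of "- s"] quadratic Zpos
    have "Z * (2 * Z + s\<^sup>2 * m) \<le> 2 * (Z\<^sup>2 * exp (s\<^sup>2 * (sqnorm V c / (4 * \<epsilon>))))"
      using mult_left_mono[OF quadratic, of Z] by (simp add: distrib_left)
    moreover have "Z * (2 * Z + s\<^sup>2 * m) = 2 * (Z\<^sup>2 * (1 + s\<^sup>2 * (m / Z) / 2))"
      using Zpos by (simp add: power2_eq_square distrib_left)
    ultimately have "Z\<^sup>2 * (1 + s\<^sup>2 * (m / Z) / 2) \<le> Z\<^sup>2 * exp (s\<^sup>2 * (sqnorm V c / (4 * \<epsilon>)))"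
      by linarith
    then show ?thesis using Zpos by (simp only: mult_le_cancel_left_pos zero_less_power)
  qed
  have "m / Z \<le> 4 * (sqnorm V c / (4 * \<epsilon>))"
  proof (cases "sqnorm V c = 0")
    case True
    then have "1 + 1\<^sup>2 * (m / Z) / 2 \<le> exp (1\<^sup>2 * (0 / (4 * \<epsilon>)))" using conc[of 1] by simp
    then show ?thesis unfolding True by simp
  next
    case False
    define \<kappa> where "\<kappa> = sqnorm V c / (4 * \<epsilon>)"
    have "0 < sqnorm V c" using False sqnorm_nonneg[of V c] by linarith
    then have k: "0 < \<kappa>" unfolding \<kappa>_def using eps(1) by (intro divide_pos_pos) auto
    have "1 + (m / Z) / (2 * \<kappa>) \<le> exp 1"
    proof -
      have "(1 / sqrt \<kappa>)\<^sup>2 = 1 / \<kappa>" using k by (simp add: power_divide)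
      then show ?thesis
        using conc[of "1 / sqrt \<kappa>"] k unfolding \<kappa>_def[symmetric] by (simp add: mult_ac)
    qed
    also have "\<dots> \<le> 3" by (rule exp_le)
    finally have "(m / Z) / (2 * \<kappa>) \<le> 2" by simp
    then have "m / Z \<le> 2 * (2 * \<kappa>)" using k by (simp only: pos_divide_le_eq)
    then show ?thesis unfolding \<kappa>_def[symmetric] by simp
  qed
  then have "m \<le> sqnorm V c / \<epsilon> * Z" using Zpos by (simp add: field_simps)
  then show ?thesis by (simp add: m_def Z_def W_def \<epsilon>_def mult.commute)
qed

section \<open>Averaging out spins\<close>

text \<open>Functions of configurations are total functions here; the coordinates that matter are tracked explicitly.\<close>

definition depends_on :: "'v set \<Rightarrow> (('v \<Rightarrow> real) \<Rightarrow> 'b) \<Rightarrow> bool" where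
  "depends_on D F \<longleftrightarrow> (\<forall>\<sigma> \<tau>. (\<forall>x\<in>D. \<sigma> x = \<tau> x) \<longrightarrow> F \<sigma> = F \<tau>)"

lemma depends_onD: "depends_on D F \<Longrightarrow> (\<And>x. x \<in> D \<Longrightarrow> \<sigma> x = \<tau> x) \<Longrightarrow> F \<sigma> = F \<tau>"
  by (auto simp: depends_on_def)

definition avg :: "'v \<Rightarrow> (('v \<Rightarrow> real) \<Rightarrow> real) \<Rightarrow> ('v \<Rightarrow> real) \<Rightarrow> real" where
  "avg x F \<sigma> = (F (\<sigma>(x := 1)) + F (\<sigma>(x := -1))) / 2"

text \<open>Averaging over the listed spins, one at a time. As a spin may be averaged a second time without effect, the sum over
  all configurations is unchanged by a previous average over any subset.\<close>

fun avgs :: "'v list \<Rightarrow> (('v \<Rightarrow> real) \<Rightarrow> real) \<Rightarrow> ('v \<Rightarrow> real) \<Rightarrow> real" where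
  "avgs [] F = F"
| "avgs (x # xs) F = avg x (avgs xs F)"

lemma avgs_append: "avgs (xs @ ys) F = avgs xs (avgs ys F)"
  by (induction xs) auto

lemma avgs_local:
  "(\<And>\<sigma>. (\<And>y. y \<notin> set xs \<Longrightarrow> \<sigma> y = \<tau> y) \<Longrightarrow> F \<sigma> = G \<sigma>) \<Longrightarrow> avgs xs F \<tau> = avgs xs G \<tau>"
proof (induction xs arbitrary: \<tau>)
  case Nil
  then show ?case by simp
next
  case (Cons x xs)
  have "avgs xs F (\<tau>(x := s)) = avgs xs G (\<tau>(x := s))" for s
    by (rule Cons.IH, rule Cons.prems) auto
  then show ?case by (simp add: avg_def)
qed

lemma depends_on_avgs: "depends_on D F \<Longrightarrow> depends_on D (avgs xs F)"
proof (induction xs)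
  case (Cons x xs)
  then have *: "depends_on D (avgs xs F)" by simp
  show ?case
    unfolding depends_on_def
  proof (intro allI impI)
    fix \<sigma> \<tau> :: "'a \<Rightarrow> real" assume "\<forall>x\<in>D. \<sigma> x = \<tau> x"
    then have "avgs xs F (\<sigma>(x := s)) = avgs xs F (\<tau>(x := s))" for s
      by (intro depends_onD[OF *]) auto
    then show "avgs (x # xs) F \<sigma> = avgs (x # xs) F \<tau>" by (simp add: avg_def)
  qed
qed simp

lemma avgs_mult:
  "depends_on D f \<Longrightarrow> set xs \<inter> D = {} \<Longrightarrow> avgs xs (\<lambda>\<sigma>. f \<sigma> * g \<sigma>) \<tau> = f \<tau> * avgs xs g \<tau>"
proof (induction xs arbitrary: \<tau>)
  case (Cons x xs)
  have "f (\<tau>(x := s)) = f \<tau>" for s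
    by (rule depends_onD[OF Cons.prems(1)]) (use Cons.prems(2) in auto)
  with Cons show ?case by (simp add: avg_def algebra_simps)
qed simp

lemma avgs_prod_list:
  assumes "sorted_wrt (\<lambda>p q. D p \<inter> D q = {}) ps"
    and "\<And>p. p \<in> set ps \<Longrightarrow> depends_on (D p) (H p)" "\<And>p. p \<in> set ps \<Longrightarrow> set (L p) \<subseteq> D p"
  shows "avgs (concat (map L ps)) (\<lambda>\<sigma>. \<Prod>p\<leftarrow>ps. H p \<sigma>) \<tau> = (\<Prod>p\<leftarrow>ps. avgs (L p) (H p) \<tau>)"
  using assms
proof (induction ps arbitrary: \<tau>)
  case (Cons p ps)
  let ?R = "\<lambda>\<sigma>. \<Prod>q\<leftarrow>ps. H q \<sigma>" and ?X = "concat (map L ps)"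
  have IH: "avgs ?X ?R \<tau> = (\<Prod>q\<leftarrow>ps. avgs (L q) (H q) \<tau>)" for \<tau>
    using Cons by auto
  have dis: "D p \<inter> D q = {}" if "q \<in> set ps" for q
    using Cons.prems(1) that by auto
  have 1: "avgs ?X (\<lambda>\<sigma>. H p \<sigma> * ?R \<sigma>) \<tau> = H p \<tau> * avgs ?X ?R \<tau>" for \<tau>
  proof (rule avgs_mult)
    show "depends_on (D p) (H p)" using Cons.prems by simp
    show "set ?X \<inter> D p = {}" using dis Cons.prems(3) by fastforce
  qed
  have dep: "depends_on (\<Union>q\<in>set ps. D q) (avgs ?X ?R)"
  proof (rule depends_on_avgs)
    have "H q \<sigma> = H q \<tau>" if "\<forall>x\<in>(\<Union>q\<in>set ps. D q). \<sigma> x = \<tau> x" "q \<in> set ps" for q \<sigma> \<tau>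
      by (rule depends_onD[where D = "D q"]) (use Cons.prems that in auto)
    then show "depends_on (\<Union>q\<in>set ps. D q) ?R"
      unfolding depends_on_def by (intro allI impI arg_cong[where f = prod_list] map_cong refl) blast
  qed
  have "avgs ?X (\<lambda>\<sigma>. H p \<sigma> * ?R \<sigma>) = (\<lambda>\<sigma>. avgs ?X ?R \<sigma> * H p \<sigma>)"
    by (rule ext) (simp add: 1 mult.commute)
  then have "avgs (concat (map L (p # ps))) (\<lambda>\<sigma>. \<Prod>q\<leftarrow>p # ps. H q \<sigma>) \<tau>
      = avgs (L p) (\<lambda>\<sigma>. avgs ?X ?R \<sigma> * H p \<sigma>) \<tau>"
    by (simp add: avgs_append)
  also have "\<dots> = avgs ?X ?R \<tau> * avgs (L p) (H p) \<tau>"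
    by (rule avgs_mult[OF dep]) (use dis Cons.prems(3)[of p] in auto)
  finally show ?case by (simp add: IH mult.commute)
qed simp

lemma sum_spin_cfgs_avg:
  assumes "finite V" "x \<in> V"
  shows "(\<Sum>\<sigma>\<in>spin_cfgs V. avg x F \<sigma>) = (\<Sum>\<sigma>\<in>spin_cfgs V. F \<sigma>)"
proof -
  define W where "W = V - {x}"
  have W: "V = insert x W" "x \<notin> W" "finite W"
    using assms by (auto simp: W_def)
  show ?thesis
    unfolding W(1) sum_spin_cfgs_insert[OF W(3,2)] by (simp add: avg_def)
qed

lemma sum_spin_cfgs_avgs:
  assumes "finite V" "set xs \<subseteq> V"
  shows "(\<Sum>\<sigma>\<in>spin_cfgs V. avgs xs F \<sigma>) = (\<Sum>\<sigma>\<in>spin_cfgs V. F \<sigma>)"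
  using assms by (induction xs) (auto simp: sum_spin_cfgs_avg)

section \<open>Belief propagation on trees\<close>

text \<open>A rooted tree with labelled vertices. The spins at a \<open>Leaf\<close> are boundary spins and stay fixed, those at a \<open>Node\<close> are summed
  over.\<close>

datatype 'v rtree = Leaf 'v | Node 'v "'v rtree list"

fun troot :: "'v rtree \<Rightarrow> 'v" where
  "troot (Leaf x) = x"
| "troot (Node x ts) = x"

fun tverts :: "'v rtree \<Rightarrow> 'v list" where
  "tverts (Leaf x) = [x]"
| "tverts (Node x ts) = x # concat (map tverts ts)"

fun inner_verts :: "'v rtree \<Rightarrow> 'v list" where
  "inner_verts (Leaf x) = []"
| "inner_verts (Node x ts) = x # concat (map inner_verts ts)"

fun leaves :: "'v rtree \<Rightarrow> 'v list" where
  "leaves (Leaf x) = [x]"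
| "leaves (Node x ts) = concat (map leaves ts)"

fun energy :: "'v rtree \<Rightarrow> ('v \<Rightarrow> real) \<Rightarrow> real" where
  "energy (Leaf x) \<sigma> = 0"
| "energy (Node x ts) \<sigma> = (\<Sum>t\<leftarrow>ts. \<sigma> x * \<sigma> (troot t) + energy t \<sigma>)"

text \<open>The message of belief propagation: the normalised partition function of the subtree, including the edge to a parent with spin \<open>s\<close>, as a
  function of \<open>s\<close> and of the boundary spins.\<close>

fun msg :: "real \<Rightarrow> 'v rtree \<Rightarrow> real \<Rightarrow> ('v \<Rightarrow> real) \<Rightarrow> real" where
  "msg b (Leaf x) s \<sigma> = exp (b * s * \<sigma> x)"
| "msg b (Node x ts) s \<sigma> = (exp (b * s) * (\<Prod>t\<leftarrow>ts. msg b t 1 \<sigma>) + exp (- (b * s)) * (\<Prod>t\<leftarrow>ts. msg b t (-1) \<sigma>)) / 2"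

text \<open>The field on a parent that is caused by a child in the field \<open>x\<close>; it equals \<open>artanh (tanh b tanh x)\<close>.\<close>

definition cavity_map :: "real \<Rightarrow> real \<Rightarrow> real" where
  "cavity_map b x = (ln (cosh (b + x)) - ln (cosh (b - x))) / 2"

fun cavity_field :: "real \<Rightarrow> 'v rtree \<Rightarrow> ('v \<Rightarrow> real) \<Rightarrow> real" where
  "cavity_field b (Leaf x) \<sigma> = b * \<sigma> x"
| "cavity_field b (Node x ts) \<sigma> = cavity_map b (\<Sum>t\<leftarrow>ts. cavity_field b t \<sigma>)"

lemma root_in_tverts: "troot t \<in> set (tverts t)"
  by (cases t) auto

lemma inner_subset_tverts: "set (inner_verts t) \<subseteq> set (tverts t)"
  by (induction t) auto

lemma leaves_subset_tverts: "set (leaves t) \<subseteq> set (tverts t)"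
  by (induction t) auto

lemma distinct_concat_mapD: "distinct (concat (map f ts)) \<Longrightarrow> t \<in> set ts \<Longrightarrow> distinct (f t)"
  by (induction ts) auto

lemma distinct_concat_sorted_wrt:
  "distinct (concat (map f ts)) \<Longrightarrow> sorted_wrt (\<lambda>t u. set (f t) \<inter> set (f u) = {}) ts"
  by (induction ts) auto

lemma distinct_concat_disjoint:
  "distinct (concat (map f ts)) \<Longrightarrow> t \<in> set ts \<Longrightarrow> u \<in> set ts \<Longrightarrow> t \<noteq> u \<Longrightarrow> set (f t) \<inter> set (f u) = {}"
  by (induction ts) auto

lemma leaves_inner_disjoint: "distinct (tverts t) \<Longrightarrow> set (leaves t) \<inter> set (inner_verts t) = {}"
proof (induction t)
  case (Node x ts)
  have *: "set (leaves t) \<inter> set (inner_verts u) = {}" if t: "t \<in> set ts" and u: "u \<in> set ts" for t u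
  proof (cases "set (tverts t) \<inter> set (tverts u) = {}")
    case True
    then show ?thesis using inner_subset_tverts[of u] leaves_subset_tverts[of t] by blast
  next
    case False
    have d: "distinct (concat (map tverts ts))" using Node.prems by simp
    have "t = u"
    proof (rule ccontr)
      assume "t \<noteq> u"
      with t u have "set (tverts t) \<inter> set (tverts u) = {}"
        by (intro distinct_concat_disjoint[OF d])
      with False show False by blast
    qed
    then show ?thesis using Node.IH[OF t] distinct_concat_mapD[OF d t] by simp
  qed
  have "x \<notin> set (leaves t)" if "t \<in> set ts" for t
    using Node.prems that leaves_subset_tverts by fastforce
  then show ?case using * by auto
qed simp

lemma sum_list_cong_depends:
  "(\<And>t. t \<in> set ts \<Longrightarrow> f t = g t) \<Longrightarrow> (\<Sum>t\<leftarrow>ts. f t) = (\<Sum>t\<leftarrow>ts. g t :: real)"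
  by (intro arg_cong[where f = sum_list] map_cong refl) blast

lemma depends_on_energy: "depends_on (set (tverts t)) (energy t)"
proof (induction t)
  case (Node x ts)
  show ?case
    unfolding depends_on_def
  proof (intro allI impI)
    fix \<sigma> \<tau> :: "'a \<Rightarrow> real" assume eq: "\<forall>y\<in>set (tverts (Node x ts)). \<sigma> y = \<tau> y"
    have "energy t \<sigma> = energy t \<tau> \<and> \<sigma> (troot t) = \<tau> (troot t)" if "t \<in> set ts" for t
      using eq that depends_onD[OF Node.IH[OF that], of \<sigma> \<tau>] root_in_tverts[of t] by auto
    moreover have "\<sigma> x = \<tau> x" using eq by simp
    ultimately show "energy (Node x ts) \<sigma> = energy (Node x ts) \<tau>"
      unfolding energy.simps by (intro sum_list_cong_depends) simp
  qed
qed (simp add: depends_on_def)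

lemma depends_on_msg: "depends_on (set (leaves t)) (msg b t s)"
proof (induction t arbitrary: s)
  case (Node x ts)
  show ?case
    unfolding depends_on_def
  proof (intro allI impI)
    fix \<sigma> \<tau> :: "'a \<Rightarrow> real" assume eq: "\<forall>y\<in>set (leaves (Node x ts)). \<sigma> y = \<tau> y"
    have "msg b t s \<sigma> = msg b t s \<tau>" if "t \<in> set ts" for t s
      using eq that by (intro depends_onD[OF Node.IH[OF that]]) auto
    then have "map (\<lambda>t. msg b t s \<sigma>) ts = map (\<lambda>t. msg b t s \<tau>) ts" for s by simp
    then show "msg b (Node x ts) s \<sigma> = msg b (Node x ts) s \<tau>"
      by (simp only: msg.simps)
  qed
qed (simp add: depends_on_def)

lemma depends_on_cavity_field: "depends_on (set (leaves t)) (cavity_field b t)"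
proof (induction t)
  case (Node x ts)
  show ?case
    unfolding depends_on_def
  proof (intro allI impI)
    fix \<sigma> \<tau> :: "'a \<Rightarrow> real" assume eq: "\<forall>y\<in>set (leaves (Node x ts)). \<sigma> y = \<tau> y"
    have "cavity_field b t \<sigma> = cavity_field b t \<tau>" if "t \<in> set ts" for t
      using eq that by (intro depends_onD[OF Node.IH[OF that]]) auto
    then show "cavity_field b (Node x ts) \<sigma> = cavity_field b (Node x ts) \<tau>"
      unfolding cavity_field.simps by (intro arg_cong[where f = "cavity_map b"] sum_list_cong_depends)
  qed
qed (simp add: depends_on_def)

definition tree_weight :: "real \<Rightarrow> 'v rtree \<Rightarrow> real \<Rightarrow> ('v \<Rightarrow> real) \<Rightarrow> real" where
  "tree_weight b t s \<sigma> = exp (b * s * \<sigma> (troot t)) * exp (b * energy t \<sigma>)"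

lemma depends_on_tree_weight: "depends_on (set (tverts t)) (tree_weight b t s)"
  unfolding depends_on_def tree_weight_def
proof (intro allI impI)
  fix \<sigma> \<tau> :: "'a \<Rightarrow> real" assume eq: "\<forall>x\<in>set (tverts t). \<sigma> x = \<tau> x"
  have "energy t \<sigma> = energy t \<tau>" by (rule depends_onD[OF depends_on_energy]) (use eq in blast)
  moreover have "\<sigma> (troot t) = \<tau> (troot t)" using eq root_in_tverts by blast
  ultimately show "exp (b * s * \<sigma> (troot t)) * exp (b * energy t \<sigma>) = exp (b * s * \<tau> (troot t)) * exp (b * energy t \<tau>)"
    by simp
qed

lemma exp_energy_children:
  "exp (b * (\<Sum>t\<leftarrow>ts. s * \<sigma> (troot t) + energy t \<sigma>)) = (\<Prod>t\<leftarrow>ts. tree_weight b t s \<sigma>)"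
  by (induction ts) (simp_all add: tree_weight_def algebra_simps exp_add)

text \<open>Belief propagation is exact on trees: once the spin of the root is fixed, the subtrees of the children are
  independent.\<close>

lemma avgs_tree_weight:
  "distinct (tverts t) \<Longrightarrow> avgs (inner_verts t) (tree_weight b t s) \<tau> = msg b t s \<tau>"
proof (induction t arbitrary: s \<tau>)
  case (Leaf x)
  then show ?case by (simp add: tree_weight_def)
next
  case (Node x ts)
  let ?X = "concat (map inner_verts ts)"
  have d: "distinct (concat (map tverts ts))" and x: "x \<notin> set (concat (map tverts ts))"
    using Node.prems by auto
  have xX: "x \<notin> set ?X" using x inner_subset_tverts by fastforce
  have children: "avgs ?X (\<lambda>\<sigma>. \<Prod>t\<leftarrow>ts. tree_weight b t r \<sigma>) \<tau> = (\<Prod>t\<leftarrow>ts. msg b t r \<tau>)" for r \<tau>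
  proof -
    have "avgs ?X (\<lambda>\<sigma>. \<Prod>t\<leftarrow>ts. tree_weight b t r \<sigma>) \<tau> = (\<Prod>t\<leftarrow>ts. avgs (inner_verts t) (tree_weight b t r) \<tau>)"
      by (rule avgs_prod_list[where D = "\<lambda>t. set (tverts t)"])
        (rule distinct_concat_sorted_wrt[OF d] depends_on_tree_weight inner_subset_tverts)+
    also have "\<dots> = (\<Prod>t\<leftarrow>ts. msg b t r \<tau>)"
      by (intro arg_cong[where f = prod_list] map_cong refl Node.IH distinct_concat_mapD[OF d])
    finally show ?thesis .
  qed
  have "avgs ?X (tree_weight b (Node x ts) s) \<sigma> = exp (b * s * \<sigma> x) * (\<Prod>t\<leftarrow>ts. msg b t (\<sigma> x) \<sigma>)" for \<sigma>
  proof -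
    have "avgs ?X (tree_weight b (Node x ts) s) \<sigma>
        = avgs ?X (\<lambda>\<rho>. exp (b * s * \<sigma> x) * (\<Prod>t\<leftarrow>ts. tree_weight b t (\<sigma> x) \<rho>)) \<sigma>"
    proof (rule avgs_local)
      fix \<rho> assume "\<And>y. y \<notin> set ?X \<Longrightarrow> \<rho> y = \<sigma> y"
      then have "\<rho> x = \<sigma> x" using xX by blast
      then show "tree_weight b (Node x ts) s \<rho> = exp (b * s * \<sigma> x) * (\<Prod>t\<leftarrow>ts. tree_weight b t (\<sigma> x) \<rho>)"
        unfolding tree_weight_def[of b "Node x ts"] by (simp add: exp_energy_children)
    qed
    also have "\<dots> = exp (b * s * \<sigma> x) * (\<Prod>t\<leftarrow>ts. msg b t (\<sigma> x) \<sigma>)"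
      by (subst avgs_mult[where D = "{}"]) (auto simp: depends_on_def children)
    finally show ?thesis .
  qed
  moreover have "(\<Prod>t\<leftarrow>ts. msg b t r (\<tau>(x := r))) = (\<Prod>t\<leftarrow>ts. msg b t r \<tau>)" for r
  proof -
    have "msg b t r (\<tau>(x := r)) = msg b t r \<tau>" if "t \<in> set ts" for t
      by (rule depends_onD[OF depends_on_msg]) (use x that leaves_subset_tverts in fastforce)
    then show ?thesis by (intro arg_cong[where f = prod_list] map_cong refl)
  qed
  ultimately show ?case by (simp add: avg_def)
qed

lemma exp_ln_cosh_half: "exp (ln (cosh (x :: real)) / 2) = sqrt (cosh x)"
proof -
  have "0 < cosh x" by (rule cosh_real_pos)
  then have "ln (cosh x) / 2 = ln (sqrt (cosh x))" and "0 < sqrt (cosh x)"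
    by (simp_all only: ln_sqrt real_sqrt_gt_0_iff)
  then show ?thesis by (simp only: exp_ln)
qed

text \<open>A function on \<open>{1, -1}\<close> with positive values is of the form \<open>C exp (s a)\<close>; the recursion for messages becomes the recursion for
  cavity fields.\<close>

lemma msg_cavity_field:
  "\<exists>C>0. \<forall>s\<in>{1, -1}. msg b t s \<sigma> = C * exp (s * cavity_field b t \<sigma>)"
proof (induction t)
  case (Leaf x)
  then show ?case by (intro exI[of _ 1]) (auto simp: mult_ac)
next
  case (Node x ts)
  have "\<exists>C>0. \<forall>s\<in>{1, -1}. (\<Prod>t\<leftarrow>ts. msg b t s \<sigma>) = C * exp (s * (\<Sum>t\<leftarrow>ts. cavity_field b t \<sigma>))"
    using Node.IH
  proof (induction ts)
    case Nil
    then show ?case by (intro exI[of _ 1]) auto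
  next
    case (Cons t ts)
    obtain C where C: "C > 0" "\<forall>s\<in>{1, -1}. msg b t s \<sigma> = C * exp (s * cavity_field b t \<sigma>)"
      using Cons.prems[of t] by auto
    obtain C' where C': "C' > 0" "\<forall>s\<in>{1, -1}. (\<Prod>t\<leftarrow>ts. msg b t s \<sigma>) = C' * exp (s * (\<Sum>t\<leftarrow>ts. cavity_field b t \<sigma>))"
      using Cons.IH[OF Cons.prems] by auto
    show ?case
    proof (intro exI[of _ "C * C'"] conjI ballI)
      fix s :: real assume "s \<in> {1, -1}"
      then show "(\<Prod>t\<leftarrow>t # ts. msg b t s \<sigma>) = C * C' * exp (s * (\<Sum>t\<leftarrow>t # ts. cavity_field b t \<sigma>))"
        using C(2) C'(2) by (simp only: list.map prod_list.Cons sum_list.Cons distrib_left exp_add mult_ac)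
    qed (use C C' in simp)
  qed
  then obtain C where C: "C > 0"
    "\<forall>s\<in>{1, -1}. (\<Prod>t\<leftarrow>ts. msg b t s \<sigma>) = C * exp (s * (\<Sum>t\<leftarrow>ts. cavity_field b t \<sigma>))" by auto
  define X where "X = (\<Sum>t\<leftarrow>ts. cavity_field b t \<sigma>)"
  define p where "p = sqrt (cosh (b + X))"
  define q where "q = sqrt (cosh (b - X))"
  have pq: "0 < p" "0 < q" "p * p = cosh (b + X)" "q * q = cosh (b - X)"
    using cosh_real_pos[of "b + X"] cosh_real_pos[of "b - X"] by (simp_all add: p_def q_def)
  have e: "exp (cavity_map b X) = p / q" "exp (- cavity_map b X) = q / p"
    by (simp_all add: cavity_map_def p_def q_def diff_divide_distrib exp_diff exp_ln_cosh_half)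
  have P: "(\<Prod>t\<leftarrow>ts. msg b t 1 \<sigma>) = C * exp X" "(\<Prod>t\<leftarrow>ts. msg b t (-1) \<sigma>) = C * exp (- X)"
    using C(2) by (auto simp: X_def)
  have "msg b (Node x ts) 1 \<sigma> = C * cosh (b + X)"
  proof -
    have "cosh (b + X) = (exp b * exp X + exp (- b) * exp (- X)) / 2"
      by (simp add: cosh_def flip: exp_add)
    moreover have "msg b (Node x ts) 1 \<sigma> = C * ((exp b * exp X + exp (- b) * exp (- X)) / 2)"
      by (simp add: P distrib_left mult.left_commute)
    ultimately show ?thesis by (simp only:)
  qed
  moreover have "msg b (Node x ts) (-1) \<sigma> = C * cosh (b - X)"
  proof -
    have "cosh (b - X) = (exp (- b) * exp X + exp b * exp (- X)) / 2"
      by (simp add: cosh_def add.commute flip: exp_add)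
    moreover have "msg b (Node x ts) (-1) \<sigma> = C * ((exp (- b) * exp X + exp b * exp (- X)) / 2)"
      by (simp add: P distrib_left mult.left_commute)
    ultimately show ?thesis by (simp only:)
  qed
  ultimately have "\<forall>s\<in>{1, -1}. msg b (Node x ts) s \<sigma> = (C * (p * q)) * exp (s * cavity_map b X)"
  proof -
    assume "msg b (Node x ts) 1 \<sigma> = C * cosh (b + X)" "msg b (Node x ts) (-1) \<sigma> = C * cosh (b - X)"
    moreover have "C * (p * q) * (p / q) = C * (p * p)" "C * (p * q) * (q / p) = C * (q * q)"
      using pq(1,2) by simp_all
    ultimately show ?thesis by (simp only: ball_simps mult_1 mult_minus1 e pq(3,4))
  qed
  then show ?case
    using C(1) pq by (intro exI[of _ "C * (p * q)"]) (simp add: X_def)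
qed

definition msg_scale :: "real \<Rightarrow> 'v rtree \<Rightarrow> ('v \<Rightarrow> real) \<Rightarrow> real" where
  "msg_scale b t \<sigma> = sqrt (msg b t 1 \<sigma> * msg b t (-1) \<sigma>)"

lemma msg_eq:
  assumes "s \<in> {1, -1}"
  shows "msg b t s \<sigma> = msg_scale b t \<sigma> * exp (s * cavity_field b t \<sigma>)"
proof -
  obtain C where C: "C > 0" "\<forall>s\<in>{1, -1}. msg b t s \<sigma> = C * exp (s * cavity_field b t \<sigma>)"
    using msg_cavity_field[of b t \<sigma>] by auto
  then have "msg b t 1 \<sigma> * msg b t (-1) \<sigma> = C\<^sup>2"
    by (simp add: power2_eq_square mult_ac exp_minus_inverse)
  then have "msg_scale b t \<sigma> = C" using C(1) by (simp add: msg_scale_def)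
  then show ?thesis using C(2) assms by auto
qed

lemma prod_msg_eq:
  assumes "s \<in> {1, -1}"
  shows "(\<Prod>t\<leftarrow>ts. msg b t s \<sigma>) = (\<Prod>t\<leftarrow>ts. msg_scale b t \<sigma>) * exp (s * (\<Sum>t\<leftarrow>ts. cavity_field b t \<sigma>))"
proof (induction ts)
  case (Cons t ts)
  then show ?case
    by (simp only: list.map prod_list.Cons sum_list.Cons distrib_left exp_add mult_ac msg_eq[OF assms])
qed simp

text \<open>The correlation of two spins with coupling \<open>b\<close> in the fields \<open>X\<close> and \<open>Y\<close>.\<close>

definition edge_corr :: "real \<Rightarrow> real \<Rightarrow> real \<Rightarrow> real" where
  "edge_corr b X Y = (exp b * cosh (X + Y) - exp (- b) * cosh (X - Y)) / (exp b * cosh (X + Y) + exp (- b) * cosh (X - Y))"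

lemma edge_corr_bound: "\<bar>edge_corr b X Y - tanh b\<bar> \<le> X\<^sup>2 + Y\<^sup>2"
proof -
  define p where "p = exp b"
  define q where "q = exp (- b)"
  define u where "u = cosh X * cosh Y"
  define v where "v = sinh X * sinh Y"
  have pq: "0 < p" "0 < q" by (auto simp: p_def q_def)
  have c: "cosh (X + Y) = u + v" "cosh (X - Y) = u - v"
    by (simp_all add: u_def v_def cosh_add cosh_diff)
  have u: "0 < u" by (simp add: u_def cosh_real_pos)
  have cp: "0 < u + v" "0 < u - v" using c cosh_real_pos by metis+
  let ?D = "p * (u + v) + q * (u - v)"
  have D: "0 < ?D"
    using mult_pos_pos[OF pq(1) cp(1)] mult_pos_pos[OF pq(2) cp(2)] by linarith
  have "tanh b = (p - q) / (p + q)"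
  proof -
    have "sinh b = (p - q) / 2" "cosh b = (p + q) / 2"
      by (simp_all add: sinh_field_def cosh_field_def p_def q_def)
    moreover have "(x / 2) / (y / 2) = x / y" for x y :: real by simp
    ultimately show ?thesis by (simp only: tanh_def)
  qed
  then have "edge_corr b X Y - tanh b = (p * (u + v) - q * (u - v)) / ?D - (p - q) / (p + q)"
    by (simp add: edge_corr_def c p_def q_def)
  also have "\<dots> = ((p * (u + v) - q * (u - v)) * (p + q) - (p - q) * ?D) / (?D * (p + q))"
    using D pq by (simp add: diff_frac_eq)
  also have "(p * (u + v) - q * (u - v)) * (p + q) - (p - q) * ?D = 4 * (p * q) * v"
    by (simp add: algebra_simps)
  finally have "\<bar>edge_corr b X Y - tanh b\<bar> = 4 * (p * q) * \<bar>v\<bar> / (?D * (p + q))"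
    using D pq by (simp add: abs_mult)
  also have "\<dots> \<le> 2 * \<bar>v\<bar> / u"
  proof -
    have "2 * (p * q) * u \<le> ?D * (p + q)"
    proof -
      have "?D * (p + q) - 2 * (p * q) * u = p * p * (u + v) + q * q * (u - v)"
        by (simp add: algebra_simps)
      moreover have "0 \<le> p * p * (u + v) + q * q * (u - v)"
        using mult_nonneg_nonneg[of "p * p" "u + v"] mult_nonneg_nonneg[of "q * q" "u - v"] cp by simp
      ultimately show ?thesis by linarith
    qed
    then have "(2 * \<bar>v\<bar>) * (2 * (p * q) * u) \<le> (2 * \<bar>v\<bar>) * (?D * (p + q))"
      by (intro mult_left_mono) auto
    then have "(4 * (p * q) * \<bar>v\<bar>) * u \<le> (2 * \<bar>v\<bar>) * (?D * (p + q))"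
      by (simp add: mult_ac)
    then show ?thesis
      using D pq u by (simp add: divide_le_eq pos_le_divide_eq mult_pos_pos)
  qed
  also have "\<dots> = 2 * (\<bar>tanh X\<bar> * \<bar>tanh Y\<bar>)"
    using cosh_real_pos[of X] cosh_real_pos[of Y] by (simp add: u_def v_def tanh_def abs_mult)
  also have "\<dots> \<le> 2 * (\<bar>X\<bar> * \<bar>Y\<bar>)"
    by (intro mult_left_mono mult_mono abs_tanh_le) auto
  also have "\<dots> \<le> X\<^sup>2 + Y\<^sup>2"
    using sum_squares_bound[of "\<bar>X\<bar>" "\<bar>Y\<bar>"] by (simp add: mult.assoc)
  finally show ?thesis .
qed

text \<open>The conditional law of the two end points of an edge, given the spins at the leaves of the two trees that hang off
  the edge. Averaging over the inner vertices does not change the total sum, and the remaining part \<open>R\<close> of the energy is unaffected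
  by it.\<close>

lemma tree_edge_correlation:
  fixes V :: "'v set" and q R :: "('v \<Rightarrow> real) \<Rightarrow> real"
  assumes fin: "finite V" and d: "distinct (tverts (Node v ts) @ tverts (Node u us))"
    and sub: "set (inner_verts (Node v ts)) \<union> set (inner_verts (Node u us)) \<subseteq> V"
    and q: "\<And>\<sigma>. q \<sigma> = \<sigma> v * \<sigma> u + energy (Node v ts) \<sigma> + energy (Node u us) \<sigma> + R \<sigma>"
    and R: "depends_on D R" "D \<inter> (set (inner_verts (Node v ts)) \<union> set (inner_verts (Node u us))) = {}"
  shows "(\<Sum>\<sigma>\<in>spin_cfgs V. exp (b * q \<sigma>) * (\<sigma> v * \<sigma> u))
    = (\<Sum>\<sigma>\<in>spin_cfgs V. exp (b * q \<sigma>) * edge_corr b (\<Sum>t\<leftarrow>ts. cavity_field b t \<sigma>) (\<Sum>t\<leftarrow>us. cavity_field b t \<sigma>))"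
proof -
  define X where "X = (\<lambda>\<sigma>. \<Sum>t\<leftarrow>ts. cavity_field b t \<sigma>)"
  define Y where "Y = (\<lambda>\<sigma>. \<Sum>t\<leftarrow>us. cavity_field b t \<sigma>)"
  define I where "I = concat (map inner_verts (ts @ us))"
  define J where "J = v # u # I"
  define L where "L = set (concat (map leaves (ts @ us)))"
  have setJ: "set J = set (inner_verts (Node v ts)) \<union> set (inner_verts (Node u us))"
    by (auto simp: J_def I_def)
  have dts: "distinct (concat (map tverts (ts @ us)))" and vu: "v \<noteq> u"
    "v \<notin> set (concat (map tverts (ts @ us)))" "u \<notin> set (concat (map tverts (ts @ us)))"
    using d by auto
  have Isub: "set I \<subseteq> set (concat (map tverts (ts @ us)))"
    unfolding I_def using inner_subset_tverts by fastforce
  have Lsub: "L \<subseteq> set (concat (map tverts (ts @ us)))"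
    unfolding L_def using leaves_subset_tverts by fastforce
  have LI: "L \<inter> set I = {}"
    using leaves_inner_disjoint[of "Node v (ts @ us)"] dts vu by (auto simp: L_def I_def)
  have LJ: "L \<inter> set J = {}" using LI Lsub vu by (auto simp: J_def)
  have depX: "depends_on L X"
    unfolding depends_on_def X_def
    by (intro allI impI sum_list_cong_depends depends_onD[OF depends_on_cavity_field]) (auto simp: L_def)
  have depY: "depends_on L Y"
    unfolding depends_on_def Y_def
    by (intro allI impI sum_list_cong_depends depends_onD[OF depends_on_cavity_field]) (auto simp: L_def)
  define K where "K = (\<lambda>\<sigma>. \<Prod>t\<leftarrow>ts @ us. msg_scale b t \<sigma>)"
  have children: "avgs I (\<lambda>\<sigma>. (\<Prod>t\<leftarrow>ts. tree_weight b t s \<sigma>) * (\<Prod>t\<leftarrow>us. tree_weight b t s' \<sigma>)) \<tau>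
      = K \<tau> * exp (s * X \<tau> + s' * Y \<tau>)" if s: "s \<in> {1, -1}" "s' \<in> {1, -1}" for s s' \<tau>
  proof -
    define ps where "ps = map (\<lambda>t. (t, s)) ts @ map (\<lambda>t. (t, s')) us"
    have fst: "map fst ps = ts @ us" by (simp add: ps_def comp_def)
    have "avgs (concat (map (\<lambda>p. inner_verts (fst p)) ps)) (\<lambda>\<sigma>. \<Prod>p\<leftarrow>ps. tree_weight b (fst p) (snd p) \<sigma>) \<tau>
        = (\<Prod>p\<leftarrow>ps. avgs (inner_verts (fst p)) (tree_weight b (fst p) (snd p)) \<tau>)"
    proof (rule avgs_prod_list[where D = "\<lambda>p. set (tverts (fst p))"])
      show "sorted_wrt (\<lambda>p q. set (tverts (fst p)) \<inter> set (tverts (fst q)) = {}) ps"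
        using distinct_concat_sorted_wrt[OF dts] unfolding fst[symmetric] sorted_wrt_map .
    qed (rule depends_on_tree_weight inner_subset_tverts)+
    also have "map (\<lambda>p. inner_verts (fst p)) ps = map inner_verts (ts @ us)"
      unfolding fst[symmetric] by simp
    also have "(\<Prod>p\<leftarrow>ps. avgs (inner_verts (fst p)) (tree_weight b (fst p) (snd p)) \<tau>)
        = (\<Prod>p\<leftarrow>ps. msg b (fst p) (snd p) \<tau>)"
    proof (intro arg_cong[where f = prod_list] map_cong refl avgs_tree_weight)
      fix p assume "p \<in> set ps"
      then have "fst p \<in> set (ts @ us)" unfolding fst[symmetric] by simp
      then show "distinct (tverts (fst p))" by (rule distinct_concat_mapD[OF dts])
    qed
    also have "\<dots> = (\<Prod>t\<leftarrow>ts. msg b t s \<tau>) * (\<Prod>t\<leftarrow>us. msg b t s' \<tau>)"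
      by (simp add: ps_def comp_def)
    also have "\<dots> = K \<tau> * exp (s * X \<tau> + s' * Y \<tau>)"
      unfolding prod_msg_eq[OF s(1)] prod_msg_eq[OF s(2)] by (simp add: K_def X_def Y_def exp_add)
    finally show ?thesis by (simp add: ps_def comp_def I_def)
  qed
  let ?W = "\<lambda>\<sigma>. exp (b * (\<sigma> v * \<sigma> u + energy (Node v ts) \<sigma> + energy (Node u us) \<sigma>))"
  have inner: "avgs J (\<lambda>\<sigma>. ?W \<sigma> * g (\<sigma> v * \<sigma> u)) \<tau>
      = K' * (exp b * cosh (X \<tau> + Y \<tau>) * g 1 + exp (- b) * cosh (X \<tau> - Y \<tau>) * g (-1)) / 2"
    if K': "\<And>s s'. K (\<tau>(v := s, u := s')) = K'" for g \<tau> K'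
  proof -
    have loc: "avgs I (\<lambda>\<sigma>. ?W \<sigma> * g (\<sigma> v * \<sigma> u)) \<rho>
        = exp (b * (s * s')) * g (s * s') * (K \<rho> * exp (s * X \<rho> + s' * Y \<rho>))"
      if s: "s \<in> {1, -1}" "s' \<in> {1, -1}" "\<rho> v = s" "\<rho> u = s'" for s s' \<rho>
    proof -
      have "avgs I (\<lambda>\<sigma>. ?W \<sigma> * g (\<sigma> v * \<sigma> u)) \<rho>
          = avgs I (\<lambda>\<sigma>. (exp (b * (s * s')) * g (s * s')) * ((\<Prod>t\<leftarrow>ts. tree_weight b t s \<sigma>) * (\<Prod>t\<leftarrow>us. tree_weight b t s' \<sigma>))) \<rho>"
      proof (rule avgs_local)
        fix \<sigma> assume "\<And>y. y \<notin> set I \<Longrightarrow> \<sigma> y = \<rho> y"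
        moreover have "v \<notin> set I" "u \<notin> set I" using Isub vu by auto
        ultimately have "\<sigma> v = s" "\<sigma> u = s'" using s by auto
        then show "?W \<sigma> * g (\<sigma> v * \<sigma> u) = (exp (b * (s * s')) * g (s * s')) * ((\<Prod>t\<leftarrow>ts. tree_weight b t s \<sigma>) * (\<Prod>t\<leftarrow>us. tree_weight b t s' \<sigma>))"
          by (simp add: distrib_left[of b] exp_add exp_energy_children)
      qed
      also have "\<dots> = (exp (b * (s * s')) * g (s * s')) * (K \<rho> * exp (s * X \<rho> + s' * Y \<rho>))"
        by (subst avgs_mult[where D = "{}"]) (use children[OF s(1,2)] in \<open>auto simp: depends_on_def\<close>)
      finally show ?thesis .
    qed
    have XY: "X (\<tau>(v := s, u := s')) = X \<tau>" "Y (\<tau>(v := s, u := s')) = Y \<tau>" for s s'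
      by (rule depends_onD[OF depX] depends_onD[OF depY]; use LJ in \<open>auto simp: J_def\<close>)+
    have l: "avgs I (\<lambda>\<sigma>. ?W \<sigma> * g (\<sigma> v * \<sigma> u)) (\<tau>(v := s, u := s'))
       = exp (b * (s * s')) * g (s * s') * (K' * exp (s * X \<tau> + s' * Y \<tau>))"
      if s: "s \<in> {1, -1}" "s' \<in> {1, -1}" for s s'
      by (subst loc[OF s]) (use vu(1) XY K' in auto)
    have "avgs J (\<lambda>\<sigma>. ?W \<sigma> * g (\<sigma> v * \<sigma> u)) \<tau>
        = (exp b * g 1 * (K' * exp (X \<tau> + Y \<tau>)) + exp (- b) * g (-1) * (K' * exp (X \<tau> - Y \<tau>))
         + exp (- b) * g (-1) * (K' * exp (- X \<tau> + Y \<tau>)) + exp b * g 1 * (K' * exp (- X \<tau> - Y \<tau>))) / 4"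
    proof -
      have four: "((w + x) / 2 + (y + z) / 2) / 2 = (w + x + y + z) / 4" for w x y z :: real
        by (simp add: add_divide_distrib)
      show ?thesis
        unfolding J_def avgs.simps avg_def four
        using l[of 1 1] l[of 1 "-1"] l[of "-1" 1] l[of "-1" "-1"] by simp
    qed
    also have "\<dots> = K' * (exp b * cosh (X \<tau> + Y \<tau>) * g 1 + exp (- b) * cosh (X \<tau> - Y \<tau>) * g (-1)) / 2"
    proof -
      have "cosh (X \<tau> + Y \<tau>) = (exp (X \<tau> + Y \<tau>) + exp (- X \<tau> - Y \<tau>)) / 2"
        "cosh (X \<tau> - Y \<tau>) = (exp (X \<tau> - Y \<tau>) + exp (- X \<tau> + Y \<tau>)) / 2"
        by (simp_all add: cosh_def)
      then show ?thesis by (simp only:) (simp add: field_simps)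
    qed
    finally show ?thesis .
  qed
  have depK: "K \<sigma> = K \<tau>" if "\<And>x. x \<in> L \<Longrightarrow> \<sigma> x = \<tau> x" for \<sigma> \<tau>
  proof -
    have "msg b t s \<sigma> = msg b t s \<tau>" if "t \<in> set (ts @ us)" for t s
      by (rule depends_onD[OF depends_on_msg]) (use \<open>\<And>x. x \<in> L \<Longrightarrow> \<sigma> x = \<tau> x\<close> that in \<open>auto simp: L_def\<close>)
    then show ?thesis
      unfolding K_def msg_scale_def by (intro arg_cong[where f = prod_list] map_cong refl) simp
  qed
  have "avgs J (\<lambda>\<sigma>. ?W \<sigma> * (\<sigma> v * \<sigma> u)) \<tau> = edge_corr b (X \<tau>) (Y \<tau>) * avgs J ?W \<tau>" for \<tau>
  proof -
    have K': "K (\<tau>(v := s, u := s')) = K \<tau>" for s s'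
      by (rule depK) (use LJ in \<open>auto simp: J_def\<close>)
    have "0 < exp b * cosh (X \<tau> + Y \<tau>) + exp (- b) * cosh (X \<tau> - Y \<tau>)"
      by (intro add_pos_pos mult_pos_pos cosh_real_pos exp_gt_zero)
    moreover have "avgs J (\<lambda>\<sigma>. ?W \<sigma> * (\<sigma> v * \<sigma> u)) \<tau>
        = K \<tau> * (exp b * cosh (X \<tau> + Y \<tau>) - exp (- b) * cosh (X \<tau> - Y \<tau>)) / 2"
      using inner[OF K', of "\<lambda>x. x"] by (simp only: mult_1_right mult_minus1_right diff_conv_add_uminus)
    moreover have "avgs J ?W \<tau> = K \<tau> * (exp b * cosh (X \<tau> + Y \<tau>) + exp (- b) * cosh (X \<tau> - Y \<tau>)) / 2"
      using inner[OF K', of "\<lambda>x. 1"] by (simp only: mult_1_right)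
    ultimately show ?thesis
      unfolding edge_corr_def by (simp only: times_divide_eq_left times_divide_eq_right) simp
  qed
  moreover have dE: "depends_on L (\<lambda>\<sigma>. edge_corr b (X \<sigma>) (Y \<sigma>))"
    unfolding depends_on_def using depends_onD[OF depX] depends_onD[OF depY] by metis
  ultimately have *: "avgs J (\<lambda>\<sigma>. ?W \<sigma> * (\<sigma> v * \<sigma> u)) \<tau> = avgs J (\<lambda>\<sigma>. edge_corr b (X \<sigma>) (Y \<sigma>) * ?W \<sigma>) \<tau>" for \<tau>
    by (subst avgs_mult[OF dE]) (use LJ in auto)
  have dR: "depends_on D (\<lambda>\<sigma>. exp (b * R \<sigma>))"
    unfolding depends_on_def using depends_onD[OF R(1)] by metis
  have split: "exp (b * q \<sigma>) = exp (b * R \<sigma>) * ?W \<sigma>" for \<sigma>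
    by (simp add: q distrib_left flip: exp_add)
  have JD: "set J \<inter> D = {}" using R(2) setJ by auto
  have "(\<Sum>\<sigma>\<in>spin_cfgs V. exp (b * q \<sigma>) * (\<sigma> v * \<sigma> u))
      = (\<Sum>\<sigma>\<in>spin_cfgs V. avgs J (\<lambda>\<sigma>. exp (b * R \<sigma>) * (?W \<sigma> * (\<sigma> v * \<sigma> u))) \<sigma>)"
    using sub setJ by (subst sum_spin_cfgs_avgs[OF fin]) (auto simp: split mult.assoc)
  also have "\<dots> = (\<Sum>\<sigma>\<in>spin_cfgs V. avgs J (\<lambda>\<sigma>. exp (b * R \<sigma>) * (edge_corr b (X \<sigma>) (Y \<sigma>) * ?W \<sigma>)) \<sigma>)"
    by (simp only: avgs_mult[OF dR JD] *)
  also have "\<dots> = (\<Sum>\<sigma>\<in>spin_cfgs V. exp (b * q \<sigma>) * edge_corr b (X \<sigma>) (Y \<sigma>))"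
    using sub setJ by (subst sum_spin_cfgs_avgs[OF fin]) (auto simp: split mult_ac)
  finally show ?thesis by (simp add: X_def Y_def)
qed

section \<open>Decay of the influence of boundary spins\<close>

text \<open>The derivative is \<open>sinh b cosh b / (cosh\<^sup>2 b + sinh\<^sup>2 z)\<close>, which is largest in absolute value at \<open>z = 0\<close>.\<close>

lemma cavity_map_lipschitz: "\<bar>cavity_map b x - cavity_map b y\<bar> \<le> tanh \<bar>b\<bar> * \<bar>x - y\<bar>"
proof -
  have der: "(cavity_map b has_real_derivative (tanh (b + z) + tanh (b - z)) / 2) (at z)" for z
    unfolding cavity_map_def[abs_def]
    by (auto intro!: derivative_eq_intros simp: tanh_def field_simps cosh_real_pos less_imp_neq[OF cosh_real_pos, symmetric])
  have bound: "\<bar>(tanh (b + z) + tanh (b - z)) / 2\<bar> \<le> tanh \<bar>b\<bar>" for z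
  proof -
    let ?P = "cosh (b + z) * cosh (b - z)"
    have P: "0 < ?P" by (intro mult_pos_pos cosh_real_pos)
    have cb: "0 < cosh b" by (rule cosh_real_pos)
    have "tanh (b + z) + tanh (b - z) = (sinh (b + z) * cosh (b - z) + sinh (b - z) * cosh (b + z)) / ?P"
      unfolding tanh_def using cosh_real_pos[of "b + z"] cosh_real_pos[of "b - z"]
      by (subst add_frac_eq) (auto simp: less_imp_neq[OF cosh_real_pos, symmetric])
    also have "sinh (b + z) * cosh (b - z) + sinh (b - z) * cosh (b + z) = 2 * sinh b * cosh b"
    proof -
      have "sinh (b + z) * cosh (b - z) + sinh (b - z) * cosh (b + z) = sinh ((b + z) + (b - z))"
        by (simp only: sinh_add mult.commute)
      also have "(b + z) + (b - z) = 2 * b" by simp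
      finally show ?thesis by (simp only: sinh_double)
    qed
    finally have eq: "(tanh (b + z) + tanh (b - z)) / 2 = sinh b * cosh b / ?P" by simp
    have "?P = (cosh b)\<^sup>2 + (sinh z)\<^sup>2"
    proof -
      have "?P = (cosh b)\<^sup>2 * (cosh z)\<^sup>2 - (sinh b)\<^sup>2 * (sinh z)\<^sup>2"
        by (simp add: cosh_add cosh_diff power2_eq_square algebra_simps)
      also have "(sinh b)\<^sup>2 = (cosh b)\<^sup>2 - 1" using cosh_square_eq[of b] by simp
      also have "(cosh z)\<^sup>2 = (sinh z)\<^sup>2 + 1" by (rule cosh_square_eq)
      finally show ?thesis by (simp add: algebra_simps)
    qed
    then have le: "(cosh b)\<^sup>2 \<le> ?P" by simp
    have "\<bar>(tanh (b + z) + tanh (b - z)) / 2\<bar> = \<bar>sinh b\<bar> * cosh b / ?P"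
      unfolding eq abs_divide abs_mult using P cb by simp
    also have "\<dots> \<le> \<bar>sinh b\<bar> * cosh b / (cosh b)\<^sup>2"
      using le cb by (intro divide_left_mono) auto
    also have "\<dots> = tanh \<bar>b\<bar>"
      using cb by (cases "0 \<le> b") (simp_all add: tanh_def power2_eq_square sinh_real_nonneg_iff abs_if)
    finally show ?thesis .
  qed
  have "norm (cavity_map b x - cavity_map b y) \<le> tanh \<bar>b\<bar> * norm (x - y)"
    by (rule field_differentiable_bound[of UNIV "cavity_map b" "\<lambda>z. (tanh (b + z) + tanh (b - z)) / 2"])
      (use der bound in auto)
  then show ?thesis by simp
qed

lemma cavity_map_uminus: "cavity_map b (- x) = - cavity_map b x"
  by (simp add: cavity_map_def minus_divide_left)

lemma cavity_field_uminus: "cavity_field b t (\<lambda>i. - \<sigma> i) = - cavity_field b t \<sigma>"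
proof (induction t)
  case (Node x ts)
  have "(\<Sum>t\<leftarrow>ts. cavity_field b t (\<lambda>i. - \<sigma> i)) = (\<Sum>t\<leftarrow>ts. - cavity_field b t \<sigma>)"
    by (rule sum_list_cong_depends) (rule Node.IH)
  also have "\<dots> = - (\<Sum>t\<leftarrow>ts. cavity_field b t \<sigma>)" by (induction ts) auto
  finally show ?case by (simp only: cavity_field.simps cavity_map_uminus)
qed simp

text \<open>An upper bound for the effect of flipping the spin at \<open>x\<close> on the cavity field.\<close>

fun influence :: "real \<Rightarrow> 'v rtree \<Rightarrow> 'v \<Rightarrow> real" where
  "influence b (Leaf y) x = (if x = y then 2 * \<bar>b\<bar> else 0)"
| "influence b (Node y ts) x = tanh \<bar>b\<bar> * (\<Sum>t\<leftarrow>ts. influence b t x)"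

text \<open>The sum of the squared influences when the vertices of the tree are distinct. It decays like \<open>((k - 1) tanh\<^sup>2 b)\<^sup>n\<close>
  in a tree of depth \<open>n\<close> with \<open>k - 1\<close> children per vertex, although the number of leaves grows.\<close>

fun influence_sq :: "real \<Rightarrow> 'v rtree \<Rightarrow> real" where
  "influence_sq b (Leaf y) = 4 * b\<^sup>2"
| "influence_sq b (Node y ts) = (tanh b)\<^sup>2 * (\<Sum>t\<leftarrow>ts. influence_sq b t)"

lemma abs_sum_list_diff_le:
  fixes f g h :: "'a \<Rightarrow> real"
  assumes "\<And>t. t \<in> set ts \<Longrightarrow> \<bar>f t - g t\<bar> \<le> h t"
  shows "\<bar>(\<Sum>t\<leftarrow>ts. f t) - (\<Sum>t\<leftarrow>ts. g t)\<bar> \<le> (\<Sum>t\<leftarrow>ts. h t)"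
  using assms
proof (induction ts)
  case (Cons t ts)
  have "\<bar>f t - g t\<bar> \<le> h t" "\<bar>(\<Sum>t\<leftarrow>ts. f t) - (\<Sum>t\<leftarrow>ts. g t)\<bar> \<le> (\<Sum>t\<leftarrow>ts. h t)"
    using Cons by auto
  then show ?case by simp
qed simp

lemma cavity_field_flip:
  assumes "\<sigma> x = 1 \<or> \<sigma> x = -1"
  shows "\<bar>cavity_field b t (\<sigma>(x := - \<sigma> x)) - cavity_field b t \<sigma>\<bar> \<le> influence b t x"
proof (induction t)
  case (Leaf y)
  have "b * - 1 - b * 1 = - (2 * b)" "b * 1 - b * - 1 = 2 * b" by simp_all
  then show ?case using assms by (auto simp: abs_mult)
next
  case (Node y ts)
  have "\<bar>cavity_field b (Node y ts) (\<sigma>(x := - \<sigma> x)) - cavity_field b (Node y ts) \<sigma>\<bar>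
      \<le> tanh \<bar>b\<bar> * \<bar>(\<Sum>t\<leftarrow>ts. cavity_field b t (\<sigma>(x := - \<sigma> x))) - (\<Sum>t\<leftarrow>ts. cavity_field b t \<sigma>)\<bar>"
    unfolding cavity_field.simps by (rule cavity_map_lipschitz)
  also have "\<dots> \<le> tanh \<bar>b\<bar> * (\<Sum>t\<leftarrow>ts. influence b t x)"
    by (intro mult_left_mono abs_sum_list_diff_le Node.IH) simp_all
  finally show ?case unfolding influence.simps .
qed

lemma influence_outside: "x \<notin> set (tverts t) \<Longrightarrow> influence b t x = 0"
proof (induction t)
  case (Node y ts)
  have "(\<Sum>t\<leftarrow>ts. influence b t x) = (\<Sum>t\<leftarrow>ts. 0)"
    by (rule sum_list_cong_depends) (rule Node.IH, use Node.prems in auto)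
  then show ?case by simp
qed simp

text \<open>A vertex belongs to at most one of the trees, so the mixed terms of the square vanish.\<close>

lemma sqnorm_sum_list_influence:
  assumes "distinct (concat (map tverts ts))" "\<And>t. t \<in> set ts \<Longrightarrow> sqnorm V (influence b t) \<le> influence_sq b t"
  shows "sqnorm V (\<lambda>x. \<Sum>t\<leftarrow>ts. influence b t x) \<le> (\<Sum>t\<leftarrow>ts. influence_sq b t)"
  using assms
proof (induction ts)
  case Nil
  then show ?case by (simp add: sqnorm_def)
next
  case (Cons t ts)
  let ?r = "\<lambda>x. \<Sum>t\<leftarrow>ts. influence b t x"
  have "influence b t x * ?r x = 0" for x
  proof (cases "x \<in> set (tverts t)")
    case True
    then have "x \<notin> set (tverts u)" if "u \<in> set ts" for u using Cons.prems(1) that by auto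
    then have "?r x = (\<Sum>t\<leftarrow>ts. 0)" by (intro sum_list_cong_depends influence_outside)
    then show ?thesis by simp
  qed (simp add: influence_outside)
  then have "(influence b t x + ?r x)\<^sup>2 = (influence b t x)\<^sup>2 + (?r x)\<^sup>2" for x
    by (simp add: power2_sum mult.assoc)
  then have "sqnorm V (\<lambda>x. \<Sum>t\<leftarrow>t # ts. influence b t x) = sqnorm V (influence b t) + sqnorm V ?r"
    by (simp add: sqnorm_def sum.distrib)
  also have "\<dots> \<le> influence_sq b t + (\<Sum>t\<leftarrow>ts. influence_sq b t)"
    using Cons by (intro add_mono) auto
  finally show ?case by simp
qed

lemma sqnorm_influence:
  assumes "finite V"
  shows "distinct (tverts t) \<Longrightarrow> sqnorm V (influence b t) \<le> influence_sq b t"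
proof (induction t)
  case (Leaf y)
  have "sqnorm V (influence b (Leaf y)) = (\<Sum>x\<in>V. if x = y then 4 * b\<^sup>2 else 0)"
    unfolding sqnorm_def by (intro sum.cong) (auto simp: power_mult_distrib)
  also have "\<dots> \<le> influence_sq b (Leaf y)" using assms by simp
  finally show ?case .
next
  case (Node y ts)
  have d: "distinct (concat (map tverts ts))" using Node.prems by simp
  have "sqnorm V (influence b (Node y ts)) = (tanh b)\<^sup>2 * sqnorm V (\<lambda>x. \<Sum>t\<leftarrow>ts. influence b t x)"
    unfolding sqnorm_def sum_distrib_left
    by (intro sum.cong refl) (simp add: power_mult_distrib tanh_real_abs)
  also have "\<dots> \<le> (tanh b)\<^sup>2 * (\<Sum>t\<leftarrow>ts. influence_sq b t)"
    by (intro mult_left_mono sqnorm_sum_list_influence d Node.IH distinct_concat_mapD[OF d]) auto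
  finally show ?case unfolding influence_sq.simps .
qed

section \<open>Quadratic forms and extreme eigenvalues\<close>

lemma sqnorm_mat_app_bound:
  assumes "finite V"
  shows "sqnorm V (mat_app V D y) \<le> (\<Sum>i\<in>V. \<Sum>j\<in>V. (D i j)\<^sup>2) * sqnorm V y"
proof -
  have "sqnorm V (mat_app V D y) \<le> (\<Sum>i\<in>V. (\<Sum>j\<in>V. (D i j)\<^sup>2) * sqnorm V y)"
    unfolding sqnorm_def[of V "mat_app V D y"] mat_app_def
    unfolding sqnorm_def by (intro sum_mono Cauchy_Schwarz_ineq_sum)
  then show ?thesis by (simp add: sum_distrib_right)
qed

lemma quad_le_bound:
  assumes "finite V"
  shows "quad V A x \<le> (1 + (\<Sum>i\<in>V. \<Sum>j\<in>V. (A i j)\<^sup>2)) * sqnorm V x"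
proof -
  have "quad V A x \<le> (\<Sum>i\<in>V. (x i)\<^sup>2 + (mat_app V A x i)\<^sup>2)"
    unfolding quad_conv
  proof (rule sum_mono)
    fix i show "x i * mat_app V A x i \<le> (x i)\<^sup>2 + (mat_app V A x i)\<^sup>2"
      using sum_squares_bound[of "x i" "mat_app V A x i"] zero_le_power2[of "x i"] zero_le_power2[of "mat_app V A x i"]
      by linarith
  qed
  also have "\<dots> = sqnorm V x + sqnorm V (mat_app V A x)"
    by (simp add: sqnorm_def sum.distrib)
  finally show ?thesis
    using sqnorm_mat_app_bound[OF assms, of A x] by (simp add: distrib_right)
qed

text \<open>Rayleigh principle without compactness: if \<open>\<Lambda>\<close>, the supremum of the quadratic form on the unit
  sphere, were not an eigenvalue, then \<open>\<Lambda> - A \<ge> 0\<close> would be invertible, and hence bounded below by a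
  positive multiple of the identity.\<close>

lemma rayleigh_le:
  fixes A :: "'v \<Rightarrow> 'v \<Rightarrow> real"
  assumes fin: "finite V" and sym: "\<And>i j. A i j = A j i"
    and inv: "\<And>l. c < l \<Longrightarrow> \<exists>D. \<forall>x. \<forall>i\<in>V. x i = mat_app V D (\<lambda>j. l * x j - mat_app V A x j) i"
  shows "quad V A x \<le> c * sqnorm V x"
proof (rule ccontr)
  assume contra: "\<not> quad V A x \<le> c * sqnorm V x"
  define S where "S = {l. \<forall>x. quad V A x \<le> l * sqnorm V x}"
  define K where "K = 1 + (\<Sum>i\<in>V. \<Sum>j\<in>V. (A i j)\<^sup>2)"
  have K: "K \<in> S" unfolding S_def K_def using quad_le_bound[OF fin] by blast
  have x0: "0 < sqnorm V x"
  proof -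
    have "sqnorm V x \<noteq> 0"
    proof
      assume z: "sqnorm V x = 0"
      have "quad V A x \<le> K * sqnorm V x" using K by (simp add: S_def)
      with z contra show False by simp
    qed
    then show ?thesis using sqnorm_nonneg[of V x] by linarith
  qed
  define r where "r = quad V A x / sqnorm V x"
  have r: "c < r" using contra x0 by (simp add: r_def pos_less_divide_eq)
  have low: "r \<le> l" if "l \<in> S" for l
    using that x0 by (simp add: S_def r_def pos_divide_le_eq)
  have bdd: "bdd_below S" using low by (intro bdd_belowI[of S r]) auto
  define \<Lambda> where "\<Lambda> = Inf S"
  have rL: "r \<le> \<Lambda>" unfolding \<Lambda>_def using K low by (intro cInf_greatest) auto
  have LS: "quad V A y \<le> \<Lambda> * sqnorm V y" for y
  proof (cases "sqnorm V y = 0")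
    case True
    have "quad V A y \<le> K * sqnorm V y" using K by (simp add: S_def)
    with True show ?thesis by simp
  next
    case False
    then have y: "0 < sqnorm V y" using sqnorm_nonneg[of V y] by linarith
    have "quad V A y / sqnorm V y \<le> \<Lambda>"
      unfolding \<Lambda>_def using K y by (intro cInf_greatest) (auto simp: S_def pos_divide_le_eq)
    then show ?thesis using y by (simp add: pos_divide_le_eq)
  qed
  have "c < \<Lambda>" using r rL by linarith
  from inv[OF this] obtain D where
    "\<forall>x. \<forall>i\<in>V. x i = mat_app V D (\<lambda>j. \<Lambda> * x j - mat_app V A x j) i" ..
  then have D: "x i = mat_app V D (\<lambda>j. \<Lambda> * x j - mat_app V A x j) i" if "i \<in> V" for x i
    using that by blast
  define C where "C = (\<lambda>i j. (if i = j then \<Lambda> else 0) - A i j)"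
  have Capp: "mat_app V C y i = \<Lambda> * y i - mat_app V A y i" if "i \<in> V" for y i
  proof -
    have "mat_app V C y i = (\<Sum>j\<in>V. (if i = j then \<Lambda> * y i else 0) - A i j * y j)"
      unfolding mat_app_def C_def by (intro sum.cong refl) (simp add: left_diff_distrib)
    then show ?thesis using that fin by (simp add: sum_subtractf mat_app_def)
  qed
  have Cquad: "quad V C y = \<Lambda> * sqnorm V y - quad V A y" for y
  proof -
    have "quad V C y = (\<Sum>i\<in>V. y i * (\<Lambda> * y i - mat_app V A y i))"
      unfolding quad_conv by (intro sum.cong refl) (simp add: Capp)
    then show ?thesis
      by (simp add: quad_conv sqnorm_def right_diff_distrib sum_subtractf sum_distrib_left power2_eq_square mult_ac)
  qed
  have Csym: "C i j = C j i" for i j by (simp add: C_def sym)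
  define k where "k = 1 + (\<Sum>i\<in>V. \<Sum>j\<in>V. (C i j)\<^sup>2)"
  define d where "d = 1 + (\<Sum>i\<in>V. \<Sum>j\<in>V. (D i j)\<^sup>2)"
  have kd: "0 < k" "0 < d"
    by (simp_all add: k_def d_def add_pos_nonneg sum_nonneg)
  have below: "sqnorm V y \<le> d * k * quad V C y" for y
  proof -
    have "sqnorm V y = sqnorm V (mat_app V D (mat_app V C y))"
    proof -
      have "mat_app V D (mat_app V C y) i = mat_app V D (\<lambda>j. \<Lambda> * y j - mat_app V A y j) i" for i
        unfolding mat_app_def[of V D] by (intro sum.cong refl) (simp add: Capp)
      then show ?thesis unfolding sqnorm_def by (intro sum.cong refl arg_cong[where f = "\<lambda>z. z\<^sup>2"]) (simp only: D[symmetric])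
    qed
    also have "\<dots> \<le> (\<Sum>i\<in>V. \<Sum>j\<in>V. (D i j)\<^sup>2) * sqnorm V (mat_app V C y)"
      by (rule sqnorm_mat_app_bound[OF fin])
    also have "\<dots> \<le> d * sqnorm V (mat_app V C y)"
      by (intro mult_right_mono sqnorm_nonneg) (simp add: d_def)
    also have "\<dots> \<le> d * (k * quad V C y)"
    proof (intro mult_left_mono sqnorm_mat_app_le)
      show "0 \<le> quad V C z" for z using LS by (simp add: Cquad)
      show "quad V C z \<le> k * sqnorm V z" for z unfolding k_def by (rule quad_le_bound[OF fin])
    qed (use Csym kd in auto)
    finally show ?thesis by (simp add: mult.assoc)
  qed
  have "\<Lambda> - 1 / (d * k) \<in> S"
    unfolding S_def
  proof (intro CollectI allI)
    fix y
    have "sqnorm V y / (d * k) \<le> quad V C y"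
      using below[of y] kd by (simp add: pos_divide_le_eq mult_ac)
    then show "quad V A y \<le> (\<Lambda> - 1 / (d * k)) * sqnorm V y"
      by (simp add: Cquad left_diff_distrib)
  qed
  then have "\<Lambda> \<le> \<Lambda> - 1 / (d * k)" unfolding \<Lambda>_def by (rule cInf_lower[OF _ bdd])
  moreover have "0 < 1 / (d * k)" using kd by simp
  ultimately show False by linarith
qed

text \<open>The explicit inverse of \<open>l - B\<close>, in the form in which the Rayleigh principle uses it.\<close>

lemma scalar_resolvent_exists:
  fixes B :: "real mat"
  assumes B: "B \<in> carrier_mat n n" and l: "\<not> eigenvalue B l"
  shows "\<exists>D. \<forall>x. \<forall>i\<in>{..<n}. x i = mat_app {..<n} D (\<lambda>j. l * x j - mat_app {..<n} (\<lambda>i j. B $$ (i, j)) x j) i"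
proof -
  define C where "C = l \<cdot>\<^sub>m 1\<^sub>m n - B"
  have C: "C \<in> carrier_mat n n" using B unfolding C_def by (rule minus_carrier_mat)
  have "det C \<noteq> 0"
  proof
    assume "det C = 0"
    then obtain v where v: "v \<in> carrier_vec n" "v \<noteq> 0\<^sub>v n" "C *\<^sub>v v = 0\<^sub>v n"
      using det_0_iff_vec_prod_zero_field[OF C] by auto
    have "B *\<^sub>v v = l \<cdot>\<^sub>v v"
    proof -
      have "C *\<^sub>v v = l \<cdot>\<^sub>v v - B *\<^sub>v v"
      proof -
        have "(l \<cdot>\<^sub>m 1\<^sub>m n) *\<^sub>v v = l \<cdot>\<^sub>v v"
          using v by (intro eq_vecI) (auto simp: scalar_prod_def if_distrib[of "\<lambda>z. z * _"] if_distrib[of "\<lambda>z. _ * z"] cong: if_cong)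
        then show ?thesis
          unfolding C_def using B v by (subst minus_mult_distrib_mat_vec[of _ n n]) auto
      qed
      then have z: "l \<cdot>\<^sub>v v - B *\<^sub>v v = 0\<^sub>v n" using v by simp
      show ?thesis
      proof (rule eq_vecI)
        fix i assume "i < dim_vec (l \<cdot>\<^sub>v v)"
        then have i: "i < n" using v by simp
        have "vec_index (l \<cdot>\<^sub>v v - B *\<^sub>v v) i = 0" unfolding z using i by simp
        then show "vec_index (B *\<^sub>v v) i = vec_index (l \<cdot>\<^sub>v v) i" using B v i by simp
      qed (use B v in auto)
    qed
    then have "eigenvalue B l" using v B unfolding eigenvalue_def eigenvector_def by auto
    with l show False by simp
  qed
  then obtain D where D: "D \<in> carrier_mat n n" "D * C = 1\<^sub>m n"
    using det_non_zero_imp_unit[OF C] unfolding Units_def ring_mat_def by auto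
  show ?thesis
  proof (intro exI[of _ "\<lambda>i j. D $$ (i, j)"] allI ballI)
    fix x :: "nat \<Rightarrow> real" and i assume i: "i \<in> {..<n}"
    let ?v = "vec n x"
    have "D *\<^sub>v (C *\<^sub>v ?v) = ?v"
      using D C by (subst assoc_mult_mat_vec[symmetric, OF D(1) C]) auto
    then have "x i = vec_index (D *\<^sub>v (C *\<^sub>v ?v)) i" using i by simp
    also have "\<dots> = (\<Sum>j<n. D $$ (i, j) * vec_index (C *\<^sub>v ?v) j)"
      using D C i by (simp add: scalar_prod_def atLeast0LessThan)
    also have "\<dots> = mat_app {..<n} (\<lambda>i j. D $$ (i, j)) (\<lambda>j. l * x j - mat_app {..<n} (\<lambda>i j. B $$ (i, j)) x j) i"
      unfolding mat_app_def
    proof (intro sum.cong refl arg_cong[where f = "(*) _"])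
      fix j assume j: "j \<in> {..<n}"
      have "vec_index (C *\<^sub>v ?v) j = (\<Sum>m<n. C $$ (j, m) * x m)"
        using C j by (simp add: scalar_prod_def atLeast0LessThan)
      also have "\<dots> = (\<Sum>m<n. (if m = j then l * x j else 0) - B $$ (j, m) * x m)"
        using B j by (intro sum.cong refl) (auto simp: C_def left_diff_distrib)
      also have "\<dots> = l * x j - (\<Sum>m<n. B $$ (j, m) * x m)"
        using j by (simp add: sum_subtractf)
      finally show "vec_index (C *\<^sub>v ?v) j = l * x j - (\<Sum>m<n. B $$ (j, m) * x m)" .
    qed
    finally show "x i = mat_app {..<n} (\<lambda>i j. D $$ (i, j)) (\<lambda>j. l * x j - mat_app {..<n} (\<lambda>i j. B $$ (i, j)) x j) i" .
  qed
qed

lemma finite_eigenvalues: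
  fixes B :: "real mat"
  assumes "B \<in> carrier_mat n n"
  shows "finite {x. eigenvalue B x}"
proof -
  have "{x. eigenvalue B x} = {x. poly (char_poly B) x = 0}"
    using eigenvalue_root_char_poly[OF assms] by auto
  moreover have "char_poly B \<noteq> 0" using degree_monic_char_poly[OF assms] by auto
  ultimately show ?thesis using poly_roots_finite by simp
qed

lemma quad_le_eigenvalue_bound:
  fixes B :: "real mat"
  assumes B: "B \<in> carrier_mat n n" and sym: "\<And>i j. i < n \<Longrightarrow> j < n \<Longrightarrow> B $$ (i, j) = B $$ (j, i)"
    and c: "\<And>l. eigenvalue B l \<Longrightarrow> l \<le> c"
  shows "quad {..<n} (\<lambda>i j. B $$ (i, j)) x \<le> c * sqnorm {..<n} x"
proof -
  define A where "A = (\<lambda>i j. if i < n \<and> j < n then B $$ (i, j) else 0)"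
  have app: "mat_app {..<n} A y i = mat_app {..<n} (\<lambda>i j. B $$ (i, j)) y i" if "i < n" for y i
    unfolding mat_app_def using that by (intro sum.cong) (auto simp: A_def)
  have "quad {..<n} A x \<le> c * sqnorm {..<n} x"
  proof (rule rayleigh_le)
    show "A i j = A j i" for i j by (simp add: A_def sym)
    fix l assume l: "c < l"
    have "\<not> eigenvalue B l" using c[of l] l by auto
    from scalar_resolvent_exists[OF B this] obtain D where
      "\<forall>x. \<forall>i\<in>{..<n}. x i = mat_app {..<n} D (\<lambda>j. l * x j - mat_app {..<n} (\<lambda>i j. B $$ (i, j)) x j) i" ..
    then have D: "x i = mat_app {..<n} D (\<lambda>j. l * x j - mat_app {..<n} (\<lambda>i j. B $$ (i, j)) x j) i" if "i < n" for x i
      using that by blast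
    have "x i = mat_app {..<n} D (\<lambda>j. l * x j - mat_app {..<n} A x j) i" if "i < n" for x i
    proof -
      have "mat_app {..<n} D (\<lambda>j. l * x j - mat_app {..<n} A x j) i
          = mat_app {..<n} D (\<lambda>j. l * x j - mat_app {..<n} (\<lambda>i j. B $$ (i, j)) x j) i"
        unfolding mat_app_def[of _ D] by (intro sum.cong refl) (simp add: app)
      then show ?thesis by (simp only: D[OF that, symmetric])
    qed
    then show "\<exists>D. \<forall>x. \<forall>i\<in>{..<n}. x i = mat_app {..<n} D (\<lambda>j. l * x j - mat_app {..<n} A x j) i"
      by blast
  qed simp
  moreover have "quad {..<n} A x = quad {..<n} (\<lambda>i j. B $$ (i, j)) x"
    unfolding quad_conv by (intro sum.cong refl) (simp add: app)
  ultimately show ?thesis by simp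
qed

lemma lambda_min_max_quad:
  fixes B :: "real mat"
  assumes B: "B \<in> carrier_mat n n" and sym: "\<And>i j. i < n \<Longrightarrow> j < n \<Longrightarrow> B $$ (i, j) = B $$ (j, i)"
  shows "lambda_min B * sqnorm {..<n} x \<le> quad {..<n} (\<lambda>i j. B $$ (i, j)) x"
    and "quad {..<n} (\<lambda>i j. B $$ (i, j)) x \<le> lambda_max B * sqnorm {..<n} x"
proof -
  note fin = finite_eigenvalues[OF B]
  show "quad {..<n} (\<lambda>i j. B $$ (i, j)) x \<le> lambda_max B * sqnorm {..<n} x"
  proof (rule quad_le_eigenvalue_bound[OF B sym])
    show "l \<le> lambda_max B" if "eigenvalue B l" for l
      unfolding lambda_max_def by (rule Max_ge[OF fin]) (simp add: that)
  qed
  have "quad {..<n} (\<lambda>i j. (- B) $$ (i, j)) x \<le> - lambda_min B * sqnorm {..<n} x"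
  proof (rule quad_le_eigenvalue_bound)
    fix l assume "eigenvalue (- B) l"
    then obtain v where v: "v \<in> carrier_vec n" "v \<noteq> 0\<^sub>v n" "(- B) *\<^sub>v v = l \<cdot>\<^sub>v v"
      using B unfolding eigenvalue_def eigenvector_def by auto
    have "B *\<^sub>v v = (- l) \<cdot>\<^sub>v v"
    proof (rule eq_vecI)
      fix i assume "i < dim_vec ((- l) \<cdot>\<^sub>v v)"
      then have i: "i < n" using v by simp
      have "- (B *\<^sub>v v) = l \<cdot>\<^sub>v v" using v B by simp
      then have "vec_index (- (B *\<^sub>v v)) i = vec_index (l \<cdot>\<^sub>v v) i" by (rule arg_cong)
      then have "- vec_index (B *\<^sub>v v) i = l * vec_index v i" using B v(1) i by simp
      then show "vec_index (B *\<^sub>v v) i = vec_index ((- l) \<cdot>\<^sub>v v) i"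
        using B v(1) i by simp
    qed (use B v in auto)
    then have "eigenvalue B (- l)"
      using B v unfolding eigenvalue_def eigenvector_def by auto
    then have "lambda_min B \<le> - l"
      unfolding lambda_min_def by (intro Min_le[OF fin]) simp
    then show "l \<le> - lambda_min B" by simp
  qed (use B sym in auto)
  moreover have "quad {..<n} (\<lambda>i j. (- B) $$ (i, j)) x = - quad {..<n} (\<lambda>i j. B $$ (i, j)) x"
    using B by (simp add: quad_def sum_negf[symmetric])
  ultimately show "lambda_min B * sqnorm {..<n} x \<le> quad {..<n} (\<lambda>i j. B $$ (i, j)) x"
    by simp
qed

section \<open>Tree-like neighbourhoods as labelled trees\<close>

lemma tree_words_ConsD: "a # w \<in> tree_words k \<Longrightarrow> w \<in> tree_words k"
  by (auto simp: tree_words_def dest: distinct_adj_ConsD)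

lemma tree_words_Cons_iff: "a # w \<in> tree_words k \<longleftrightarrow> w \<in> tree_words k \<and> a < k \<and> (w = [] \<or> a \<noteq> hd w)"
  by (cases w) (auto simp: tree_words_def)

lemma pair_wf_digraph_regular_tree: "pair_wf_digraph (regular_tree k)"
  by unfold_locales (auto simp: regular_tree_def)

lemma short_words_in_ball:
  assumes "w \<in> tree_words k" "length w \<le> r"
  shows "w \<in> graph_ball (regular_tree k) r []"
proof -
  interpret T: pair_wf_digraph "regular_tree k" by (rule pair_wf_digraph_regular_tree)
  have "\<exists>p. T.awalk [] p w \<and> length p = length w"
    using assms(1)
  proof (induction w)
    case Nil
    then show ?case
      by (intro exI[of _ "[]"]) (unfold T.awalk_def, simp add: regular_tree_def)
  next
    case (Cons a w)
    have w: "w \<in> tree_words k" using tree_words_ConsD[OF Cons.prems] .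
    obtain p where p: "T.awalk [] p w" "length p = length w" using Cons.IH[OF w] by auto
    have "T.awalk w [(w, a # w)] (a # w)"
      unfolding T.awalk_def using Cons.prems w by (simp add: regular_tree_def)
    then have "T.awalk [] (p @ [(w, a # w)]) (a # w)" by (rule T.awalk_appendI[OF p(1)])
    then show ?case using p(2) by (intro exI[of _ "p @ [(w, a # w)]"]) simp
  qed
  then show ?thesis using assms(2) unfolding graph_ball_def by auto
qed

lemma out_degree_eq_card: "out_degree (with_proj H) x = card {y. (x, y) \<in> parcs H}"
proof -
  have "out_arcs (with_proj H) x = Pair x ` {y. (x, y) \<in> parcs H}" by (auto simp: out_arcs_def)
  then show ?thesis by (simp add: out_degree_def card_image inj_on_def)
qed

text \<open>A labelling of the ball around \<open>v\<close> by words in which a vertex of depth less than \<open>r\<close> has no unlabelled neighbours.\<close>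

definition tree_chart :: "nat \<Rightarrow> nat \<Rightarrow> 'a pair_pre_digraph \<Rightarrow> 'a \<Rightarrow> (nat list \<Rightarrow> 'a) \<Rightarrow> bool" where
  "tree_chart k r G v g \<longleftrightarrow> g [] = v \<and> inj_on g {w \<in> tree_words k. length w \<le> r} \<and>
     (\<forall>w\<in>tree_words k. length w \<le> r \<longrightarrow> g w \<in> pverts G) \<and>
     (\<forall>w\<in>tree_words k. length w < r \<longrightarrow> {y. (g w, y) \<in> parcs G} = g ` {w'. (w, w') \<in> parcs (regular_tree k)})"

text \<open>An isomorphism of the induced balls gives only that the neighbours of a word map to neighbours in the graph. Both sets have \<open>k\<close>
  elements, which excludes further neighbours of vertices of distance less than \<open>r\<close>.\<close>

lemma tree_like_chart:
  assumes G: "pair_graph G" and reg: "regular k G" and k: "1 \<le> k" and like: "tree_like k r G v"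
  obtains g where "tree_chart k r G v g"
proof -
  interpret G: pair_graph G by (rule G)
  interpret T: pair_wf_digraph "regular_tree k" by (rule pair_wf_digraph_regular_tree)
  define BG where "BG = graph_ball G r v"
  define BT where "BT = graph_ball (regular_tree k) r []"
  obtain f where f: "pre_digraph.digraph_isomorphism (with_proj G \<restriction> BG) f"
    "with_proj (regular_tree k) \<restriction> BT = app_iso f (with_proj G \<restriction> BG)" "iso_verts f v = []"
    using like unfolding tree_like_def rooted_iso_def BG_def BT_def by blast
  let ?f = "iso_verts f"
  have inj: "inj_on ?f BG"
    using f(1) by (simp add: pre_digraph.digraph_isomorphism_def)
  have img: "?f ` BG = BT"
    using arg_cong[OF f(2), of verts] by simp
  have arc: "\<exists>x y. (x, y) \<in> parcs G \<and> x \<in> BG \<and> y \<in> BG \<and> ?f x = w \<and> ?f y = w'"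
    if "(w, w') \<in> parcs (regular_tree k)" "w \<in> BT" "w' \<in> BT" for w w'
  proof -
    have "(w, w') \<in> arcs (with_proj (regular_tree k) \<restriction> BT)" using that by simp
    then obtain e where e: "e \<in> arcs (with_proj G \<restriction> BG)" "(w, w') = iso_arcs f e"
      unfolding f(2) by auto
    have t: "iso_tail f = fst" "iso_head f = snd"
      using arg_cong[OF f(2), of tail] arg_cong[OF f(2), of head]
      by (simp_all add: induce_subgraph_def)
    have "iso_verts f (tail (with_proj G \<restriction> BG) e) = iso_tail f (iso_arcs f e)"
      "iso_verts f (head (with_proj G \<restriction> BG) e) = iso_head f (iso_arcs f e)"
      using f(1) e(1) unfolding pre_digraph.digraph_isomorphism_def by blast+
    then have "?f (fst e) = w" "?f (snd e) = w'"
      unfolding t e(2)[symmetric] by (simp_all add: induce_subgraph_def)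
    moreover have "e \<in> parcs G" "fst e \<in> BG" "snd e \<in> BG" using e(1) by auto
    ultimately show ?thesis by (intro exI[of _ "fst e"] exI[of _ "snd e"]) simp
  qed
  define g where "g = inv_into BG ?f"
  define W where "W = {w \<in> tree_words k. length w \<le> r}"
  have W: "W \<subseteq> BT" using short_words_in_ball by (auto simp: W_def BT_def)
  have gB: "g w \<in> BG" "?f (g w) = w" if "w \<in> BT" for w
    using that img by (auto simp: g_def inv_into_into f_inv_into_f)
  have gf: "g (?f x) = x" if "x \<in> BG" for x
    using inj that by (simp add: g_def)
  have BGv: "BG \<subseteq> pverts G"
    unfolding BG_def graph_ball_def using G.awalk_last_in_verts by auto
  have vB: "v \<in> BG"
  proof -
    have "[] \<in> W" by (simp add: W_def tree_words_def)
    then have "g [] \<in> BG" using W gB by auto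
    then obtain p where "G.awalk v p (g [])" by (auto simp: BG_def graph_ball_def)
    then have "v \<in> pverts G" by (simp add: G.awalk_def)
    then have "G.awalk v [] v" by (simp add: G.awalk_def)
    then show ?thesis by (auto simp: BG_def graph_ball_def)
  qed
  have "tree_chart k r G v g"
    unfolding tree_chart_def
  proof (intro conjI ballI impI)
    show "g [] = v" using gf[OF vB] f(3) by simp
    show "inj_on g {w \<in> tree_words k. length w \<le> r}"
      unfolding W_def[symmetric]
    proof (rule inj_onI)
      fix x y assume "x \<in> W" "y \<in> W" "g x = g y"
      then show "x = y" using gB(2)[of x] gB(2)[of y] W by auto
    qed
    show "g w \<in> pverts G" if "w \<in> tree_words k" "length w \<le> r" for w
      using that W gB(1)[of w] BGv by (auto simp: W_def)
    fix w assume w: "w \<in> tree_words k" "length w < r"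
    let ?N = "{w'. (w, w') \<in> parcs (regular_tree k)}" and ?M = "{y. (g w, y) \<in> parcs G}"
    have wW: "w \<in> W" using w by (simp add: W_def)
    have NW: "?N \<subseteq> W" using w by (auto simp: W_def regular_tree_def)
    have sub: "g ` ?N \<subseteq> ?M"
    proof
      fix y assume "y \<in> g ` ?N"
      then obtain w' where w': "(w, w') \<in> parcs (regular_tree k)" "y = g w'" by auto
      then obtain x z where "(x, z) \<in> parcs G" "x \<in> BG" "z \<in> BG" "?f x = w" "?f z = w'"
        using arc[of w w'] wW NW W by auto
      then show "y \<in> ?M" using gf w'(2) by auto
    qed
    have "card ?M = k"
    proof -
      have "g w \<in> pverts G" using wW W gB(1)[of w] BGv by auto
      then show ?thesis using reg unfolding regular_def out_degree_eq_card by simp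
    qed
    moreover have "card (g ` ?N) = k"
    proof -
      have "inj_on g ?N"
      proof (rule inj_onI)
        fix x y assume "x \<in> ?N" "y \<in> ?N" "g x = g y"
        then show "x = y" using gB(2)[of x] gB(2)[of y] NW W by auto
      qed
      moreover have "card ?N = k"
        using regular_regular_tree[OF k] w(1) unfolding regular_def out_degree_eq_card by (simp add: regular_tree_def)
      ultimately show ?thesis by (simp add: card_image)
    qed
    moreover have "finite ?M"
      by (rule finite_subset[OF _ G.pair_finite_verts]) (use G.in_arcsD2 in auto)
    ultimately show "?M = g ` ?N" using card_subset_eq[OF _ sub] by simp
  qed
  then show ?thesis by (rule that)
qed

fun tedges :: "'v rtree \<Rightarrow> ('v \<times> 'v) list" where
  "tedges (Leaf x) = []"
| "tedges (Node x ts) = concat (map (\<lambda>t. (x, troot t) # tedges t) ts)"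

lemma energy_tedges: "energy t \<sigma> = (\<Sum>(x, y)\<leftarrow>tedges t. \<sigma> x * \<sigma> y)"
proof (induction t)
  case (Node x ts)
  then show ?case by (induction ts) auto
qed simp

lemma tverts_eq_troot_Cons: "tverts t = troot t # map snd (tedges t)"
proof (induction t)
  case (Node x ts)
  then show ?case by (induction ts) auto
qed simp

text \<open>The tree below the word \<open>w\<close>, cut off after \<open>n\<close> further levels.\<close>

fun tree_at :: "nat \<Rightarrow> (nat list \<Rightarrow> 'a) \<Rightarrow> nat \<Rightarrow> nat list \<Rightarrow> 'a rtree" where
  "tree_at k g 0 w = Leaf (g w)"
| "tree_at k g (Suc n) w = Node (g w) (map (\<lambda>a. tree_at k g n (a # w)) (filter (\<lambda>a. w = [] \<or> a \<noteq> hd w) [0..<k]))"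

lemma troot_tree_at [simp]: "troot (tree_at k g n w) = g w"
  by (cases n) auto

lemma distinct_concat_mapI:
  "distinct xs \<Longrightarrow> (\<And>x. x \<in> set xs \<Longrightarrow> distinct (f x)) \<Longrightarrow>
   (\<And>x y. x \<in> set xs \<Longrightarrow> y \<in> set xs \<Longrightarrow> x \<noteq> y \<Longrightarrow> set (f x) \<inter> set (f y) = {}) \<Longrightarrow> distinct (concat (map f xs))"
proof (induction xs)
  case (Cons x xs)
  have "set (f x) \<inter> set (concat (map f xs)) = {}"
  proof -
    have "set (f x) \<inter> set (f y) = {}" if "y \<in> set xs" for y
      by (rule Cons.prems(3)) (use that Cons.prems(1) in auto)
    then show ?thesis by auto
  qed
  then show ?case using Cons by auto
qed simp

definition cone :: "nat \<Rightarrow> nat \<Rightarrow> nat list \<Rightarrow> nat list set" where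
  "cone k r w = {x \<in> tree_words k. length x \<le> r \<and> (\<exists>u. x = u @ w)}"

lemma tverts_tree_at:
  assumes inj: "inj_on g {w \<in> tree_words k. length w \<le> r}"
  shows "w \<in> tree_words k \<Longrightarrow> length w + n \<le> r \<Longrightarrow>
    set (tverts (tree_at k g n w)) \<subseteq> g ` cone k r w \<and> distinct (tverts (tree_at k g n w))"
proof (induction n arbitrary: w)
  case 0
  then show ?case by (auto simp: cone_def)
next
  case (Suc n)
  let ?as = "filter (\<lambda>a. w = [] \<or> a \<noteq> hd w) [0..<k]"
  have as: "a # w \<in> tree_words k" if "a \<in> set ?as" for a
    using Suc.prems(1) that by (auto simp: tree_words_Cons_iff)
  have IH: "set (tverts (tree_at k g n (a # w))) \<subseteq> g ` cone k r (a # w)" "distinct (tverts (tree_at k g n (a # w)))"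
    if "a \<in> set ?as" for a
    using Suc.IH[OF as[OF that]] Suc.prems(2) by auto
  have cone_sub: "cone k r (a # w) \<subseteq> cone k r w" for a by (auto simp: cone_def)
  have coneW: "cone k r x \<subseteq> {w \<in> tree_words k. length w \<le> r}" for x by (auto simp: cone_def)
  have wc: "w \<in> cone k r w" using Suc.prems by (auto simp: cone_def)
  have sub: "set (tverts (tree_at k g (Suc n) w)) \<subseteq> g ` cone k r w"
  proof
    fix y assume "y \<in> set (tverts (tree_at k g (Suc n) w))"
    then consider "y = g w" | a where "a \<in> set ?as" "y \<in> set (tverts (tree_at k g n (a # w)))" by auto
    then show "y \<in> g ` cone k r w"
    proof cases
      case 2
      then have "y \<in> g ` cone k r (a # w)" using IH(1) by blast
      then show ?thesis using cone_sub[of a] by blast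
    qed (use wc in blast)
  qed
  have dis: "g ` cone k r (a # w) \<inter> g ` cone k r (a' # w) = {}" if "a \<noteq> a'" for a a'
  proof -
    have "cone k r (a # w) \<inter> cone k r (a' # w) = {}" using that by (auto simp: cone_def)
    then show ?thesis using inj_on_image_Int[OF inj coneW coneW, of "a # w" "a' # w"] by simp
  qed
  have root: "g w \<notin> g ` cone k r (a # w)" for a
  proof
    assume "g w \<in> g ` cone k r (a # w)"
    then obtain x where x: "x \<in> cone k r (a # w)" "g w = g x" by auto
    have "w = x" by (rule inj_onD[OF inj x(2)]) (use x(1) coneW wc in blast)+
    then show False using x(1) by (auto simp: cone_def)
  qed
  have "distinct (concat (map (\<lambda>a. tverts (tree_at k g n (a # w))) ?as))"
  proof (rule distinct_concat_mapI)
    fix a a' assume "a \<in> set ?as" "a' \<in> set ?as" "a \<noteq> a'"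
    then show "set (tverts (tree_at k g n (a # w))) \<inter> set (tverts (tree_at k g n (a' # w))) = {}"
      using IH(1)[of a] IH(1)[of a'] dis[of a a'] by blast
  qed (use IH(2) in auto)
  moreover have "g w \<notin> set (concat (map (\<lambda>a. tverts (tree_at k g n (a # w))) ?as))"
  proof
    assume "g w \<in> set (concat (map (\<lambda>a. tverts (tree_at k g n (a # w))) ?as))"
    then obtain a where "a \<in> set ?as" "g w \<in> set (tverts (tree_at k g n (a # w)))" by auto
    with IH(1) root show False by blast
  qed
  ultimately have "distinct (tverts (tree_at k g (Suc n) w))" by (simp add: comp_def)
  with sub show ?case by blast
qed

lemma inner_tree_at:
  "w \<in> tree_words k \<Longrightarrow> set (inner_verts (tree_at k g n w)) = g ` {u @ w |u. u @ w \<in> tree_words k \<and> length u < n}"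
proof (induction n arbitrary: w)
  case (Suc n)
  let ?as = "{a. a # w \<in> tree_words k}"
  have as: "set (filter (\<lambda>a. w = [] \<or> a \<noteq> hd w) [0..<k]) = ?as"
    using Suc.prems by (auto simp: tree_words_Cons_iff)
  have "{u @ w |u. u @ w \<in> tree_words k \<and> length u < Suc n}
      = insert w (\<Union>a\<in>?as. {u @ a # w |u. u @ a # w \<in> tree_words k \<and> length u < n})" (is "?L = ?R")
  proof (intro equalityI subsetI)
    fix x assume "x \<in> ?L"
    then obtain u where u: "x = u @ w" "u @ w \<in> tree_words k" "length u < Suc n" by auto
    show "x \<in> ?R"
    proof (cases u rule: rev_cases)
      case (snoc u' a)
      have "a # w \<in> tree_words k" if "u' @ a # w \<in> tree_words k" for u'
        using that by (induction u') (auto dest: tree_words_ConsD)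
      then show ?thesis using u snoc by auto
    qed (use u in simp)
  next
    fix x assume "x \<in> ?R"
    then consider "x = w" | a u where "x = (u @ [a]) @ w" "(u @ [a]) @ w \<in> tree_words k" "length (u @ [a]) < Suc n" by auto
    then show "x \<in> ?L"
    proof cases
      case 1
      then show ?thesis using Suc.prems by (intro CollectI exI[of _ "[]"]) simp
    qed blast
  qed
  moreover have "set (inner_verts (tree_at k g (Suc n) w)) = insert (g w) (\<Union>a\<in>?as. set (inner_verts (tree_at k g n (a # w))))"
    unfolding as[symmetric] by (simp add: comp_def)
  ultimately show ?case using Suc.IH by (simp add: image_UN)
qed simp

lemma tedges_tree_at:
  "w \<in> tree_words k \<Longrightarrow>
    set (tedges (tree_at k g n w)) = {(g (u @ w), g (a # u @ w)) |u a. a # u @ w \<in> tree_words k \<and> length u < n}"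
proof (induction n arbitrary: w)
  case (Suc n)
  let ?as = "{a. a # w \<in> tree_words k}"
  have as: "set (filter (\<lambda>a. w = [] \<or> a \<noteq> hd w) [0..<k]) = ?as"
    using Suc.prems by (auto simp: tree_words_Cons_iff)
  have "set (tedges (tree_at k g (Suc n) w)) = (\<Union>a\<in>?as. insert (g w, g (a # w)) (set (tedges (tree_at k g n (a # w)))))"
    unfolding as[symmetric] by (simp add: comp_def)
  also have "\<dots> = (\<Union>a\<in>?as. insert (g w, g (a # w)) {(g (u @ a # w), g (c # u @ a # w)) |u c. c # u @ a # w \<in> tree_words k \<and> length u < n})"
    using Suc.IH by auto
  also have "\<dots> = {(g (u @ w), g (a # u @ w)) |u a. a # u @ w \<in> tree_words k \<and> length u < Suc n}" (is "?L = ?R")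
  proof (intro equalityI subsetI)
    fix e assume "e \<in> ?L"
    then consider a where "a # w \<in> tree_words k" "e = (g w, g (a # w))"
      | a u c where "e = (g ((u @ [a]) @ w), g (c # (u @ [a]) @ w))" "c # (u @ [a]) @ w \<in> tree_words k" "length (u @ [a]) < Suc n"
      by auto
    then show "e \<in> ?R"
    proof cases
      case 1
      then show ?thesis by (intro CollectI exI[of _ "[]"] exI[of _ a]) simp
    qed blast
  next
    fix e assume "e \<in> ?R"
    then obtain u c where u: "e = (g (u @ w), g (c # u @ w))" "c # u @ w \<in> tree_words k" "length u < Suc n" by auto
    show "e \<in> ?L"
    proof (cases u rule: rev_cases)
      case (snoc u' a)
      have "a # w \<in> tree_words k" if "u'' @ a # w \<in> tree_words k" for u''
        using that by (induction u'') (auto dest: tree_words_ConsD)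
      from this[of "c # u'"] show ?thesis using u snoc by auto
    qed (use u in auto)
  qed
  finally show ?case .
qed simp

lemma influence_sq_tree_at:
  assumes "w \<in> tree_words k" "w \<noteq> []"
  shows "influence_sq b (tree_at k g n w) \<le> 4 * b\<^sup>2 * (real (k - 1) * (tanh b)\<^sup>2) ^ n"
  using assms
proof (induction n arbitrary: w)
  case (Suc n)
  let ?as = "filter (\<lambda>a. w = [] \<or> a \<noteq> hd w) [0..<k]"
  have hd: "hd w < k" using Suc.prems by (cases w) (auto simp: tree_words_def)
  have "length ?as = card ({0..<k} - {hd w})"
  proof -
    have "length ?as = card (set ?as)" by (intro distinct_card[symmetric]) simp
    also have "set ?as = {0..<k} - {hd w}" using Suc.prems(2) by auto
    finally show ?thesis .
  qed
  then have len: "length ?as = k - 1" using hd by simp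
  let ?M = "4 * b\<^sup>2 * (real (k - 1) * (tanh b)\<^sup>2) ^ n"
  have "(\<Sum>t\<leftarrow>map (\<lambda>a. tree_at k g n (a # w)) ?as. influence_sq b t) \<le> (\<Sum>a\<leftarrow>?as. ?M)"
    unfolding map_map comp_def
    by (rule sum_list_mono) (use Suc.IH Suc.prems(1) in \<open>auto simp: tree_words_Cons_iff\<close>)
  also have "\<dots> = real (k - 1) * ?M"
    by (simp only: sum_list_triv len of_nat_id)
  finally have "influence_sq b (tree_at k g (Suc n) w) \<le> (tanh b)\<^sup>2 * (real (k - 1) * ?M)"
    unfolding tree_at.simps influence_sq.simps by (intro mult_left_mono) auto
  then show ?case by (simp only: power_Suc mult_ac)
qed simp

section \<open>Comparison with the projected model\<close>

definition adj :: "('v \<times> 'v) set \<Rightarrow> 'v \<Rightarrow> 'v \<Rightarrow> real" where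
  "adj E i j = (if (i, j) \<in> E then 1 else 0)"

lemma adj_symmetric:
  assumes "pair_graph G"
  shows "adj (parcs G) x y = adj (parcs G) y x"
proof -
  interpret G: pair_graph G by (rule assms)
  show ?thesis using G.pair_sym_arcs by (auto simp: adj_def symmetric_def elim: symE)
qed

lemma sum_adj_regular:
  assumes "pair_graph G" "regular k G" "x \<in> pverts G"
  shows "(\<Sum>y\<in>pverts G. adj (parcs G) x y) = real k"
proof -
  interpret G: pair_graph G by (rule assms)
  have "(\<Sum>y\<in>pverts G. adj (parcs G) x y) = real (card (pverts G \<inter> {y. (x, y) \<in> parcs G}))"
    using G.pair_finite_verts by (simp add: adj_def sum.If_cases)
  also have "pverts G \<inter> {y. (x, y) \<in> parcs G} = {y. (x, y) \<in> parcs G}"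
    using G.in_arcsD2 by auto
  finally show ?thesis
    using assms(2,3) by (simp add: regular_def out_degree_eq_card)
qed

definition edge_energy :: "'v set \<Rightarrow> ('v \<times> 'v) set \<Rightarrow> ('v \<Rightarrow> real) \<Rightarrow> real" where
  "edge_energy V E \<sigma> = 1/2 * quad V (adj E) \<sigma>"

lemma quad_adj:
  assumes "finite V" "E \<subseteq> V \<times> V"
  shows "quad V (adj E) \<sigma> = (\<Sum>(x, y)\<in>E. \<sigma> x * \<sigma> y)"
proof -
  have "quad V (adj E) \<sigma> = (\<Sum>p\<in>V \<times> V. if p \<in> E then \<sigma> (fst p) * \<sigma> (snd p) else 0)"
    unfolding quad_def adj_def sum.cartesian_product by (intro sum.cong refl) auto
  also have "\<dots> = (\<Sum>p\<in>V \<times> V \<inter> E. \<sigma> (fst p) * \<sigma> (snd p))"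
    using assms by (simp add: sum.inter_restrict)
  also have "V \<times> V \<inter> E = E" using assms by auto
  finally show ?thesis by (simp add: case_prod_unfold)
qed

definition adj_perp :: "'v set \<Rightarrow> ('v \<times> 'v) set \<Rightarrow> nat \<Rightarrow> 'v \<Rightarrow> 'v \<Rightarrow> real" where
  "adj_perp V E k i j = adj E i j - real k / real (card V)"

lemma quad_scale: "quad V (\<lambda>i j. b * A i j) x = b * quad V A x"
  by (simp add: quad_def sum_distrib_left mult_ac)

lemma quad_adj_perp:
  "quad V (adj_perp V E k) x = quad V (adj E) x - real k / real (card V) * (\<Sum>i\<in>V. x i)\<^sup>2"
proof -
  have "(\<Sum>i\<in>V. x i)\<^sup>2 = (\<Sum>i\<in>V. \<Sum>j\<in>V. x i * x j)"
    by (simp add: power2_eq_square sum_product)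
  then show ?thesis
    by (simp add: quad_def adj_perp_def left_diff_distrib right_diff_distrib sum_subtractf sum_distrib_left mult_ac)
qed

definition perp_weight :: "'v set \<Rightarrow> ('v \<times> 'v) set \<Rightarrow> nat \<Rightarrow> real \<Rightarrow> ('v \<Rightarrow> real) \<Rightarrow> real" where
  "perp_weight V E k b \<sigma> = exp (1/2 * quad V (\<lambda>i j. b * adj_perp V E k i j) \<sigma>)"

lemma perp_weight_eq:
  "perp_weight V E k b \<sigma> = exp (b * edge_energy V E \<sigma> - b * real k / (2 * real (card V)) * (\<Sum>i\<in>V. \<sigma> i)\<^sup>2)"
  unfolding perp_weight_def edge_energy_def quad_scale quad_adj_perp by (simp add: algebra_simps)

text \<open>The global spin flip preserves the weight and changes the sign of the function.\<close>

lemma odd_mean_zero: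
  fixes W f :: "('v \<Rightarrow> real) \<Rightarrow> real"
  assumes "depends_on V W" "depends_on V f" "\<And>\<sigma>. W (\<lambda>i. - \<sigma> i) = W \<sigma>" "\<And>\<sigma>. f (\<lambda>i. - \<sigma> i) = - f \<sigma>"
  shows "(\<Sum>\<sigma>\<in>spin_cfgs V. W \<sigma> * f \<sigma>) = 0"
proof -
  let ?n = "\<lambda>\<sigma>. \<lambda>i\<in>V. - \<sigma> i"
  have in_cfgs: "?n \<sigma> \<in> spin_cfgs V" if "\<sigma> \<in> spin_cfgs V" for \<sigma>
    using that by (auto simp: spin_cfgs_def PiE_def Pi_def)
  have nn: "?n (?n \<sigma>) = \<sigma>" if "\<sigma> \<in> spin_cfgs V" for \<sigma>
    using that by (auto simp: spin_cfgs_def PiE_def extensional_def fun_eq_iff)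
  have W: "W (?n \<sigma>) = W \<sigma>" for \<sigma>
  proof -
    have "W (?n \<sigma>) = W (\<lambda>i. - \<sigma> i)" by (rule depends_onD[OF assms(1)]) simp
    then show ?thesis by (simp only: assms(3))
  qed
  have f: "f (?n \<sigma>) = - f \<sigma>" for \<sigma>
  proof -
    have "f (?n \<sigma>) = f (\<lambda>i. - \<sigma> i)" by (rule depends_onD[OF assms(2)]) simp
    then show ?thesis by (simp only: assms(4))
  qed
  have "(\<Sum>\<sigma>\<in>spin_cfgs V. W \<sigma> * f \<sigma>) = (\<Sum>\<sigma>\<in>spin_cfgs V. W (?n \<sigma>) * f (?n \<sigma>))"
    by (rule sum.reindex_bij_witness[of _ ?n ?n]) (simp_all only: nn in_cfgs)
  also have "\<dots> = - (\<Sum>\<sigma>\<in>spin_cfgs V. W \<sigma> * f \<sigma>)"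
    by (simp only: W f mult_minus_right sum_negf)
  finally show ?thesis by simp
qed

lemma depends_on_quad: "depends_on V (quad V A)"
  unfolding depends_on_def by (intro allI impI quad_cong) blast

lemma quad_uminus: "quad V A (\<lambda>i. - x i) = quad V A x"
  by (simp add: quad_def)

text \<open>In terms of quadratic forms, the projected matrix scaled by \<open>b\<close> has spectral width at most \<open>\<delta>\<close>. Below, \<open>W\<close> and
  \<open>w\<close> are the Gibbs weights of the projected and of the original model.\<close>

locale perp_bounded =
  fixes V :: "'v set" and E :: "('v \<times> 'v) set" and k :: nat and b \<alpha> \<delta> :: real
  assumes fin: "finite V" and nonempty: "V \<noteq> {}" and sym: "(x, y) \<in> E \<Longrightarrow> (y, x) \<in> E"
    and b: "b \<le> 0" and delta: "0 \<le> \<delta>" "\<delta> < 1"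
    and lower: "\<alpha> * sqnorm V z \<le> b * quad V (adj_perp V E k) z"
    and upper: "b * quad V (adj_perp V E k) z \<le> (\<alpha> + \<delta>) * sqnorm V z"
begin

abbreviation "W \<equiv> perp_weight V E k b"

abbreviation "w \<sigma> \<equiv> exp (b * edge_energy V E \<sigma>)"

lemma perp_variance:
  assumes "\<And>\<sigma> i. \<sigma> \<in> spin_cfgs V \<Longrightarrow> i \<in> V \<Longrightarrow> \<bar>f (\<sigma>(i := - \<sigma> i)) - f \<sigma>\<bar> \<le> c i"
    and "depends_on V f" "\<And>\<sigma>. f (\<lambda>i. - \<sigma> i) = - f \<sigma>"
  shows "(\<Sum>\<sigma>\<in>spin_cfgs V. W \<sigma> * (f \<sigma>)\<^sup>2) \<le> 2 * sqnorm V c / (1 - \<delta>) * (\<Sum>\<sigma>\<in>spin_cfgs V. W \<sigma>)"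
  unfolding perp_weight_def
proof (rule ising_variance_bound[OF fin _ delta])
  show "b * adj_perp V E k i j = b * adj_perp V E k j i" for i j
    using sym by (auto simp: adj_perp_def adj_def)
  show "\<alpha> * sqnorm V x \<le> quad V (\<lambda>i j. b * adj_perp V E k i j) x"
    "quad V (\<lambda>i j. b * adj_perp V E k i j) x \<le> (\<alpha> + \<delta>) * sqnorm V x" for x
    using lower upper by (simp_all only: quad_scale)
  show "(\<Sum>\<sigma>\<in>spin_cfgs V. exp (1/2 * quad V (\<lambda>i j. b * adj_perp V E k i j) \<sigma>) * f \<sigma>) = 0"
  proof (rule odd_mean_zero[OF _ assms(2) _ assms(3)])
    show "depends_on V (\<lambda>\<sigma>. exp (1/2 * quad V (\<lambda>i j. b * adj_perp V E k i j) \<sigma>))"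
      unfolding depends_on_def
      by (intro allI impI arg_cong[where f = "\<lambda>z. exp (1/2 * z)"] depends_onD[OF depends_on_quad]) blast
  qed (simp only: quad_uminus)
qed (fact assms(1))

lemma card_pos: "0 < real (card V)"
  using fin nonempty by (simp add: card_gt_0_iff)

lemma weight_le_perp: "w \<sigma> \<le> W \<sigma>"
proof -
  have "0 \<le> - b * real k / (2 * real (card V)) * (\<Sum>i\<in>V. \<sigma> i)\<^sup>2"
    using b card_pos by (intro mult_nonneg_nonneg divide_nonneg_pos) auto
  then show ?thesis unfolding perp_weight_eq by simp
qed

text \<open>The bounded factor between the partition functions of the two models; it does not depend on the size of the graph.\<close>

definition "defect = exp (- 4 * b * real k / (1 - \<delta>))"

text \<open>The magnetisation has variance \<open>O(N)\<close> under the projected model, so by Jensen's inequality the rank-one term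
  changes the partition function by a bounded factor only.\<close>

lemma perp_le_weight:
  "(\<Sum>\<sigma>\<in>spin_cfgs V. W \<sigma>) \<le> defect * (\<Sum>\<sigma>\<in>spin_cfgs V. w \<sigma>)"
proof -
  define c where "c = - b * real k / (2 * real (card V))"
  define y where "y = - 4 * b * real k / (1 - \<delta>)"
  have "b * real k \<le> 0" using b by (simp add: mult_nonpos_nonneg)
  then have c: "0 \<le> c" unfolding c_def using card_pos by (intro divide_nonneg_pos) auto
  define M where "M = (\<lambda>\<sigma> :: 'v \<Rightarrow> real. \<Sum>i\<in>V. \<sigma> i)"
  define Z where "Z = (\<Sum>\<sigma>\<in>spin_cfgs V. W \<sigma>)"
  have var: "(\<Sum>\<sigma>\<in>spin_cfgs V. W \<sigma> * (M \<sigma>)\<^sup>2) \<le> 2 * sqnorm V (\<lambda>_. 2) / (1 - \<delta>) * Z"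
    unfolding Z_def
  proof (rule perp_variance)
    fix \<sigma> i assume \<sigma>: "\<sigma> \<in> spin_cfgs V" and i: "i \<in> V"
    have "M (\<sigma>(i := - \<sigma> i)) = (\<Sum>j\<in>V. \<sigma> j + (if j = i then - 2 * \<sigma> i else 0))"
      unfolding M_def by (intro sum.cong) auto
    also have "\<dots> = M \<sigma> - 2 * \<sigma> i" using fin i by (simp add: M_def sum.distrib)
    finally show "\<bar>M (\<sigma>(i := - \<sigma> i)) - M \<sigma>\<bar> \<le> 2" using spin_cfgs_D[OF \<sigma> i] by auto
  next
    show "depends_on V M" unfolding depends_on_def M_def by (intro allI impI sum.cong refl) blast
    show "M (\<lambda>i. - \<sigma> i) = - M \<sigma>" for \<sigma> by (simp add: M_def sum_negf)
  qed
  have "c * (\<Sum>\<sigma>\<in>spin_cfgs V. W \<sigma> * (M \<sigma>)\<^sup>2) \<le> c * (2 * sqnorm V (\<lambda>_. 2) / (1 - \<delta>) * Z)"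
    by (rule mult_left_mono[OF var c])
  also have "\<dots> = y * Z"
    using card_pos by (simp add: c_def y_def sqnorm_def)
  finally have cM: "c * (\<Sum>\<sigma>\<in>spin_cfgs V. W \<sigma> * (M \<sigma>)\<^sup>2) \<le> y * Z" .
  have "Z \<le> (\<Sum>\<sigma>\<in>spin_cfgs V. W \<sigma> * (1 + y - c * (M \<sigma>)\<^sup>2))"
  proof -
    have "(\<Sum>\<sigma>\<in>spin_cfgs V. W \<sigma> * (1 + y - c * (M \<sigma>)\<^sup>2)) = Z + y * Z - c * (\<Sum>\<sigma>\<in>spin_cfgs V. W \<sigma> * (M \<sigma>)\<^sup>2)"
      by (simp add: Z_def algebra_simps sum.distrib sum_subtractf sum_distrib_left)
    then show ?thesis using cM by simp
  qed
  also have "\<dots> \<le> (\<Sum>\<sigma>\<in>spin_cfgs V. exp y * w \<sigma>)"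
  proof (rule sum_mono)
    fix \<sigma>
    have "1 + y - c * (M \<sigma>)\<^sup>2 \<le> exp (y - c * (M \<sigma>)\<^sup>2)"
      using exp_ge_add_one_self[of "y - c * (M \<sigma>)\<^sup>2"] by linarith
    then have "W \<sigma> * (1 + y - c * (M \<sigma>)\<^sup>2) \<le> W \<sigma> * exp (y - c * (M \<sigma>)\<^sup>2)"
      by (rule mult_left_mono) (simp add: perp_weight_def)
    also have "\<dots> = exp y * w \<sigma>"
      unfolding perp_weight_eq c_def M_def by (simp flip: exp_add)
    finally show "W \<sigma> * (1 + y - c * (M \<sigma>)\<^sup>2) \<le> exp y * w \<sigma>" .
  qed
  finally show ?thesis by (simp add: Z_def y_def defect_def sum_distrib_left)
qed

text \<open>The original weights are at most the projected ones, and their partition function is smaller by at most the factor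
  \<open>defect\<close>.\<close>

lemma variance_le:
  assumes "\<And>\<sigma> i. \<sigma> \<in> spin_cfgs V \<Longrightarrow> i \<in> V \<Longrightarrow> \<bar>f (\<sigma>(i := - \<sigma> i)) - f \<sigma>\<bar> \<le> c i"
    and "depends_on V f" "\<And>\<sigma>. f (\<lambda>i. - \<sigma> i) = - f \<sigma>"
  shows "(\<Sum>\<sigma>\<in>spin_cfgs V. w \<sigma> * (f \<sigma>)\<^sup>2) \<le> 2 * sqnorm V c / (1 - \<delta>) * defect * (\<Sum>\<sigma>\<in>spin_cfgs V. w \<sigma>)"
proof -
  have "(\<Sum>\<sigma>\<in>spin_cfgs V. w \<sigma> * (f \<sigma>)\<^sup>2) \<le> (\<Sum>\<sigma>\<in>spin_cfgs V. W \<sigma> * (f \<sigma>)\<^sup>2)"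
    by (intro sum_mono mult_right_mono weight_le_perp) simp
  also have "\<dots> \<le> 2 * sqnorm V c / (1 - \<delta>) * (\<Sum>\<sigma>\<in>spin_cfgs V. W \<sigma>)"
    by (rule perp_variance[OF assms])
  also have "\<dots> \<le> 2 * sqnorm V c / (1 - \<delta>) * (defect * (\<Sum>\<sigma>\<in>spin_cfgs V. w \<sigma>))"
    using delta sqnorm_nonneg[of V c] by (intro mult_left_mono perp_le_weight divide_nonneg_pos) auto
  finally show ?thesis by (simp add: mult.assoc)
qed

lemma cavity_sum_second_moment:
  assumes d: "distinct (concat (map tverts ts))" and sub: "set (concat (map leaves ts)) \<subseteq> V"
  shows "(\<Sum>\<sigma>\<in>spin_cfgs V. w \<sigma> * (\<Sum>t\<leftarrow>ts. cavity_field b t \<sigma>)\<^sup>2)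
    \<le> 2 * (\<Sum>t\<leftarrow>ts. influence_sq b t) / (1 - \<delta>) * defect * (\<Sum>\<sigma>\<in>spin_cfgs V. w \<sigma>)"
proof -
  define f where "f = (\<lambda>\<sigma>. \<Sum>t\<leftarrow>ts. cavity_field b t \<sigma>)"
  define c where "c = (\<lambda>x. \<Sum>t\<leftarrow>ts. influence b t x)"
  have "(\<Sum>\<sigma>\<in>spin_cfgs V. w \<sigma> * (f \<sigma>)\<^sup>2) \<le> 2 * sqnorm V c / (1 - \<delta>) * defect * (\<Sum>\<sigma>\<in>spin_cfgs V. w \<sigma>)"
  proof (rule variance_le)
    fix \<sigma> i assume "\<sigma> \<in> spin_cfgs V" "i \<in> V"
    then show "\<bar>f (\<sigma>(i := - \<sigma> i)) - f \<sigma>\<bar> \<le> c i"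
      unfolding f_def c_def by (intro abs_sum_list_diff_le cavity_field_flip spin_cfgs_D)
  next
    show "depends_on V f"
      unfolding depends_on_def f_def
      by (intro allI impI sum_list_cong_depends depends_onD[OF depends_on_cavity_field]) (use sub in auto)
    show "f (\<lambda>i. - \<sigma> i) = - f \<sigma>" for \<sigma>
      unfolding f_def cavity_field_uminus by (induction ts) auto
  qed
  also have "\<dots> \<le> 2 * (\<Sum>t\<leftarrow>ts. influence_sq b t) / (1 - \<delta>) * defect * (\<Sum>\<sigma>\<in>spin_cfgs V. w \<sigma>)"
  proof -
    have "sqnorm V c \<le> (\<Sum>t\<leftarrow>ts. influence_sq b t)"
      unfolding c_def
      by (intro sqnorm_sum_list_influence d sqnorm_influence[OF fin] distinct_concat_mapD[OF d])
    then have "2 * sqnorm V c / (1 - \<delta>) \<le> 2 * (\<Sum>t\<leftarrow>ts. influence_sq b t) / (1 - \<delta>)"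
      using delta by (intro divide_right_mono) auto
    moreover have "0 \<le> defect * (\<Sum>\<sigma>\<in>spin_cfgs V. w \<sigma>)"
      by (auto simp: defect_def intro!: mult_nonneg_nonneg sum_nonneg)
    ultimately show ?thesis unfolding mult.assoc[of _ defect] by (rule mult_right_mono)
  qed
  finally show ?thesis unfolding f_def .
qed

end

section \<open>Edge correlations at tree-like vertices\<close>

lemma concat_leaves_subset: "set (concat (map leaves ts)) \<subseteq> set (concat (map tverts ts))"
  by (induction ts) (auto dest: subsetD[OF leaves_subset_tverts])

text \<open>The edge from the centre to its neighbour \<open>g [c]\<close> separates the ball into two trees. The chart shows that their edges,
  together with this edge, are all the edges of the graph at inner vertices, so the rest of the energy does not depend
  on the inner spins.\<close>

lemma tree_chart_split:
  fixes G :: "'a pair_pre_digraph"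
  assumes G: "pair_graph G" and chart: "tree_chart k (Suc n) G v g" and n: "n = Suc m" and c: "c < k"
  defines "ts \<equiv> map (\<lambda>a. tree_at k g n [a]) (filter (\<lambda>a. a \<noteq> c) [0..<k])"
    and "us \<equiv> map (\<lambda>a. tree_at k g m [a, c]) (filter (\<lambda>a. a \<noteq> c) [0..<k])"
  shows "distinct (tverts (Node v ts) @ tverts (Node (g [c]) us))"
    and "set (tverts (Node v ts)) \<union> set (tverts (Node (g [c]) us)) \<subseteq> pverts G"
    and "\<exists>R D. (\<forall>\<sigma>. edge_energy (pverts G) (parcs G) \<sigma>
          = \<sigma> v * \<sigma> (g [c]) + energy (Node v ts) \<sigma> + energy (Node (g [c]) us) \<sigma> + R \<sigma>) \<and>
        depends_on D R \<and> D \<inter> (set (inner_verts (Node v ts)) \<union> set (inner_verts (Node (g [c]) us))) = {}"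
proof -
  interpret G: pair_graph G by (rule G)
  define r where "r = Suc n"
  let ?W = "{w \<in> tree_words k. length w \<le> r}"
  have g0: "g [] = v" and inj: "inj_on g ?W" and gV: "\<And>w. w \<in> ?W \<Longrightarrow> g w \<in> pverts G"
    and nb: "\<And>w. w \<in> tree_words k \<Longrightarrow> length w < r \<Longrightarrow> {y. (g w, y) \<in> parcs G} = g ` {w'. (w, w') \<in> parcs (regular_tree k)}"
    using chart by (auto simp: tree_chart_def r_def)
  define T where "T = tree_at k g (Suc n) []"
  define t2 where "t2 = Node (g [c]) us"
  define t1 where "t1 = Node v ts"
  have nil: "[] \<in> tree_words k" by (simp add: tree_words_def)
  have t2: "t2 = tree_at k g n [c]" by (simp add: t2_def us_def n)
  have T: "T = Node v (map (\<lambda>a. tree_at k g n [a]) [0..<k])" by (simp add: T_def g0)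
  have tvT: "set (tverts T) \<subseteq> g ` cone k r []" "distinct (tverts T)"
    using tverts_tree_at[OF inj nil, of "Suc n"] by (simp_all add: T_def r_def)
  obtain xs ys where xy: "[0..<k] = xs @ c # ys"
    using split_list[of c "[0..<k]"] c by auto
  have "distinct (xs @ c # ys)" unfolding xy[symmetric] by simp
  then have "filter (\<lambda>a. a \<noteq> c) xs = xs" "filter (\<lambda>a. a \<noteq> c) ys = ys"
    by (auto intro!: filter_True)
  then have filt: "filter (\<lambda>a. a \<noteq> c) [0..<k] = xs @ ys"
    unfolding xy by simp
  have ts: "ts = map (\<lambda>a. tree_at k g n [a]) xs @ map (\<lambda>a. tree_at k g n [a]) ys"
    by (simp add: ts_def filt)
  have T': "T = Node v (map (\<lambda>a. tree_at k g n [a]) xs @ t2 # map (\<lambda>a. tree_at k g n [a]) ys)"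
    unfolding T xy t2 by simp
  show dist: "distinct (tverts (Node v ts) @ tverts (Node (g [c]) us))"
    using tvT(2) unfolding T' t2_def[symmetric] ts by auto
  have setv: "set (tverts T) = set (tverts t1) \<union> set (tverts t2)"
    unfolding T' t1_def ts by auto
  have seti: "set (inner_verts T) = set (inner_verts t1) \<union> set (inner_verts t2)"
    unfolding T' t1_def ts by auto
  have sete: "set (tedges T) = insert (v, g [c]) (set (tedges t1) \<union> set (tedges t2))"
    unfolding T' t1_def ts t2 by auto
  show "set (tverts (Node v ts)) \<union> set (tverts (Node (g [c]) us)) \<subseteq> pverts G"
    unfolding t1_def[symmetric] t2_def[symmetric] setv[symmetric]
    using tvT(1) gV by (fastforce simp: cone_def)
  define F where "F = set (tedges T)"
  have F: "F = {(g w, g (a # w)) |w a. a # w \<in> tree_words k \<and> length w < r}"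
    unfolding F_def T_def tedges_tree_at[OF nil] by (simp add: r_def)
  have I: "set (inner_verts T) = g ` {w \<in> tree_words k. length w < r}"
    unfolding T_def inner_tree_at[OF nil] by (simp add: r_def)
  have Farc: "F \<subseteq> parcs G"
  proof
    fix e assume "e \<in> F"
    then obtain w a where w: "e = (g w, g (a # w))" "a # w \<in> tree_words k" "length w < r" by (auto simp: F)
    have "w \<in> tree_words k" using tree_words_ConsD[OF w(2)] .
    moreover from this have "(w, a # w) \<in> parcs (regular_tree k)" using w by (simp add: regular_tree_def)
    ultimately have "g (a # w) \<in> {y. (g w, y) \<in> parcs G}" using nb w(3) by blast
    then show "e \<in> parcs G" using w(1) by simp
  qed
  have symG: "(y, x) \<in> parcs G" if "(x, y) \<in> parcs G" for x y
    using G.pair_sym_arcs that by (auto simp: symmetric_def elim: symE)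
  have disj: "F \<inter> F\<inverse> = {}"
  proof (rule ccontr)
    assume "F \<inter> F\<inverse> \<noteq> {}"
    then obtain w a w' a' where w: "a # w \<in> tree_words k" "length w < r" "a' # w' \<in> tree_words k" "length w' < r"
      and eq: "g w = g (a' # w')" "g (a # w) = g w'"
      by (auto simp: F)
    have "w = a' # w'" by (rule inj_onD[OF inj eq(1)]) (use w tree_words_ConsD in auto)
    moreover have "a # w = w'" by (rule inj_onD[OF inj eq(2)]) (use w tree_words_ConsD in auto)
    ultimately have "length w = Suc (Suc (length w))" by (metis length_Cons)
    then show False by simp
  qed
  have touch: "(x, y) \<in> F \<union> F\<inverse>" if arc: "(x, y) \<in> parcs G" and xin: "x \<in> set (inner_verts T)" for x y
  proof -
    obtain w where w: "x = g w" "w \<in> tree_words k" "length w < r" using xin by (auto simp: I)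
    then have "y \<in> g ` {w'. (w, w') \<in> parcs (regular_tree k)}" using nb[of w] arc by blast
    then obtain w' where w': "y = g w'" "w' \<in> tree_words k" "\<exists>a. w' = a # w \<or> w = a # w'"
      by (auto simp: regular_tree_def)
    then obtain a where "w' = a # w \<or> w = a # w'" by blast
    then show ?thesis
    proof
      assume "w' = a # w"
      then have "(x, y) \<in> F" using w w' unfolding F by blast
      then show ?thesis by simp
    next
      assume a: "w = a # w'"
      then have "length w' < r" using w by simp
      then have "(y, x) \<in> F" using a w w' unfolding F by blast
      then show ?thesis by simp
    qed
  qed
  \<comment> \<open>By \<open>touch\<close>, the remaining arcs avoid the inner vertices altogether.\<close>
  define H where "H = parcs G - (F \<union> F\<inverse>)"
  define R where "R = (\<lambda>\<sigma> :: 'a \<Rightarrow> real. 1/2 * (\<Sum>(x, y)\<in>H. \<sigma> x * \<sigma> y))"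
  define D where "D = - set (inner_verts T)"
  have depR: "depends_on D R"
  proof -
    have "x \<in> D \<and> y \<in> D" if "(x, y) \<in> H" for x y
      using that touch[of x y] touch[of y x] symG[of x y] by (auto simp: H_def D_def)
    then have inD: "fst p \<in> D" "snd p \<in> D" if "p \<in> H" for p
      using that by (cases p; force)+
    show ?thesis
      unfolding depends_on_def R_def
    proof (intro allI impI arg_cong[where f = "\<lambda>z. 1/2 * z"] sum.cong refl)
      fix \<sigma> \<tau> :: "'a \<Rightarrow> real" and p assume "\<forall>x\<in>D. \<sigma> x = \<tau> x" "p \<in> H"
      then have "\<sigma> (fst p) = \<tau> (fst p)" "\<sigma> (snd p) = \<tau> (snd p)" using inD by simp_all
      then show "(case p of (x, y) \<Rightarrow> \<sigma> x * \<sigma> y) = (case p of (x, y) \<Rightarrow> \<tau> x * \<tau> y)"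
        by (simp add: case_prod_unfold)
    qed
  qed
  have finE: "finite (parcs G)" by (rule G.pair_finite_arcs)
  have subE: "parcs G \<subseteq> pverts G \<times> pverts G" using G.in_arcsD1 G.in_arcsD2 by auto
  have dedges: "distinct ((v, g [c]) # tedges t1 @ tedges t2)"
  proof -
    have "map snd ((v, g [c]) # tedges t1 @ tedges t2) = g [c] # tl (tverts t1) @ tl (tverts t2)"
      using tverts_eq_troot_Cons[of t1] tverts_eq_troot_Cons[of t2] by simp
    moreover have "distinct (g [c] # tl (tverts t1) @ tl (tverts t2))"
      using dist unfolding t1_def t2_def by auto
    ultimately show ?thesis by (metis distinct_map)
  qed
  have "edge_energy (pverts G) (parcs G) \<sigma> = \<sigma> v * \<sigma> (g [c]) + energy t1 \<sigma> + energy t2 \<sigma> + R \<sigma>" for \<sigma>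
  proof -
    let ?s = "\<lambda>(x, y). \<sigma> x * \<sigma> y"
    have finF: "finite F" by (simp add: F_def)
    have conv: "(\<Sum>p\<in>F\<inverse>. ?s p) = (\<Sum>p\<in>F. ?s p)"
      by (rule sum.reindex_bij_witness[of _ prod.swap prod.swap]) (auto simp: mult.commute)
    have "quad (pverts G) (adj (parcs G)) \<sigma> = (\<Sum>p\<in>parcs G. ?s p)"
      by (rule quad_adj[OF G.pair_finite_verts subE])
    also have "\<dots> = (\<Sum>p\<in>(F \<union> F\<inverse>) \<union> H. ?s p)"
      by (rule arg_cong[where f = "sum ?s"]) (use Farc symG in \<open>auto simp: H_def\<close>)
    also have "(\<Sum>p\<in>(F \<union> F\<inverse>) \<union> H. ?s p) = (\<Sum>p\<in>F \<union> F\<inverse>. ?s p) + (\<Sum>p\<in>H. ?s p)"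
      using finF finE by (intro sum.union_disjoint) (auto simp: H_def)
    also have "(\<Sum>p\<in>F \<union> F\<inverse>. ?s p) = (\<Sum>p\<in>F. ?s p) + (\<Sum>p\<in>F\<inverse>. ?s p)"
      using finF disj by (intro sum.union_disjoint) auto
    finally have qd: "quad (pverts G) (adj (parcs G)) \<sigma> = (\<Sum>p\<in>F. ?s p) + (\<Sum>p\<in>F\<inverse>. ?s p) + (\<Sum>p\<in>H. ?s p)" .
    have SF: "(\<Sum>p\<in>F. ?s p) = \<sigma> v * \<sigma> (g [c]) + energy t1 \<sigma> + energy t2 \<sigma>"
    proof -
      have "F = set ((v, g [c]) # tedges t1 @ tedges t2)" using sete by (simp add: F_def)
      then have "(\<Sum>p\<in>F. ?s p) = (\<Sum>p\<leftarrow>(v, g [c]) # tedges t1 @ tedges t2. ?s p)"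
        using sum_list_distinct_conv_sum_set[OF dedges, of ?s] by simp
      then show ?thesis by (simp add: energy_tedges)
    qed
    show ?thesis unfolding edge_energy_def qd conv SF R_def by simp
  qed
  then show "\<exists>R D. (\<forall>\<sigma>. edge_energy (pverts G) (parcs G) \<sigma>
          = \<sigma> v * \<sigma> (g [c]) + energy (Node v ts) \<sigma> + energy (Node (g [c]) us) \<sigma> + R \<sigma>) \<and>
        depends_on D R \<and> D \<inter> (set (inner_verts (Node v ts)) \<union> set (inner_verts (Node (g [c]) us))) = {}"
    using depR unfolding t1_def[symmetric] t2_def[symmetric] seti[symmetric]
    by (intro exI[of _ R] exI[of _ D]) (auto simp: D_def)
qed

locale ising_graph = perp_bounded "pverts G" "parcs G" k b \<alpha> \<delta>
  for G :: "'a pair_pre_digraph" and k :: nat and b \<alpha> \<delta> :: real +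
  assumes graph: "pair_graph G" and reg: "regular k G" and k: "1 \<le> k"
    and contract: "real (k - 1) * (tanh b)\<^sup>2 \<le> 1"
begin

definition "Z = (\<Sum>\<sigma>\<in>spin_cfgs (pverts G). w \<sigma>)"

definition "corr x y = (\<Sum>\<sigma>\<in>spin_cfgs (pverts G). w \<sigma> * (\<sigma> x * \<sigma> y))"

definition "corr_err m = 2 * (2 * (real k * (4 * b\<^sup>2 * (real (k - 1) * (tanh b)\<^sup>2) ^ m)) / (1 - \<delta>) * defect)"

lemma Z_pos: "0 < Z"
  unfolding Z_def by (intro sum_pos finite_spin_cfgs fin spin_cfgs_nonempty exp_gt_zero)

text \<open>The depths of the two trees differ by one, since the ball is centred at one end of the edge.\<close>

lemma corr_tree_like:
  assumes like: "tree_like k (Suc (Suc m)) G v" and edge: "(v, u) \<in> parcs G"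
  shows "\<bar>corr v u - tanh b * Z\<bar> \<le> corr_err m * Z"
proof -
  obtain g where chart: "tree_chart k (Suc (Suc m)) G v g"
    using tree_like_chart[OF graph reg k like] by blast
  define n where "n = Suc m"
  have chart': "tree_chart k (Suc n) G v g" using chart by (simp add: n_def)
  have nil: "[] \<in> tree_words k" by (simp add: tree_words_def)
  have all: "\<forall>w\<in>tree_words k. length w < Suc n \<longrightarrow> {y. (g w, y) \<in> parcs G} = g ` {w'. (w, w') \<in> parcs (regular_tree k)}"
    and "g [] = v"
    using chart' unfolding tree_chart_def by blast+
  moreover have "{y. (g [], y) \<in> parcs G} = g ` {w'. ([], w') \<in> parcs (regular_tree k)}"
    using bspec[OF all nil] by simp
  ultimately have "u \<in> g ` {w'. ([], w') \<in> parcs (regular_tree k)}" using edge by blast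
  then obtain w' where "u = g w'" "([], w') \<in> parcs (regular_tree k)" by auto
  then obtain c where c: "u = g [c]" "[c] \<in> tree_words k" by (auto simp: regular_tree_def)
  have ck: "c < k" using c(2) by (simp add: tree_words_def)
  define ts where "ts = map (\<lambda>a. tree_at k g n [a]) (filter (\<lambda>a. a \<noteq> c) [0..<k])"
  define us where "us = map (\<lambda>a. tree_at k g m [a, c]) (filter (\<lambda>a. a \<noteq> c) [0..<k])"
  note split = tree_chart_split[OF graph chart' n_def ck, folded ts_def us_def c(1)]
  obtain R D where RD: "\<And>\<sigma>. edge_energy (pverts G) (parcs G) \<sigma> = \<sigma> v * \<sigma> u + energy (Node v ts) \<sigma> + energy (Node u us) \<sigma> + R \<sigma>"
    "depends_on D R" "D \<inter> (set (inner_verts (Node v ts)) \<union> set (inner_verts (Node u us))) = {}"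
    using split(3) by blast
  have insub: "set (inner_verts (Node v ts)) \<union> set (inner_verts (Node u us)) \<subseteq> pverts G"
    using split(2) inner_subset_tverts[of "Node v ts"] inner_subset_tverts[of "Node u us"] by blast
  define X where "X = (\<lambda>\<sigma>. \<Sum>t\<leftarrow>ts. cavity_field b t \<sigma>)"
  define Y where "Y = (\<lambda>\<sigma>. \<Sum>t\<leftarrow>us. cavity_field b t \<sigma>)"
  let ?S = "spin_cfgs (pverts G)"
  let ?\<rho> = "real (k - 1) * (tanh b)\<^sup>2"
  have eq: "corr v u = (\<Sum>\<sigma>\<in>?S. w \<sigma> * edge_corr b (X \<sigma>) (Y \<sigma>))"
    unfolding corr_def X_def Y_def
    by (rule tree_edge_correlation[OF fin split(1) insub RD])
  have "\<bar>corr v u - tanh b * Z\<bar> = \<bar>\<Sum>\<sigma>\<in>?S. w \<sigma> * (edge_corr b (X \<sigma>) (Y \<sigma>) - tanh b)\<bar>"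
    unfolding eq Z_def by (simp add: left_diff_distrib right_diff_distrib sum_subtractf sum_distrib_left mult_ac)
  also have "\<dots> \<le> (\<Sum>\<sigma>\<in>?S. \<bar>w \<sigma> * (edge_corr b (X \<sigma>) (Y \<sigma>) - tanh b)\<bar>)" by (rule sum_abs)
  also have "\<dots> \<le> (\<Sum>\<sigma>\<in>?S. w \<sigma> * ((X \<sigma>)\<^sup>2 + (Y \<sigma>)\<^sup>2))"
    by (intro sum_mono) (simp add: abs_mult edge_corr_bound)
  also have "\<dots> = (\<Sum>\<sigma>\<in>?S. w \<sigma> * (X \<sigma>)\<^sup>2) + (\<Sum>\<sigma>\<in>?S. w \<sigma> * (Y \<sigma>)\<^sup>2)"
    by (simp add: distrib_left sum.distrib)
  also have "\<dots> \<le> corr_err m / 2 * Z + corr_err m / 2 * Z"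
  proof -
    have moment: "(\<Sum>\<sigma>\<in>?S. w \<sigma> * (\<Sum>t\<leftarrow>l. cavity_field b t \<sigma>)\<^sup>2) \<le> corr_err m / 2 * Z"
      if d: "distinct (concat (map tverts l))" and sub: "set (concat (map tverts l)) \<subseteq> pverts G"
        and isq: "(\<Sum>t\<leftarrow>l. influence_sq b t) \<le> real k * (4 * b\<^sup>2 * ?\<rho> ^ m)" for l
    proof -
      have "set (concat (map leaves l)) \<subseteq> pverts G" using sub concat_leaves_subset[of l] by blast
      then have "(\<Sum>\<sigma>\<in>?S. w \<sigma> * (\<Sum>t\<leftarrow>l. cavity_field b t \<sigma>)\<^sup>2) \<le> 2 * (\<Sum>t\<leftarrow>l. influence_sq b t) / (1 - \<delta>) * defect * Z"
        unfolding Z_def by (rule cavity_sum_second_moment[OF d])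
      also have "\<dots> \<le> 2 * (real k * (4 * b\<^sup>2 * ?\<rho> ^ m)) / (1 - \<delta>) * defect * Z"
        using isq delta Z_pos by (intro mult_right_mono divide_right_mono mult_left_mono) (auto simp: defect_def)
      also have "\<dots> = corr_err m / 2 * Z" 
      proof -
        have "2 * q / 2 = q" for q :: real by simp
        then show ?thesis by (simp only: corr_err_def)
      qed
      finally show ?thesis .
    qed
    have len: "real (length (filter (\<lambda>a. a \<noteq> c) [0..<k])) \<le> real k"
      using length_filter_le[of "\<lambda>a. a \<noteq> c" "[0..<k]"] by simp
    have each: "(\<Sum>a\<leftarrow>filter (\<lambda>a. a \<noteq> c) [0..<k]. influence_sq b (f a)) \<le> real k * (4 * b\<^sup>2 * ?\<rho> ^ m)"
      if f: "\<And>a. a < k \<Longrightarrow> a \<noteq> c \<Longrightarrow> influence_sq b (f a) \<le> 4 * b\<^sup>2 * ?\<rho> ^ m" for f :: "nat \<Rightarrow> 'a rtree"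
    proof -
      have "(\<Sum>a\<leftarrow>filter (\<lambda>a. a \<noteq> c) [0..<k]. influence_sq b (f a)) \<le> (\<Sum>a\<leftarrow>filter (\<lambda>a. a \<noteq> c) [0..<k]. 4 * b\<^sup>2 * ?\<rho> ^ m)"
        by (rule sum_list_mono) (use f in auto)
      also have "\<dots> = real (length (filter (\<lambda>a. a \<noteq> c) [0..<k])) * (4 * b\<^sup>2 * ?\<rho> ^ m)"
        by (simp only: sum_list_triv)
      also have "\<dots> \<le> real k * (4 * b\<^sup>2 * ?\<rho> ^ m)"
        by (rule mult_right_mono[OF len]) simp
      finally show ?thesis .
    qed
    have "(\<Sum>t\<leftarrow>ts. influence_sq b t) \<le> real k * (4 * b\<^sup>2 * ?\<rho> ^ m)"
      unfolding ts_def map_map comp_def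
    proof (rule each)
      fix a assume "a < k" "a \<noteq> c"
      then have "influence_sq b (tree_at k g n [a]) \<le> 4 * b\<^sup>2 * ?\<rho> ^ n"
        by (intro influence_sq_tree_at) (auto simp: tree_words_def)
      also have "\<dots> \<le> 4 * b\<^sup>2 * ?\<rho> ^ m"
        by (intro mult_left_mono power_decreasing contract) (auto simp: n_def)
      finally show "influence_sq b (tree_at k g n [a]) \<le> 4 * b\<^sup>2 * ?\<rho> ^ m" .
    qed
    moreover have "(\<Sum>t\<leftarrow>us. influence_sq b t) \<le> real k * (4 * b\<^sup>2 * ?\<rho> ^ m)"
      unfolding us_def map_map comp_def
    proof (rule each)
      fix a assume "a < k" "a \<noteq> c"
      then show "influence_sq b (tree_at k g m [a, c]) \<le> 4 * b\<^sup>2 * ?\<rho> ^ m"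
        using ck by (intro influence_sq_tree_at) (auto simp: tree_words_def)
    qed
    moreover have "distinct (concat (map tverts ts))" "distinct (concat (map tverts us))"
      "set (concat (map tverts ts)) \<subseteq> pverts G" "set (concat (map tverts us)) \<subseteq> pverts G"
      using split(1) split(2) unfolding tverts.simps distinct_append distinct.simps set_append list.set by blast+
    ultimately show ?thesis unfolding X_def Y_def by (intro add_mono moment)
  qed
  also have "\<dots> = corr_err m * Z"
    by (simp only: distrib_right[symmetric] field_sum_of_halves)
  finally show ?thesis .
qed

text \<open>Vertices without a tree-like neighbourhood are estimated by the trivial bound 2 for the difference of two correlations.\<close>

lemma mean_energy_estimate:
  "\<bar>(\<Sum>\<sigma>\<in>spin_cfgs (pverts G). w \<sigma> * edge_energy (pverts G) (parcs G) \<sigma>) / Z / real (card (pverts G)) - real k / 2 * tanh b\<bar>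
    \<le> real k * corr_err m / 2 + real k * (1 - real (card {v \<in> pverts G. tree_like k (Suc (Suc m)) G v}) / real (card (pverts G)))"
proof -
  interpret G: pair_graph G by (rule graph)
  let ?V = "pverts G" and ?E = "parcs G"
  define N where "N = real (card ?V)"
  have N: "0 < N" using card_pos by (simp add: N_def)
  define good where "good = {v \<in> ?V. tree_like k (Suc (Suc m)) G v}"
  define e where "e = corr_err m"
  have e: "0 \<le> e" using delta by (auto simp: e_def corr_err_def defect_def intro!: mult_nonneg_nonneg divide_nonneg_pos)
  have tanh1: "\<bar>tanh b\<bar> \<le> 1" using tanh_real_abs[of b] tanh_real_lt_1[of "\<bar>b\<bar>"] by simp
  have corr_le: "\<bar>corr x y\<bar> \<le> Z" if "x \<in> ?V" "y \<in> ?V" for x y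
  proof -
    have "\<bar>corr x y\<bar> \<le> (\<Sum>\<sigma>\<in>spin_cfgs ?V. \<bar>w \<sigma> * (\<sigma> x * \<sigma> y)\<bar>)" unfolding corr_def by (rule sum_abs)
    also have "\<dots> = Z"
      unfolding Z_def
    proof (rule sum.cong[OF refl])
      fix \<sigma> assume \<sigma>: "\<sigma> \<in> spin_cfgs ?V"
      show "\<bar>w \<sigma> * (\<sigma> x * \<sigma> y)\<bar> = w \<sigma>"
        using spin_cfgs_D[OF \<sigma> that(1)] spin_cfgs_D[OF \<sigma> that(2)] by (auto simp: abs_mult)
    qed
    finally show ?thesis .
  qed
  note deg = sum_adj_regular[OF graph reg]
  have energy: "(\<Sum>\<sigma>\<in>spin_cfgs ?V. w \<sigma> * edge_energy ?V ?E \<sigma>) = 1/2 * (\<Sum>x\<in>?V. \<Sum>y\<in>?V. adj ?E x y * corr x y)"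
  proof -
    have "(\<Sum>\<sigma>\<in>spin_cfgs ?V. w \<sigma> * edge_energy ?V ?E \<sigma>)
        = (\<Sum>\<sigma>\<in>spin_cfgs ?V. \<Sum>x\<in>?V. \<Sum>y\<in>?V. 1/2 * (adj ?E x y * (w \<sigma> * (\<sigma> x * \<sigma> y))))"
    proof (rule sum.cong[OF refl])
      have "c * edge_energy ?V ?E \<sigma> = (\<Sum>x\<in>?V. \<Sum>y\<in>?V. 1/2 * (adj ?E x y * (c * (\<sigma> x * \<sigma> y))))" for c \<sigma>
        by (simp add: edge_energy_def quad_def sum_distrib_left mult_ac)
      then show "w \<sigma> * edge_energy ?V ?E \<sigma> = (\<Sum>x\<in>?V. \<Sum>y\<in>?V. 1/2 * (adj ?E x y * (w \<sigma> * (\<sigma> x * \<sigma> y))))" for \<sigma> .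
    qed
    also have "\<dots> = (\<Sum>x\<in>?V. \<Sum>\<sigma>\<in>spin_cfgs ?V. \<Sum>y\<in>?V. 1/2 * (adj ?E x y * (w \<sigma> * (\<sigma> x * \<sigma> y))))"
      by (rule sum.swap)
    also have "\<dots> = (\<Sum>x\<in>?V. \<Sum>y\<in>?V. \<Sum>\<sigma>\<in>spin_cfgs ?V. 1/2 * (adj ?E x y * (w \<sigma> * (\<sigma> x * \<sigma> y))))"
      by (intro sum.cong refl sum.swap)
    also have "\<dots> = 1/2 * (\<Sum>x\<in>?V. \<Sum>y\<in>?V. adj ?E x y * corr x y)"
      by (simp only: corr_def sum_distrib_left)
    finally show ?thesis .
  qed
  have vertex: "\<bar>(\<Sum>y\<in>?V. adj ?E x y * corr x y) - real k * tanh b * Z\<bar> \<le> real k * (if x \<in> good then e else 2) * Z"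
    if x: "x \<in> ?V" for x
  proof -
    have "(\<Sum>y\<in>?V. adj ?E x y * corr x y) - real k * tanh b * Z = (\<Sum>y\<in>?V. adj ?E x y * (corr x y - tanh b * Z))"
      unfolding deg[OF x, symmetric] by (simp add: right_diff_distrib sum_subtractf sum_distrib_right mult.assoc)
    also have "\<bar>\<dots>\<bar> \<le> (\<Sum>y\<in>?V. \<bar>adj ?E x y * (corr x y - tanh b * Z)\<bar>)" by (rule sum_abs)
    also have "\<dots> \<le> (\<Sum>y\<in>?V. adj ?E x y * ((if x \<in> good then e else 2) * Z))"
    proof (rule sum_mono)
      fix y assume y: "y \<in> ?V"
      have "\<bar>corr x y - tanh b * Z\<bar> \<le> (if x \<in> good then e else 2) * Z" if "(x, y) \<in> ?E"
      proof (cases "x \<in> good")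
        case True
        then show ?thesis using corr_tree_like[of m x y] that by (simp add: good_def e_def mult.commute)
      next
        case False
        have "\<bar>tanh b * Z\<bar> \<le> 1 * Z" unfolding abs_mult using tanh1 Z_pos by (intro mult_mono) auto
        then show ?thesis using corr_le[OF x y] False by simp
      qed
      then show "\<bar>adj ?E x y * (corr x y - tanh b * Z)\<bar> \<le> adj ?E x y * ((if x \<in> good then e else 2) * Z)"
        by (simp add: adj_def)
    qed
    also have "\<dots> = real k * (if x \<in> good then e else 2) * Z"
      by (simp only: sum_distrib_right[symmetric] deg[OF x] mult.assoc)
    finally show ?thesis .
  qed
  define Q where "Q = (\<Sum>x\<in>?V. \<Sum>y\<in>?V. adj ?E x y * corr x y)"
  have "\<bar>Q - N * (real k * tanh b * Z)\<bar>
      = \<bar>\<Sum>x\<in>?V. (\<Sum>y\<in>?V. adj ?E x y * corr x y) - real k * tanh b * Z\<bar>"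
    unfolding Q_def by (simp add: sum_subtractf N_def)
  also have "\<dots> \<le> (\<Sum>x\<in>?V. \<bar>(\<Sum>y\<in>?V. adj ?E x y * corr x y) - real k * tanh b * Z\<bar>)" by (rule sum_abs)
  also have "\<dots> \<le> (\<Sum>x\<in>?V. real k * (if x \<in> good then e else 2) * Z)" by (intro sum_mono vertex)
  also have "\<dots> \<le> (\<Sum>x\<in>?V. real k * (e + (if x \<in> good then 0 else 2)) * Z)"
    using e Z_pos by (intro sum_mono mult_right_mono mult_left_mono) auto
  also have "\<dots> = real k * Z * (\<Sum>x\<in>?V. e + (if x \<in> good then 0 else 2))"
    by (simp only: sum_distrib_left mult_ac)
  also have "(\<Sum>x\<in>?V. e + (if x \<in> good then 0 else 2)) = N * e + 2 * (N - real (card good))"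
  proof -
    have g: "good \<subseteq> ?V" by (auto simp: good_def)
    have "(\<Sum>x\<in>?V. if x \<in> good then 0 else 2 :: real) = 2 * real (card (?V - good))"
      using fin by (simp add: sum.If_cases Diff_eq)
    also have "real (card (?V - good)) = N - real (card good)"
      using card_Diff_subset[OF finite_subset[OF g fin] g] card_mono[OF fin g] by (simp add: N_def of_nat_diff)
    finally show ?thesis by (simp add: sum.distrib N_def)
  qed
  finally have main: "\<bar>Q - N * (real k * tanh b * Z)\<bar>
      \<le> real k * Z * (N * e + 2 * (N - real (card good)))" .
  have NZ: "0 < 2 * Z * N" using N Z_pos by simp
  have eqq: "1/2 * q / Z / N - real k / 2 * tanh b = (q - N * (real k * tanh b * Z)) / (2 * Z * N)" for q
  proof -
    have "(q - N * (real k * tanh b * Z)) / (2 * Z * N) = q / (2 * Z * N) - (real k * tanh b) * (Z * N) / (2 * (Z * N))"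
      by (simp add: diff_divide_distrib mult_ac)
    moreover have "(real k * tanh b) * (Z * N) / (2 * (Z * N)) = real k / 2 * tanh b"
      using N Z_pos by simp
    ultimately show ?thesis by simp
  qed
  have "\<bar>1/2 * Q / Z / N - real k / 2 * tanh b\<bar>
      = \<bar>Q - N * (real k * tanh b * Z)\<bar> / (2 * Z * N)"
    unfolding eqq abs_divide using NZ by simp
  also have "\<dots> \<le> real k * Z * (N * e + 2 * (N - real (card good))) / (2 * Z * N)"
    using main NZ by (intro divide_right_mono) auto
  also have "\<dots> = real k * e / 2 + real k * (1 - real (card good) / N)"
  proof -
    have "real k * Z * (N * e + 2 * (N - real (card good))) / (2 * Z * N)
        = real k * (Z * (N * e + 2 * (N - real (card good)))) / (Z * (2 * N))" by (simp add: mult_ac)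
    also have "\<dots> = real k * ((N * e + 2 * (N - real (card good))) / (2 * N))"
      using Z_pos by simp
    also have "(N * e + 2 * (N - real (card good))) / (2 * N) = e / 2 + (1 - real (card good) / N)"
      using N by (simp add: add_divide_distrib diff_divide_distrib)
    finally show ?thesis by (simp add: distrib_left)
  qed
  finally show ?thesis unfolding energy Q_def[symmetric] N_def[symmetric] good_def[symmetric] e_def[symmetric] .
qed

end

section \<open>The spectral hypothesis\<close>

lemma perp_part_index:
  assumes G: "pair_graph G" and V: "pverts G = {..<N}" and reg: "regular k G" and N: "0 < N" and i: "i < N" and j: "j < N"
  shows "perp_part (weight_matrix N \<beta> G) $$ (i, j) = \<beta> * adj_perp {..<N} (parcs G) k i j"
proof -
  interpret G: pair_graph G by (rule G)
  let ?E = "parcs G"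
  define a where "a = (\<lambda>i j. \<beta> * adj ?E i j)"
  note adj_sym = adj_symmetric[OF G]
  have deg: "(\<Sum>y<N. adj ?E x y) = real k" if "x < N" for x
    using sum_adj_regular[OF G reg, of x] that V by simp
  have row: "(\<Sum>l<N. a l j) = \<beta> * real k" if "j < N" for j
    using deg[OF that] by (simp add: a_def sum_distrib_left[symmetric] adj_sym[of _ j])
  have row': "(\<Sum>l<N. a i l) = \<beta> * real k" if "i < N" for i
    using deg[OF that] by (simp add: a_def sum_distrib_left[symmetric])
  let ?P = "P_perp N" and ?A = "weight_matrix N \<beta> G"
  have dims: "?P \<in> carrier_mat N N" "?A \<in> carrier_mat N N"
    by (auto simp: P_perp_def weight_matrix_def)
  have P: "?P $$ (x, y) = (if x = y then 1 else 0) - 1 / real N" if "x < N" "y < N" for x y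
    using that by (simp add: P_perp_def)
  have A: "?A $$ (x, y) = a x y" if "x < N" "y < N" for x y
    using that by (simp add: weight_matrix_def a_def adj_def)
  have mult: "(B * C) $$ (x, y) = (\<Sum>l<N. B $$ (x, l) * C $$ (l, y))"
    if "B \<in> carrier_mat N N" "C \<in> carrier_mat N N" "x < N" "y < N" for B C :: "real mat" and x y
    using that by (auto simp: scalar_prod_def atLeast0LessThan)
  have PA: "(?P * ?A) $$ (x, y) = a x y - \<beta> * real k / real N" if "x < N" "y < N" for x y
  proof -
    have "(?P * ?A) $$ (x, y) = (\<Sum>l<N. (if l = x then a x y else 0) - a l y / real N)"
      unfolding mult[OF dims that] by (intro sum.cong refl) (use that in \<open>auto simp: P A left_diff_distrib\<close>)
    also have "\<dots> = a x y - (\<Sum>l<N. a l y) / real N"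
      using that by (simp add: sum_subtractf sum_divide_distrib)
    finally show ?thesis using row[OF that(2)] by simp
  qed
  have "(?P * ?A * ?P) $$ (i, j) = (\<Sum>l<N. (if l = j then a i j - \<beta> * real k / real N else 0) - (a i l - \<beta> * real k / real N) / real N)"
    unfolding mult[OF mult_carrier_mat[OF dims] dims(1) i j]
    by (intro sum.cong refl) (use i j in \<open>auto simp: P PA right_diff_distrib\<close>)
  also have "\<dots> = a i j - \<beta> * real k / real N - (\<Sum>l<N. a i l - \<beta> * real k / real N) / real N"
  proof -
    have "(\<Sum>l<N. (if l = j then x else 0) - f l / real N) = x - (\<Sum>l<N. f l) / real N" for x and f :: "nat \<Rightarrow> real"
      using j by (simp add: sum_subtractf sum_divide_distrib)
    then show ?thesis .
  qed
  also have "(\<Sum>l<N. a i l - \<beta> * real k / real N) = 0"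
    using N row'[OF i] by (simp add: sum_subtractf)
  finally have "(?P * ?A * ?P) $$ (i, j) = \<beta> * adj_perp {..<N} ?E k i j"
    by (simp add: a_def adj_perp_def right_diff_distrib)
  moreover have "dim_row ?A = N" by (simp add: weight_matrix_def)
  ultimately show ?thesis by (simp add: perp_part_def)
qed

lemma perp_form_bounds:
  fixes \<beta> :: real and G :: "nat pair_pre_digraph"
  assumes G: "pair_graph G" and V: "pverts G = {..<N}" and reg: "regular k G" and N: "0 < N"
  defines "B \<equiv> perp_part (weight_matrix N \<beta> G)"
  shows "lambda_min B * sqnorm {..<N} x \<le> \<beta> * quad {..<N} (adj_perp {..<N} (parcs G) k) x"
    and "\<beta> * quad {..<N} (adj_perp {..<N} (parcs G) k) x \<le> lambda_max B * sqnorm {..<N} x"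
proof -
  interpret G: pair_graph G by (rule G)
  have B: "B \<in> carrier_mat N N"
  proof -
    have "P_perp N \<in> carrier_mat N N" "weight_matrix N \<beta> G \<in> carrier_mat N N" "dim_row (weight_matrix N \<beta> G) = N"
      by (auto simp: P_perp_def weight_matrix_def)
    then show ?thesis unfolding B_def perp_part_def by (simp only:) (intro mult_carrier_mat[of _ N N])
  qed
  have idx: "B $$ (i, j) = \<beta> * adj_perp {..<N} (parcs G) k i j" if "i < N" "j < N" for i j
    unfolding B_def by (rule perp_part_index[OF G V reg N that])
  have sym: "B $$ (i, j) = B $$ (j, i)" if "i < N" "j < N" for i j
    using idx that by (simp add: adj_perp_def adj_symmetric[OF G, of i j])
  have "quad {..<N} (\<lambda>i j. B $$ (i, j)) x = quad {..<N} (\<lambda>i j. \<beta> * adj_perp {..<N} (parcs G) k i j) x"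
    unfolding quad_def by (intro sum.cong refl) (simp add: idx)
  then have q: "quad {..<N} (\<lambda>i j. B $$ (i, j)) x = \<beta> * quad {..<N} (adj_perp {..<N} (parcs G) k) x"
    by (simp only: quad_scale)
  show "lambda_min B * sqnorm {..<N} x \<le> \<beta> * quad {..<N} (adj_perp {..<N} (parcs G) k) x"
    "\<beta> * quad {..<N} (adj_perp {..<N} (parcs G) k) x \<le> lambda_max B * sqnorm {..<N} x"
    using lambda_min_max_quad[OF B sym, of x] unfolding q by auto
qed

text \<open>The test vectors \<open>\<plusminus>\<surd>k e\<^sub>v + 1\<^bsub>N(v)\<^esub>\<close> show that the spectral width is at least
  \<open>2 \<surd>k \<bar>\<beta>\<bar> (1 - k/N)\<close>.\<close>

lemma spectral_width_star:
  fixes G :: "'a pair_pre_digraph"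
  assumes G: "pair_graph G" and reg: "regular k G" and v: "v \<in> pverts G" and k: "0 < k"
    and large: "2 * k \<le> card (pverts G)"
    and lower: "\<And>x. lo * sqnorm (pverts G) x \<le> \<beta> * quad (pverts G) (adj_perp (pverts G) (parcs G) k) x"
    and upper: "\<And>x. \<beta> * quad (pverts G) (adj_perp (pverts G) (parcs G) k) x \<le> hi * sqnorm (pverts G) x"
  shows "sqrt (real k) * \<bar>\<beta>\<bar> \<le> hi - lo"
proof -
  interpret G: pair_graph G by (rule G)
  let ?V = "pverts G" and ?E = "parcs G"
  let ?A = "adj_perp ?V ?E k"
  define N where "N = real (card ?V)"
  have N: "2 * real k \<le> N" "0 < N" using large k by (auto simp: N_def)
  define S where "S = {y. (v, y) \<in> ?E}"
  have S: "S \<subseteq> ?V" "v \<notin> S"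
    using G.in_arcsD2 G.pair_no_loops[of "(v, v)"] by (auto simp: S_def)
  have cardS: "card S = k"
    using reg v by (simp add: regular_def out_degree_eq_card S_def)
  define u where "u = (\<lambda>i. if i \<in> S then 1 else 0 :: real)"
  define z where "z = (\<lambda>i. if i = v then sqrt (real k) else 0)"
  have sq: "sqnorm ?V (\<lambda>i. u i + t * z i) = 2 * real k" if t: "t = 1 \<or> t = -1" for t
  proof -
    have "(u i + t * z i)\<^sup>2 = (if i \<in> S then 1 else 0) + (if i = v then real k else 0)" for i
      using t S(2) by (auto simp: u_def z_def power_mult_distrib)
    then have "sqnorm ?V (\<lambda>i. u i + t * z i) = (\<Sum>i\<in>?V. if i \<in> S then 1 else 0) + (\<Sum>i\<in>?V. if i = v then real k else 0)"
      by (simp add: sqnorm_def sum.distrib)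
    moreover have "(\<Sum>i\<in>?V. if i \<in> S then 1 else 0 :: real) = real k"
      using S G.pair_finite_verts cardS by (simp add: sum.If_cases Int_absorb1)
    ultimately show ?thesis using v G.pair_finite_verts by simp
  qed
  have sym: "?A i j = ?A j i" for i j
    by (simp add: adj_perp_def adj_symmetric[OF G, of i j])
  define c where "c = (\<Sum>i\<in>?V. z i * mat_app ?V ?A u i)"
  have quad: "quad ?V ?A (\<lambda>i. u i + t * z i) = quad ?V ?A u + 2 * t * c + t\<^sup>2 * quad ?V ?A z" for t
    unfolding c_def by (rule quad_add_scaled[OF sym])
  \<comment> \<open>Both test vectors have norm \<open>2 k\<close>, so only the cross term \<open>c\<close> separates their Rayleigh quotients.\<close>
  have "c = sqrt (real k) * mat_app ?V ?A u v"
  proof -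
    have "c = (\<Sum>i\<in>?V. if i = v then sqrt (real k) * mat_app ?V ?A u v else 0)"
      unfolding c_def by (intro sum.cong refl) (simp add: z_def)
    then show ?thesis using v G.pair_finite_verts by simp
  qed
  also have "mat_app ?V ?A u v = (\<Sum>j\<in>S. ?A v j)"
  proof -
    have "mat_app ?V ?A u v = (\<Sum>j\<in>?V. if j \<in> S then ?A v j else 0)"
      unfolding mat_app_def by (intro sum.cong refl) (simp add: u_def)
    also have "\<dots> = (\<Sum>j\<in>?V \<inter> S. ?A v j)"
      using G.pair_finite_verts by (simp add: sum.inter_restrict)
    also have "?V \<inter> S = S" using S by auto
    finally show ?thesis .
  qed
  also have "(\<Sum>j\<in>S. ?A v j) = (\<Sum>j\<in>S. 1 - real k / N)"
    by (intro sum.cong refl) (simp add: adj_perp_def adj_def S_def N_def)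
  also have "\<dots> = real k * (1 - real k / N)" using cardS by simp
  finally have c: "c = sqrt (real k) * (real k * (1 - real k / N))" .
  have half: "1/2 \<le> 1 - real k / N" 
  proof -
    have "real k / N \<le> 1/2" using N by (simp only: pos_divide_le_eq)
    then show ?thesis by linarith
  qed
  have rk: "0 < real k" "0 < sqrt (real k)" using k by auto
  have cpos: "sqrt (real k) * real k \<le> 2 * c"
    unfolding c using mult_left_mono[OF half, of "2 * (sqrt (real k) * real k)"] rk by simp
  let ?q = "\<lambda>t. \<beta> * quad ?V ?A (\<lambda>i. u i + t * z i)"
  have diff: "?q 1 - ?q (-1) = 4 * (\<beta> * c)" unfolding quad by (simp add: algebra_simps)
  have "\<bar>4 * (\<beta> * c)\<bar> \<le> (hi - lo) * (2 * real k)"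
    unfolding diff[symmetric]
    using lower[of "\<lambda>i. u i + 1 * z i"] upper[of "\<lambda>i. u i + 1 * z i"]
      lower[of "\<lambda>i. u i + (-1) * z i"] upper[of "\<lambda>i. u i + (-1) * z i"]
    unfolding sq[of 1, OF disjI1[OF refl]] sq[of "-1", OF disjI2[OF refl]] left_diff_distrib abs_le_iff
    by linarith
  moreover have "\<bar>4 * (\<beta> * c)\<bar> \<ge> 2 * (\<bar>\<beta>\<bar> * (sqrt (real k) * real k))"
  proof -
    have "0 \<le> c" using cpos mult_pos_pos[OF rk(2,1)] by linarith
    then have "\<bar>4 * (\<beta> * c)\<bar> = 2 * (\<bar>\<beta>\<bar> * (2 * c))" by (simp add: abs_mult)
    then show ?thesis using mult_left_mono[OF cpos, of "\<bar>\<beta>\<bar>"] by (simp add: mult_ac)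
  qed
  ultimately have "2 * (\<bar>\<beta>\<bar> * (sqrt (real k) * real k)) \<le> (hi - lo) * (2 * real k)" by linarith
  then have "(sqrt (real k) * \<bar>\<beta>\<bar>) * (2 * real k) \<le> (hi - lo) * (2 * real k)" by (simp add: mult_ac)
  then show ?thesis by (rule mult_right_le_imp_le) (use rk in simp)
qed

lemma ising_free_energy_eq:
  assumes V: "pverts G = {..<N}"
  shows "ising_free_energy (weight_matrix N \<beta> G) (0\<^sub>v N)
    = ln (\<Sum>\<sigma>\<in>spin_cfgs {..<N}. exp (\<beta> * edge_energy {..<N} (parcs G) \<sigma>)) / real N"
proof -
  let ?A = "weight_matrix N \<beta> G"
  have dim: "dim_row ?A = N" by (simp add: weight_matrix_def)
  have "(\<Sum>\<sigma>\<in>spins N. exp (1/2 * scalar_prod \<sigma> (?A *\<^sub>v \<sigma>) + scalar_prod (0\<^sub>v N) \<sigma>))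
      = (\<Sum>\<sigma>\<in>spin_cfgs {..<N}. exp (\<beta> * edge_energy {..<N} (parcs G) \<sigma>))"
  proof (rule sum.reindex_bij_witness[of _ "\<lambda>\<sigma>. vec N \<sigma>" "\<lambda>\<sigma>. restrict (vec_index \<sigma>) {..<N}"])
    fix \<sigma> assume s: "\<sigma> \<in> spins N"
    then have carr: "\<sigma> \<in> carrier_vec N" by (simp add: spins_def)
    show "vec N (restrict (vec_index \<sigma>) {..<N}) = \<sigma>" using carr by (intro eq_vecI) auto
    show "restrict (vec_index \<sigma>) {..<N} \<in> spin_cfgs {..<N}"
      using s by (auto simp: spins_def spin_cfgs_def)
    let ?s = "vec_index \<sigma>"
    have "scalar_prod \<sigma> (?A *\<^sub>v \<sigma>) = (\<Sum>i<N. \<Sum>j<N. ?s i * (\<beta> * adj (parcs G) i j) * ?s j)"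
      using carr by (auto simp: scalar_prod_def weight_matrix_def adj_def sum_distrib_left atLeast0LessThan intro!: sum.cong)
    also have "\<dots> = quad {..<N} (\<lambda>i j. \<beta> * adj (parcs G) i j) ?s" by (simp add: quad_def)
    also have "\<dots> = quad {..<N} (\<lambda>i j. \<beta> * adj (parcs G) i j) (restrict ?s {..<N})" by (rule quad_cong) simp
    also have "\<dots> = \<beta> * quad {..<N} (adj (parcs G)) (restrict ?s {..<N})" by (rule quad_scale)
    finally have "1/2 * scalar_prod \<sigma> (?A *\<^sub>v \<sigma>) = \<beta> * edge_energy {..<N} (parcs G) (restrict ?s {..<N})"
      by (simp add: edge_energy_def)
    moreover have "scalar_prod (0\<^sub>v N) \<sigma> = 0" using carr by simp
    ultimately show "exp (\<beta> * edge_energy {..<N} (parcs G) (restrict ?s {..<N}))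
        = exp (1/2 * scalar_prod \<sigma> (?A *\<^sub>v \<sigma>) + scalar_prod (0\<^sub>v N) \<sigma>)" by simp
  next
    fix \<sigma> :: "nat \<Rightarrow> real" assume s: "\<sigma> \<in> spin_cfgs {..<N}"
    show "restrict (vec_index (vec N \<sigma>)) {..<N} = \<sigma>"
      using s by (auto simp: spin_cfgs_def PiE_def extensional_def fun_eq_iff)
    show "vec N \<sigma> \<in> spins N" using spin_cfgs_D[OF s] by (auto simp: spins_def)
  qed
  then show ?thesis by (simp add: ising_free_energy_def dim)
qed

section \<open>The free energy\<close>

lemma card_spin_cfgs: "finite V \<Longrightarrow> card (spin_cfgs V) = 2 ^ card V"
  unfolding spin_cfgs_def by (subst card_PiE) (auto simp: numeral_2_eq_2)

definition edge_err :: "nat \<Rightarrow> real \<Rightarrow> real \<Rightarrow> nat \<Rightarrow> real" where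
  "edge_err k \<beta> \<delta> m = 2 * (2 * (real k * (4 * \<beta>\<^sup>2 * (real (k - 1) * (tanh \<beta>)\<^sup>2) ^ m)) / (1 - \<delta>) * exp (- 4 * \<beta> * real k / (1 - \<delta>)))"

text \<open>The spectral hypothesis at \<open>\<beta>\<close> implies it at every \<open>s = \<theta> \<beta>\<close> with \<open>0 \<le> \<theta> \<le> 1\<close>, because all eigenvalues are scaled by
  \<open>\<theta>\<close>; so the estimate of the derivative is uniform and can be integrated.\<close>

lemma free_energy_estimate:
  fixes G :: "'a pair_pre_digraph"
  assumes G: "pair_graph G" and reg: "regular k G" and ne: "pverts G \<noteq> {}" and k: "1 \<le> k"
    and \<beta>: "\<beta> < 0" and delta: "0 \<le> \<delta>" "\<delta> < 1" and width: "hi - lo \<le> \<delta>"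
    and lower: "\<And>x. lo * sqnorm (pverts G) x \<le> \<beta> * quad (pverts G) (adj_perp (pverts G) (parcs G) k) x"
    and upper: "\<And>x. \<beta> * quad (pverts G) (adj_perp (pverts G) (parcs G) k) x \<le> hi * sqnorm (pverts G) x"
    and contract: "real (k - 1) * (tanh \<beta>)\<^sup>2 \<le> 1"
  shows "\<bar>ln (\<Sum>\<sigma>\<in>spin_cfgs (pverts G). exp (\<beta> * edge_energy (pverts G) (parcs G) \<sigma>)) / real (card (pverts G))
      - (ln 2 + real k / 2 * ln (cosh \<beta>))\<bar>
    \<le> (real k * edge_err k \<beta> \<delta> m / 2
       + real k * (1 - real (card {v \<in> pverts G. tree_like k (Suc (Suc m)) G v}) / real (card (pverts G)))) * \<bar>\<beta>\<bar>"
    (is "_ \<le> ?B * _")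
proof -
  interpret G: pair_graph G by (rule G)
  let ?V = "pverts G" and ?E = "parcs G"
  let ?e = "edge_energy ?V ?E"
  let ?N = "real (card ?V)"
  have fin: "finite ?V" by (rule G.pair_finite_verts)
  define Z where "Z = (\<lambda>s. \<Sum>\<sigma>\<in>spin_cfgs ?V. exp (s * ?e \<sigma>))"
  have Zpos: "0 < Z s" for s
    unfolding Z_def by (intro sum_pos finite_spin_cfgs fin spin_cfgs_nonempty exp_gt_zero)
  have N: "0 < ?N" using ne fin by (simp add: card_gt_0_iff)
  define D where "D = (\<lambda>s. ln (Z s) / ?N - real k / 2 * ln (cosh s))"
  define D' where "D' = (\<lambda>s. (\<Sum>\<sigma>\<in>spin_cfgs ?V. exp (s * ?e \<sigma>) * ?e \<sigma>) / Z s / ?N - real k / 2 * tanh s)"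
  have der: "(D has_real_derivative D' s) (at s)" for s
  proof -
    have "(Z has_real_derivative (\<Sum>\<sigma>\<in>spin_cfgs ?V. exp (s * ?e \<sigma>) * ?e \<sigma>)) (at s)"
      unfolding Z_def by (auto intro!: derivative_eq_intros)
    then have "((\<lambda>s. ln (Z s)) has_real_derivative (\<Sum>\<sigma>\<in>spin_cfgs ?V. exp (s * ?e \<sigma>) * ?e \<sigma>) / Z s) (at s)"
      using Zpos[of s] by (auto intro!: derivative_eq_intros)
    moreover have "((\<lambda>s. ln (cosh s)) has_real_derivative tanh s) (at s)"
      using cosh_real_pos[of s] by (auto intro!: derivative_eq_intros simp: tanh_def)
    ultimately show ?thesis
      unfolding D_def D'_def by (intro DERIV_diff DERIV_cdivide DERIV_cmult)
  qed
  have bound: "\<bar>D' s\<bar> \<le> ?B" if s: "s \<in> {\<beta>..0}" for s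
  proof -
    define \<theta> where "\<theta> = s / \<beta>"
    have th: "0 \<le> \<theta>" "\<theta> \<le> 1" "s = \<theta> * \<beta>" 
    proof -
      show "0 \<le> \<theta>" unfolding \<theta>_def using s \<beta> by (intro divide_nonpos_neg) auto
      show "\<theta> \<le> 1" unfolding \<theta>_def neg_divide_le_eq[OF \<beta>] using s by simp
      show "s = \<theta> * \<beta>" unfolding \<theta>_def using \<beta> by simp
    qed
    have sb: "\<bar>s\<bar> \<le> \<bar>\<beta>\<bar>" using s by auto
    have s2: "s\<^sup>2 \<le> \<beta>\<^sup>2" using sb by (simp add: abs_le_square_iff)
    have t2: "(tanh s)\<^sup>2 \<le> (tanh \<beta>)\<^sup>2"
    proof -
      have "\<bar>tanh s\<bar> \<le> \<bar>tanh \<beta>\<bar>" unfolding tanh_real_abs[symmetric] using sb by (simp only: tanh_real_le_iff)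
      then show ?thesis by (simp add: abs_le_square_iff)
    qed
    have r: "real (k - 1) * (tanh s)\<^sup>2 \<le> real (k - 1) * (tanh \<beta>)\<^sup>2" by (intro mult_left_mono t2) simp
    interpret P: ising_graph G k s "\<theta> * lo" \<delta>
    proof (intro ising_graph.intro perp_bounded.intro ising_graph_axioms.intro)
      show "(y, x) \<in> ?E" if "(x, y) \<in> ?E" for x y
        using G.pair_sym_arcs that by (auto simp: symmetric_def elim: symE)
      show "\<theta> * lo * sqnorm ?V x \<le> s * quad ?V (adj_perp ?V ?E k) x" for x
        using mult_left_mono[OF lower[of x] th(1)] unfolding th(3) by (simp only: mult.assoc)
      show "s * quad ?V (adj_perp ?V ?E k) x \<le> (\<theta> * lo + \<delta>) * sqnorm ?V x" for x
      proof -
        have "s * quad ?V (adj_perp ?V ?E k) x \<le> \<theta> * hi * sqnorm ?V x"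
          using mult_left_mono[OF upper[of x] th(1)] unfolding th(3) by (simp only: mult.assoc)
        also have "\<dots> \<le> (\<theta> * lo + \<delta>) * sqnorm ?V x"
        proof (intro mult_right_mono sqnorm_nonneg)
          have "\<theta> * (hi - lo) \<le> \<theta> * \<delta>" by (intro mult_left_mono width th(1))
          also have "\<dots> \<le> 1 * \<delta>" by (intro mult_right_mono th(2) delta(1))
          finally show "\<theta> * hi \<le> \<theta> * lo + \<delta>" by (simp add: right_diff_distrib)
        qed
        finally show ?thesis .
      qed
      show "real (k - 1) * (tanh s)\<^sup>2 \<le> 1" using r contract by linarith
      show "s \<le> 0" using s by simp
    qed (fact fin ne delta G reg k)+
    have defect: "P.defect \<le> exp (- 4 * \<beta> * real k / (1 - \<delta>))"
    proof -
      have "- 4 * s * real k \<le> - 4 * \<beta> * real k" using s by (intro mult_right_mono) auto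
      then show ?thesis unfolding P.defect_def using delta by (simp add: divide_right_mono)
    qed
    have "P.corr_err m \<le> edge_err k \<beta> \<delta> m"
    proof -
      have "(real (k - 1) * (tanh s)\<^sup>2) ^ m \<le> (real (k - 1) * (tanh \<beta>)\<^sup>2) ^ m"
        by (rule power_mono[OF r]) simp
      moreover have "4 * s\<^sup>2 \<le> 4 * \<beta>\<^sup>2" using s2 by simp
      ultimately have "4 * s\<^sup>2 * (real (k - 1) * (tanh s)\<^sup>2) ^ m \<le> 4 * \<beta>\<^sup>2 * (real (k - 1) * (tanh \<beta>)\<^sup>2) ^ m"
        by (intro mult_mono) simp_all
      then have "real k * (4 * s\<^sup>2 * (real (k - 1) * (tanh s)\<^sup>2) ^ m) \<le> real k * (4 * \<beta>\<^sup>2 * (real (k - 1) * (tanh \<beta>)\<^sup>2) ^ m)"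
        by (rule mult_left_mono) simp
      then have "2 * (real k * (4 * s\<^sup>2 * (real (k - 1) * (tanh s)\<^sup>2) ^ m)) \<le> 2 * (real k * (4 * \<beta>\<^sup>2 * (real (k - 1) * (tanh \<beta>)\<^sup>2) ^ m))"
        by (rule mult_left_mono) simp
      then have frac: "2 * (real k * (4 * s\<^sup>2 * (real (k - 1) * (tanh s)\<^sup>2) ^ m)) / (1 - \<delta>)
          \<le> 2 * (real k * (4 * \<beta>\<^sup>2 * (real (k - 1) * (tanh \<beta>)\<^sup>2) ^ m)) / (1 - \<delta>)"
        using delta by (intro divide_right_mono) simp_all
      moreover have "0 \<le> 2 * (real k * (4 * \<beta>\<^sup>2 * (real (k - 1) * (tanh \<beta>)\<^sup>2) ^ m)) / (1 - \<delta>)"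
        using delta by (intro divide_nonneg_pos) simp_all
      moreover have "0 \<le> P.defect" by (simp add: P.defect_def)
      ultimately have "2 * (real k * (4 * s\<^sup>2 * (real (k - 1) * (tanh s)\<^sup>2) ^ m)) / (1 - \<delta>) * P.defect
          \<le> 2 * (real k * (4 * \<beta>\<^sup>2 * (real (k - 1) * (tanh \<beta>)\<^sup>2) ^ m)) / (1 - \<delta>) * exp (- 4 * \<beta> * real k / (1 - \<delta>))"
        using defect by (intro mult_mono)
      then show ?thesis unfolding P.corr_err_def edge_err_def by (rule mult_left_mono) simp
    qed
    then have "real k * P.corr_err m / 2 \<le> real k * edge_err k \<beta> \<delta> m / 2"
      by (intro divide_right_mono mult_left_mono) auto
    moreover have "\<bar>D' s\<bar> \<le> real k * P.corr_err m / 2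
       + real k * (1 - real (card {v \<in> ?V. tree_like k (Suc (Suc m)) G v}) / ?N)"
      using P.mean_energy_estimate[of m] unfolding D'_def Z_def P.Z_def .
    ultimately show ?thesis by linarith
  qed
  have lip: "norm (D \<beta> - D 0) \<le> ?B * norm (\<beta> - 0)"
  proof (rule field_differentiable_bound[of "{\<beta>..0}" D D'])
    show "(D has_field_derivative D' s) (at s within {\<beta>..0})" for s
      using der by (rule has_field_derivative_at_within)
    show "norm (D' s) \<le> ?B" if "s \<in> {\<beta>..0}" for s
      unfolding real_norm_def by (rule bound[OF that])
    show "convex {\<beta>..0}" by (rule convex_real_interval)
    show "\<beta> \<in> {\<beta>..0}" "0 \<in> {\<beta>..0}" using \<beta> by simp_all
  qed
  have "Z 0 = 2 ^ card ?V" by (simp add: Z_def card_spin_cfgs[OF fin])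
  then have lnZ: "ln (Z 0) = ?N * ln 2" by (simp add: ln_realpow)
  have D0: "D 0 = ln 2" unfolding D_def lnZ using N ne by simp
  have "D \<beta> - ln 2 = ln (Z \<beta>) / ?N - (ln 2 + real k / 2 * ln (cosh \<beta>))" by (simp add: D_def)
  with lip show ?thesis unfolding D0 real_norm_def diff_0_right by (simp only: Z_def)
qed

theorem mainTheorem4:
  fixes k :: nat and \<beta> :: real
    and S :: "nat set" and G :: "nat \<Rightarrow> nat pair_pre_digraph"
  assumes "k \<ge> 3" and "\<beta> \<le> 0"
    and "infinite S" and "0 \<notin> S"
    and "\<And>N. N \<in> S \<Longrightarrow> pair_graph (G N)"
    and "\<And>N. N \<in> S \<Longrightarrow> pverts (G N) = {..<N}"
    and "\<And>N. N \<in> S \<Longrightarrow> regular k (G N)"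
    and "converges_locally_to_tree k S G"
    and "\<exists>I :: real set. is_interval I \<and> bounded I \<and> diameter I < 1 \<and>
           (\<forall>N\<in>S. lambda_max (perp_part (weight_matrix N \<beta> (G N))) \<in> I \<and>
                   lambda_min (perp_part (weight_matrix N \<beta> (G N))) \<in> I)"
  shows "((\<lambda>N. ising_free_energy (weight_matrix N \<beta> (G N)) (0\<^sub>v N))
            \<longlongrightarrow> ln 2 + real k / 2 * ln (cosh \<beta>)) (inf sequentially (principal S))"
proof -
  let ?F = "inf sequentially (principal S)"
  let ?L = "ln 2 + real k / 2 * ln (cosh \<beta>)"
  have inS: "eventually (\<lambda>N. N \<in> S) ?F" by (simp add: eventually_inf_principal)
  have Npos: "0 < N" if "N \<in> S" for N using that assms(4) by (cases N) auto
  have fe: "ising_free_energy (weight_matrix N \<beta> (G N)) (0\<^sub>v N)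
      = ln (\<Sum>\<sigma>\<in>spin_cfgs {..<N}. exp (\<beta> * edge_energy {..<N} (parcs (G N)) \<sigma>)) / real N" if "N \<in> S" for N
    by (rule ising_free_energy_eq[OF assms(6)[OF that]])
  show ?thesis
  proof (cases "\<beta> = 0")
    case True
    have "eventually (\<lambda>N. ising_free_energy (weight_matrix N \<beta> (G N)) (0\<^sub>v N) = ?L) ?F"
      using inS
    proof (rule eventually_mono)
      fix N assume N: "N \<in> S"
      show "ising_free_energy (weight_matrix N \<beta> (G N)) (0\<^sub>v N) = ?L"
        unfolding fe[OF N] using True Npos[OF N] by (simp add: card_spin_cfgs ln_realpow)
    qed
    then show ?thesis by (rule tendsto_eventually)
  next
    case False
    then have \<beta>: "\<beta> < 0" using assms(2) by simp
    obtain I :: "real set" where I: "bounded I" "diameter I < 1"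
      "\<And>N. N \<in> S \<Longrightarrow> lambda_max (perp_part (weight_matrix N \<beta> (G N))) \<in> I"
      "\<And>N. N \<in> S \<Longrightarrow> lambda_min (perp_part (weight_matrix N \<beta> (G N))) \<in> I"
      using assms(9) by blast
    define \<delta> where "\<delta> = diameter I"
    have delta: "0 \<le> \<delta>" "\<delta> < 1" using diameter_ge_0[OF I(1)] I(2) by (auto simp: \<delta>_def)
    define hi where "hi = (\<lambda>N. lambda_max (perp_part (weight_matrix N \<beta> (G N))))"
    define lo where "lo = (\<lambda>N. lambda_min (perp_part (weight_matrix N \<beta> (G N))))"
    have width: "hi N - lo N \<le> \<delta>" if "N \<in> S" for N
      using diameter_bounded_bound[OF I(1) I(3)[OF that] I(4)[OF that]]
      by (simp add: \<delta>_def hi_def lo_def dist_real_def)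
    have forms: "lo N * sqnorm (pverts (G N)) x \<le> \<beta> * quad (pverts (G N)) (adj_perp (pverts (G N)) (parcs (G N)) k) x"
      "\<beta> * quad (pverts (G N)) (adj_perp (pverts (G N)) (parcs (G N)) k) x \<le> hi N * sqnorm (pverts (G N)) x"
      if "N \<in> S" for N x
      unfolding lo_def hi_def assms(6)[OF that]
      by (rule perp_form_bounds[OF assms(5)[OF that] assms(6)[OF that] assms(7)[OF that] Npos[OF that]])+
    define \<rho> where "\<rho> = real (k - 1) * (tanh \<beta>)\<^sup>2"
    have rho: "0 \<le> \<rho>" "\<rho> < 1"
    proof -
      show "0 \<le> \<rho>" by (simp add: \<rho>_def)
      obtain N where N: "N \<in> S" "2 * k \<le> N"
        using assms(3) unfolding infinite_nat_iff_unbounded_le by blast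
      have "sqrt (real k) * \<bar>\<beta>\<bar> \<le> hi N - lo N"
      proof (rule spectral_width_star[OF assms(5)[OF N(1)] assms(7)[OF N(1)] _ _ _ forms[OF N(1)]])
        show "0 \<in> pverts (G N)" using Npos[OF N(1)] assms(6)[OF N(1)] by simp
        show "2 * k \<le> card (pverts (G N))" using N assms(6)[OF N(1)] by simp
      qed (use assms(1) in simp)
      also have "\<dots> < 1" using width[OF N(1)] delta by linarith
      finally have "sqrt (real k) * \<bar>\<beta>\<bar> < 1" .
      then have "(sqrt (real k) * \<bar>\<beta>\<bar>)\<^sup>2 < 1" by (simp add: power_less_one_iff abs_square_less_1)
      then have kb: "real k * \<beta>\<^sup>2 < 1" by (simp add: power_mult_distrib)
      have "(tanh \<beta>)\<^sup>2 \<le> \<beta>\<^sup>2" using abs_tanh_le[of \<beta>] by (simp add: abs_le_square_iff)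
      then have "\<rho> \<le> real k * \<beta>\<^sup>2" unfolding \<rho>_def by (intro mult_mono) auto
      with kb show "\<rho> < 1" by simp
    qed
    have err0: "(\<lambda>m. real k * edge_err k \<beta> \<delta> m / 2 * \<bar>\<beta>\<bar>) \<longlonglongrightarrow> 0"
    proof -
      have pow: "(\<lambda>m. \<rho> ^ m) \<longlonglongrightarrow> 0" using rho by (intro LIMSEQ_power_zero) simp
      have "(\<lambda>m. real k * (2 * (2 * (real k * (4 * \<beta>\<^sup>2 * \<rho> ^ m)) / (1 - \<delta>) * exp (- 4 * \<beta> * real k / (1 - \<delta>)))) / 2 * \<bar>\<beta>\<bar>)
          \<longlonglongrightarrow> real k * (2 * (2 * (real k * (4 * \<beta>\<^sup>2 * 0)) / (1 - \<delta>) * exp (- 4 * \<beta> * real k / (1 - \<delta>)))) / 2 * \<bar>\<beta>\<bar>"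
        by (intro tendsto_mult tendsto_divide tendsto_const pow) (use delta in auto)
      then show ?thesis by (simp add: edge_err_def \<rho>_def)
    qed
    show ?thesis
    proof (rule tendstoI)
      fix e :: real assume e: "0 < e"
      have "0 < e / 2" using e by simp
      from order_tendstoD(2)[OF err0 this]
      obtain m where m: "real k * edge_err k \<beta> \<delta> m / 2 * \<bar>\<beta>\<bar> < e / 2"
        by (rule eventually_happens'[OF sequentially_bot, THEN exE])
      define fr where "fr = (\<lambda>N. real (card {v \<in> pverts (G N). tree_like k (Suc (Suc m)) (G N) v}) / real (card (pverts (G N))))"
      have "(fr \<longlongrightarrow> 1) ?F"
        using assms(8) unfolding converges_locally_to_tree_def fr_def by blast
      then have "((\<lambda>N. real k * (1 - fr N) * \<bar>\<beta>\<bar>) \<longlongrightarrow> real k * (1 - 1) * \<bar>\<beta>\<bar>) ?F"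
        by (intro tendsto_intros)
      then have "eventually (\<lambda>N. real k * (1 - fr N) * \<bar>\<beta>\<bar> < e / 2) ?F"
        by (rule order_tendstoD(2)) (use e in simp)
      with inS show "eventually (\<lambda>N. dist (ising_free_energy (weight_matrix N \<beta> (G N)) (0\<^sub>v N)) ?L < e) ?F"
      proof eventually_elim
        case (elim N)
        note N = elim(1)
        note V = assms(6)[OF N]
        have "\<bar>ising_free_energy (weight_matrix N \<beta> (G N)) (0\<^sub>v N) - ?L\<bar>
            \<le> (real k * edge_err k \<beta> \<delta> m / 2 + real k * (1 - fr N)) * \<bar>\<beta>\<bar>"
        proof -
          have "pverts (G N) \<noteq> {}" "1 \<le> k" "real (k - 1) * (tanh \<beta>)\<^sup>2 \<le> 1"
            using V Npos[OF N] assms(1) rho(2) by (auto simp: \<rho>_def)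
          from free_energy_estimate[OF assms(5)[OF N] assms(7)[OF N] this(1,2) \<beta> delta width[OF N] forms[OF N] this(3), of m]
          show ?thesis unfolding fr_def fe[OF N] V by simp
        qed
        also have "\<dots> = real k * edge_err k \<beta> \<delta> m / 2 * \<bar>\<beta>\<bar> + real k * (1 - fr N) * \<bar>\<beta>\<bar>"
          by (rule distrib_right)
        also have "\<dots> < e" using m elim(2) by linarith
        finally show ?case by (simp add: dist_real_def)
      qed
    qed
  qed
qed

end
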